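(* Consider a countable Markov chain on $\mathbb N_0$ whose transition matrix is a $(p+2)$-diagonal matrix of type II, $P_{II}$, admitting a positive stochastic bidiagonal factorization, or of type I, $P_I$, admitting the transposed version of such a factorization. Let $T$ be the associated monic banded Hessenberg matrix, let $\{B_n\}_{n=0}^\infty$ be its type II recursion polynomials. Then there are type I recursion polynomials $\{A^{(1)}_n,\dots,A^{(p)}_n\}_{n=0}^\infty$ of $T$ (for some initial condition matrix) and positive Lebesgue--Stieltjes measures $\mathrm d\psi_1,\dots,\mathrm d\psi_p$ on $[0,1]$, for which these are multiple orthogonal polynomials of types II and I, i.e. $\int_0^1\big(A^{(1)}_k\mathrm d\psi_1+\cdots+A^{(p)}_k\mathrm d\psi_p\big)B_l=\delta_{k,l}$ for $k,l\in\mathbb N_0$, such that the following holds (the formulas with subscript $II$ in the type II case, those with subscript $I$ in the type I case). (i) Karlin--McGregor representation formula: for $n,k,l\in\mathbb N_0$, $$\big((P_{II})^n\big)_{k,l}=\Theta_{II,k,l}\int_0^1\big(A^{(1)}_l(x)\mathrm d\psi_1(x)+\cdots+A^{(p)}_l(x)\mathrm d\psi_p(x)\big)x^nB_k(x),$$ $$\big((P_{I})^n\big)_{k,l}=\Theta_{I,l,k}\int_0^1\big(A^{(1)}_k(x)\mathrm d\psi_1(x)+\cdots+A^{(p)}_k(x)\mathrm d\psi_p(x)\big)x^nB_l(x).$$ (ii) Spectral representation of generating functions: for $|s|<1$ and $k,l\in\mathbb N_0$, put $G_{l,k}(s)=\int_0^1\big(A^{(1)}_l(x)\mathrm d\psi_1(x)+\cdots+A^{(p)}_l(x)\mathrm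 d\psi_p(x)\big)\frac{B_k(x)}{1-sx}$. The transition probability generating functions are $$(P_{II}(s))_{k,l}=\Theta_{II,k,l}\,G_{l,k}(s),\qquad (P_I(s))_{k,l}=\Theta_{I,l,k}\,G_{k,l}(s).$$ For $k\ne l$ the first passage generating functions are $$(F_{II}(s))_{k,l}=\Theta_{II,k,l}\frac{G_{l,k}(s)}{G_{l,l}(s)},\qquad (F_I(s))_{k,l}=\Theta_{I,l,k}\frac{G_{k,l}(s)}{G_{l,l}(s)},$$ and for $k=l$ they are given, for both types, by $F_{ll}(s)=1-\dfrac1{G_{l,l}(s)}$. (iii) The Markov chain is recurrent if and only if the integral $\displaystyle\int_0^1\frac{\mathrm d\psi_1(x)}{1-x}$ diverges; otherwise it is transient.
   Context: Fix an integer $p\ge1$; matrices are semi-infinite, indexed by $\mathbb N_0=\{0,1,2,\dots\}$. A type II banded stochastic matrix $P_{II}=(P_{i,j})$ is a nonnegative matrix with row sums $1$ and $P_{i,j}=0$ if $j>i+1$ or $j<i-p$; a type I one, $P_I$, is a nonnegative matrix with row sums $1$ and $P_{i,j}=0$ if $j>i+p$ or $j<i-1$. Positive stochastic bidiagonal factorization of $P_{II}$: $P_{II}=\Pi_1\cdots\Pi_p\Upsilon$ with each $\Pi_a$ a lower bidiagonal stochastic matrix ($(\Pi_a)_{0,0}=1$, $(\Pi_a)_{k,k-1}+(\Pi_a)_{k,k}=1$, $(\Pi_a)_{k,k-1}>0$, $(\Pi_a)_{k,k}>0$ for $k\ge1$) and $\Upsilon$ an upper bidiagonal stochastic matrix ($\Upsilon_{k,k}+\Upsilon_{k,k+1}=1$,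 $\Upsilon_{k,k}>0$, $\Upsilon_{k,k+1}>0$). The transposed version for $P_I$: $P_I=\Pi\Upsilon_p\cdots\Upsilon_1$ with $\Pi$ a lower bidiagonal stochastic matrix ($\Pi_{0,0}=1$, $\Pi_{k,k-1}+\Pi_{k,k}=1$, $\Pi_{k,k-1}>0$, $\Pi_{k,k}>0$ for $k\ge1$) and each $\Upsilon_a$, $a\in\{1,\dots,p\}$, an upper bidiagonal stochastic matrix ($(\Upsilon_a)_{k,k}+(\Upsilon_a)_{k,k+1}=1$, $(\Upsilon_a)_{k,k}>0$, $(\Upsilon_a)_{k,k+1}>0$ for $k\ge0$). Associated monic Hessenberg matrix $T$: in the type II case, with $\pi_{II,0}=1$, $\pi_{II,n}=\frac1{P_{0,1}P_{1,2}\cdots P_{n-1,n}}$ and $\pi_{II}=\mathrm{diag}(\pi_{II,0},\pi_{II,1},\dots)$, $T$ is defined by $P_{II}=\pi_{II}T\pi_{II}^{-1}$; in the type I case, with $\pi_{I,0}=1$, $\pi_{I,n}=\frac1{P_{1,0}P_{2,1}\cdots P_{n,n-1}}$ and $\pi_I=\mathrm{diag}(\pi_{I,0},\pi_{I,1},\dots)$, $T$ is defined by $P_I=\pi_I^{-1}T^\top\pi_I$. Then $T_{n,n+1}=1$, $T_{i,j}=0$ if $j>i+1$ or $j<i-p$, $T_{n,n-p}\ne0$ for $n\ge p$. Set $\Theta_{II,k,l}=\pi_{II,k}/\pi_{II,l}$ and $\Theta_{I,l,k}=\pi_{I,l}/\pi_{I,k}$. Type II recursion polynomials: $B_0=1$,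 $B_{n+1}=(x-T_{n,n})B_n-T_{n,n-1}B_{n-1}-\cdots-T_{n,n-p}B_{n-p}$ (terms with negative index are $0$). Type I recursion polynomials: given a real lower unitriangular $p\times p$ matrix $\nu$ (initial condition matrix), $A^{(a)}_{j}=\nu_{j+1,a}$ for $0\le j\le p-1$, $A^{(a)}_{-1}=0$, and $A^{(a)}_{n-1}+T_{n,n}A^{(a)}_n+\cdots+T_{n+p,n}A^{(a)}_{n+p}=xA^{(a)}_n$, $n\in\mathbb N_0$, $a\in\{1,\dots,p\}$. Generating functions: $(P(s))_{k,l}=\sum_{n\ge0}(P^n)_{k,l}s^n$ and $(F(s))_{k,l}=\sum_{n\ge1}f^n_{k,l}s^n$, where $f^n_{k,l}$ is the probability that, starting from $k$, the chain visits $l$ at time $n$ for the first time (at times $\ge1$); $F_{ll}(s)=(F(s))_{l,l}$. *)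

theory Defs
  imports "HOL-Probability.Probability" "HOL-Computational_Algebra.Polynomial"
begin

section \<open>Semi-infinite matrices\<close>

type_synonym smat = "nat \<Rightarrow> nat \<Rightarrow> real"

definition smat_one :: smat where
  "smat_one i j = of_bool (i = j)"

definition smat_diag :: "(nat \<Rightarrow> real) \<Rightarrow> smat" where
  "smat_diag d i j = (if i = j then d i else 0)"

definition smat_transpose :: "smat \<Rightarrow> smat" where
  "smat_transpose A i j = A j i"

text \<open>The product is only used when the left factor has finitely supported rows (all factors
  below are banded), so that the series is a finite sum.\<close>

definition smat_mult :: "smat \<Rightarrow> smat \<Rightarrow> smat" where
  "smat_mult A B i j = (\<Sum>k. A i k * B k j)"

definition smat_prod :: "smat list \<Rightarrow> smat" where
  "smat_prod As = foldr smat_mult As smat_one"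

primrec smat_pow :: "smat \<Rightarrow> nat \<Rightarrow> smat" where
  "smat_pow A 0 = smat_one"
| "smat_pow A (Suc n) = smat_mult A (smat_pow A n)"

section \<open>Banded stochastic matrices and their bidiagonal factorizations\<close>

definition stochastic :: "smat \<Rightarrow> bool" where
  "stochastic P \<longleftrightarrow> (\<forall>i j. 0 \<le> P i j) \<and> (\<forall>i. P i sums 1)"

definition type_II_stochastic :: "nat \<Rightarrow> smat \<Rightarrow> bool" where
  "type_II_stochastic p P \<longleftrightarrow>
     stochastic P \<and> (\<forall>i j. j > i + 1 \<or> i > j + p \<longrightarrow> P i j = 0)"

definition type_I_stochastic :: "nat \<Rightarrow> smat \<Rightarrow> bool" where
  "type_I_stochastic p P \<longleftrightarrow>
     stochastic P \<and> (\<forall>i j. j > i + p \<or> i > j + 1 \<longrightarrow> P i j = 0)"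

definition lower_bidiagonal_stochastic :: "smat \<Rightarrow> bool" where
  "lower_bidiagonal_stochastic L \<longleftrightarrow>
     (\<forall>i j. j \<noteq> i \<and> i \<noteq> Suc j \<longrightarrow> L i j = 0) \<and> L 0 0 = 1 \<and>
     (\<forall>k\<ge>1. L k (k - 1) + L k k = 1 \<and> L k (k - 1) > 0 \<and> L k k > 0)"

definition upper_bidiagonal_stochastic :: "smat \<Rightarrow> bool" where
  "upper_bidiagonal_stochastic U \<longleftrightarrow>
     (\<forall>i j. j \<noteq> i \<and> j \<noteq> Suc i \<longrightarrow> U i j = 0) \<and>
     (\<forall>k. U k k + U k (k + 1) = 1 \<and> U k k > 0 \<and> U k (k + 1) > 0)"

definition has_PSBF_II :: "nat \<Rightarrow> smat \<Rightarrow> bool" where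
  "has_PSBF_II p P \<longleftrightarrow> (\<exists>L U.
     (\<forall>a\<in>{1..p}. lower_bidiagonal_stochastic (L a)) \<and> upper_bidiagonal_stochastic U \<and>
     P = smat_prod (map L [1..<p + 1] @ [U]))"

definition has_PSBF_I :: "nat \<Rightarrow> smat \<Rightarrow> bool" where
  "has_PSBF_I p P \<longleftrightarrow> (\<exists>L U.
     lower_bidiagonal_stochastic L \<and> (\<forall>a\<in>{1..p}. upper_bidiagonal_stochastic (U a)) \<and>
     P = smat_prod (L # map U (rev [1..<p + 1])))"

section \<open>The monic Hessenberg matrix and its recursion polynomials\<close>

definition pi_II :: "smat \<Rightarrow> nat \<Rightarrow> real" where
  "pi_II P n = 1 / (\<Prod>i<n. P i (i + 1))"

definition pi_I :: "smat \<Rightarrow> nat \<Rightarrow> real" where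
  "pi_I P n = 1 / (\<Prod>i<n. P (i + 1) i)"

definition hessenberg_II :: "smat \<Rightarrow> smat \<Rightarrow> bool" where
  "hessenberg_II P T \<longleftrightarrow>
     P = smat_mult (smat_mult (smat_diag (pi_II P)) T) (smat_diag (\<lambda>n. inverse (pi_II P n)))"

definition hessenberg_I :: "smat \<Rightarrow> smat \<Rightarrow> bool" where
  "hessenberg_I P T \<longleftrightarrow>
     P = smat_mult (smat_mult (smat_diag (\<lambda>n. inverse (pi_I P n))) (smat_transpose T))
           (smat_diag (pi_I P))"

definition Theta_II :: "smat \<Rightarrow> nat \<Rightarrow> nat \<Rightarrow> real" where
  "Theta_II P k l = pi_II P k / pi_II P l"

definition Theta_I :: "smat \<Rightarrow> nat \<Rightarrow> nat \<Rightarrow> real" where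
  "Theta_I P l k = pi_I P l / pi_I P k"

fun type_II_poly :: "nat \<Rightarrow> smat \<Rightarrow> nat \<Rightarrow> real poly" where
  "type_II_poly p T 0 = 1"
| "type_II_poly p T (Suc n) =
     [:- T n n, 1:] * type_II_poly p T n
     - (\<Sum>k\<in>{1..p}. if k \<le> n then smult (T n (n - k)) (type_II_poly p T (n - k)) else 0)"

text \<open>Indices of \<open>\<nu>\<close> run over \<open>{1..p}\<close>; entries outside this range are never used.\<close>

definition initial_condition_matrix :: "nat \<Rightarrow> (nat \<Rightarrow> nat \<Rightarrow> real) \<Rightarrow> bool" where
  "initial_condition_matrix p \<nu> \<longleftrightarrow>
     (\<forall>i\<in>{1..p}. \<nu> i i = 1 \<and> (\<forall>j\<in>{1..p}. i < j \<longrightarrow> \<nu> i j = 0))"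

text \<open>\<open>A a n\<close> is the polynomial with upper index \<open>a \<in> {1..p}\<close> and lower index \<open>n\<close>.
  When \<open>T (n + p) n \<noteq> 0\<close> for all \<open>n\<close>, it is uniquely determined by \<open>\<nu>\<close>.\<close>

definition type_I_polys ::
    "nat \<Rightarrow> smat \<Rightarrow> (nat \<Rightarrow> nat \<Rightarrow> real) \<Rightarrow> (nat \<Rightarrow> nat \<Rightarrow> real poly) \<Rightarrow> bool" where
  "type_I_polys p T \<nu> A \<longleftrightarrow> (\<forall>a\<in>{1..p}.
     (\<forall>j<p. A a j = [:\<nu> (j + 1) a:]) \<and>
     (\<forall>n. (if n = 0 then 0 else A a (n - 1)) + (\<Sum>k=0..p. smult (T (n + k) n) (A a (n + k)))
            = [:0, 1:] * A a n))"

section \<open>Lebesgue--Stieltjes measures on the unit interval\<close>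

text \<open>The measure is \<open>interval_measure \<psi>\<close>. The value \<open>0\<close> on the negative axis allows an atom
  of mass \<open>\<psi> 0\<close> at the left endpoint.\<close>

definition stieltjes_01 :: "(real \<Rightarrow> real) \<Rightarrow> bool" where
  "stieltjes_01 \<psi> \<longleftrightarrow> mono \<psi> \<and> (\<forall>x. continuous (at_right x) \<psi>) \<and>
     (\<forall>x<0. \<psi> x = 0) \<and> (\<forall>x\<ge>1. \<psi> x = \<psi> 1)"

definition form_integral ::
    "nat \<Rightarrow> (nat \<Rightarrow> nat \<Rightarrow> real poly) \<Rightarrow> (nat \<Rightarrow> real \<Rightarrow> real) \<Rightarrow> nat \<Rightarrow>
     (real \<Rightarrow> 'b) \<Rightarrow> 'b::{banach, second_countable_topology}" where
  "form_integral p A \<psi> l g =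
     (\<Sum>a=1..p. LINT x:{0..1}|interval_measure (\<psi> a). poly (A a l) x *\<^sub>R g x)"

definition multiple_orthogonal ::
    "nat \<Rightarrow> (nat \<Rightarrow> nat \<Rightarrow> real poly) \<Rightarrow> (nat \<Rightarrow> real poly) \<Rightarrow> (nat \<Rightarrow> real \<Rightarrow> real) \<Rightarrow> bool" where
  "multiple_orthogonal p A B \<psi> \<longleftrightarrow>
     (\<forall>k l. form_integral p A \<psi> k (poly (B l)) = (if k = l then 1 else 0))"

definition resolvent_integral ::
    "nat \<Rightarrow> (nat \<Rightarrow> nat \<Rightarrow> real poly) \<Rightarrow> (nat \<Rightarrow> real poly) \<Rightarrow> (nat \<Rightarrow> real \<Rightarrow> real) \<Rightarrow>
     nat \<Rightarrow> nat \<Rightarrow> complex \<Rightarrow> complex" where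
  "resolvent_integral p A B \<psi> l k s =
     form_integral p A \<psi> l (\<lambda>x. complex_of_real (poly (B k) x) / (1 - s * complex_of_real x))"

section \<open>Markov chains\<close>

text \<open>\<open>M k\<close> is the law under which the process \<open>X\<close> starts at the state \<open>k\<close>.\<close>

definition markov_chain ::
    "smat \<Rightarrow> (nat \<Rightarrow> 'w measure) \<Rightarrow> (nat \<Rightarrow> 'w \<Rightarrow> nat) \<Rightarrow> bool" where
  "markov_chain P M X \<longleftrightarrow> (\<forall>k.
     prob_space (M k) \<and>
     (\<forall>n. X n \<in> measurable (M k) (count_space UNIV)) \<and>
     (AE \<omega> in M k. X 0 \<omega> = k) \<and>
     (\<forall>n x j. \<P>(\<omega> in M k. \<forall>m\<le>n. X m \<omega> = x m) > 0 \<longrightarrow>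
        \<P>(\<omega> in M k. X (Suc n) \<omega> = j \<bar> \<forall>m\<le>n. X m \<omega> = x m) = P (x n) j))"

definition first_passage ::
    "(nat \<Rightarrow> 'w measure) \<Rightarrow> (nat \<Rightarrow> 'w \<Rightarrow> nat) \<Rightarrow> nat \<Rightarrow> nat \<Rightarrow> nat \<Rightarrow> real" where
  "first_passage M X n k l = \<P>(\<omega> in M k. X n \<omega> = l \<and> (\<forall>m. 1 \<le> m \<and> m < n \<longrightarrow> X m \<omega> \<noteq> l))"

definition transition_gf :: "smat \<Rightarrow> complex \<Rightarrow> nat \<Rightarrow> nat \<Rightarrow> complex" where
  "transition_gf P s k l = (\<Sum>n. complex_of_real (smat_pow P n k l) * s ^ n)"

definition first_passage_gf ::
    "(nat \<Rightarrow> 'w measure) \<Rightarrow> (nat \<Rightarrow> 'w \<Rightarrow> nat) \<Rightarrow> complex \<Rightarrow> nat \<Rightarrow> nat \<Rightarrow> complex" where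
  "first_passage_gf M X s k l =
     (\<Sum>n. complex_of_real (first_passage M X (Suc n) k l) * s ^ Suc n)"

definition return_prob :: "(nat \<Rightarrow> 'w measure) \<Rightarrow> (nat \<Rightarrow> 'w \<Rightarrow> nat) \<Rightarrow> nat \<Rightarrow> real" where
  "return_prob M X l = \<P>(\<omega> in M l. \<exists>n\<ge>1. X n \<omega> = l)"

definition recurrent :: "(nat \<Rightarrow> 'w measure) \<Rightarrow> (nat \<Rightarrow> 'w \<Rightarrow> nat) \<Rightarrow> bool" where
  "recurrent M X \<longleftrightarrow> (\<forall>l. return_prob M X l = 1)"

definition transient :: "(nat \<Rightarrow> 'w measure) \<Rightarrow> (nat \<Rightarrow> 'w \<Rightarrow> nat) \<Rightarrow> bool" where
  "transient M X \<longleftrightarrow> (\<forall>l. return_prob M X l < 1)"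

text \<open>The quotient is taken in \<open>ennreal\<close>, where \<open>1 / 0 = \<infinity>\<close>, so that an atom of the measure
  at \<open>1\<close> makes the integral diverge (in \<open>real\<close> it would contribute \<open>0\<close>).\<close>

definition integral_diverges :: "(real \<Rightarrow> real) \<Rightarrow> bool" where
  "integral_diverges \<psi> \<longleftrightarrow>
     (\<integral>\<^sup>+x\<in>{0..1}. (1 / ennreal (1 - x)) \<partial>interval_measure \<psi>) = \<infinity>"

end

theory Submission
  imports Defs "HOL-Complex_Analysis.Complex_Analysis" "HOL-Real_Asymp.Real_Asymp"
begin

text \<open>Let \<open>Q\<close> be \<open>P\<close> in the type II case and the transpose of \<open>P\<close> in the type I case. In both cases
\<open>Q = L\<^sub>1 \<cdots> L\<^sub>p U\<close> with positive bidiagonal factors, the rows of \<open>Q\<^sup>m L\<^sub>1 \<cdots> L\<^sub>i\<close> or of its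
transpose are probability vectors, and \<open>T\<close> is conjugate to \<open>Q\<close> by a positive diagonal matrix. The two
halves of the theorem are therefore one spectral theorem about \<open>Q\<close>, read in two ways.

Both families of polynomials are generated by the recurrences of \<open>T\<close>,
so \<open>\<integral> (\<Sum>\<^sub>a A\<^sup>(\<^sup>a\<^sup>)\<^sub>l d\<psi>\<^sub>a) x\<^sup>n B\<^sub>k = (T\<^sup>n)\<^sub>k\<^sub>l\<close> holds for all \<open>k, l\<close> as soon as it holds for \<open>k = 0\<close> and
\<open>l < p\<close>, where the \<open>A\<^sup>(\<^sup>a\<^sup>)\<^sub>l\<close> are the constants of \<open>\<nu>\<close> (\<open>biorthogonality_from_first_row\<close>). The column
\<open>L\<^sub>1 \<cdots> L\<^sub>a\<^sub>-\<^sub>1 e\<^sub>0\<close> is supported on the indices below \<open>a\<close> and its last entry is positive. Hence, if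
\<open>\<psi>\<^sub>a\<close> has the moments \<open>(Q\<^sup>n L\<^sub>1 \<cdots> L\<^sub>a\<^sub>-\<^sub>1)\<^sub>0\<^sub>0\<close> up to a normalizing factor, these moments are
unitriangular combinations of the numbers \<open>(T\<^sup>n)\<^sub>0\<^sub>j\<close>, \<open>j < a\<close>, and the inverse of that unitriangular
matrix is a valid \<open>\<nu>\<close> (\<open>spectral_favard\<close>).

It remains to see that these numbers are moments of a positive measure. Applying the bidiagonal factors one at a time to the row vector \<open>e\<^sub>0\<close> and
listing the entries that arise in one sequence gives power series \<open>S\<^sub>0 = 1, S\<^sub>1, S\<^sub>2, \<dots>\<close> in \<open>t\<close> with
\<open>S\<^sub>n = \<alpha>\<^sub>n S\<^sub>n\<^sub>-\<^sub>1 + \<beta>\<^sub>n t S\<^sub>n\<^sub>+\<^sub>p\<close>, all coefficients positive, and \<open>S\<^sub>a\<close> is the generating function of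
\<open>(Q\<^sup>n L\<^sub>1 \<cdots> L\<^sub>a\<^sub>-\<^sub>1)\<^sub>0\<^sub>0\<close> for \<open>1 \<le> a \<le> p\<close>: a branched continued fraction. After truncation the series are
quotients of polynomials. For \<open>t\<close> in the upper half plane the arguments of \<open>S\<^sub>0, S\<^sub>1, \<dots>\<close> increase, and
the argument of \<open>t S\<^sub>n\<^sub>+\<^sub>p\<close> stays less than \<open>\<pi>\<close> ahead of that of \<open>S\<^sub>n\<close>; this property passes through the
recurrence from index \<open>n\<close> to \<open>n - 1\<close> (\<open>backward_recurrence_args\<close>). So \<open>t S\<^sub>a\<close> maps the upper half plane
into itself. On the real axis below \<open>1\<close> the truncated \<open>S\<^sub>a\<close> has no poles, because its coefficients are
bounded and the recurrence keeps its sign for negative \<open>t\<close>. A function of this kind generates the moments of a positive measure on \<open>[0, 1]\<close>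
(\<open>slit_plane_moments\<close>), and Helly's theorem removes the truncation (\<open>measure_with_moments\<close>).

The formulas for the transition probabilities are the case \<open>(T\<^sup>n)\<^sub>k\<^sub>l\<close> above. The
decomposition of a path at its first visit to \<open>l\<close> (\<open>renewal_equation\<close>) gives the first passage generating
functions, and it shows that the chain returns to \<open>l\<close> with probability \<open>1\<close> exactly if \<open>\<Sum>\<^sub>n (P\<^sup>n)\<^sub>l\<^sub>l\<close>
diverges (\<open>return_prob_less_1_iff\<close>). All states communicate, so it suffices to look at \<open>l = 0\<close>, where the
sum is \<open>\<integral> d\<psi>\<^sub>1 / (1 - x)\<close>.\<close>

section \<open>Arguments in the branched recurrence\<close>

text \<open>Since \<open>- cis d = cis (d - \<pi>)\<close>, the difference is a combination of \<open>cis 0\<close> and \<open>cis (d - \<pi>)\<close> with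
nonnegative coefficients, so it lies in the sector between these two directions; the bound \<open>d - \<pi> < \<psi>\<close> is
strict because the coefficient of \<open>cis 0\<close> is positive.\<close>

lemma cis_minus_scaled_cis:
  fixes r b d :: real
  assumes "r > 0" "b \<ge> 0" "0 < d" "d < pi"
  obtains s \<psi> where "s > 0" "d - pi < \<psi>" "\<psi> \<le> 0"
    "of_real r - of_real b * cis d = of_real s * cis \<psi>"
proof (cases "b = 0")
  case True
  show ?thesis
    by (rule that[of r 0]) (use True assms in auto)
next
  case False
  hence b: "b > 0" using assms by simp
  define z where "z = of_real r - of_real b * cis d"
  have im: "Im z = - b * sin d" by (simp add: z_def)
  have re: "Re z = r - b * cos d" by (simp add: z_def)
  have "sin d > 0" using assms by (simp add: sin_gt_zero)
  hence neg: "Im z < 0" using im b by simp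
  hence z0: "z \<noteq> 0" by auto
  have arg: "- pi < Arg z" "Arg z \<le> pi" by (auto simp: mpi_less_Arg Arg_le_pi)
  have arg0: "Arg z < 0" using neg by (simp add: Arg_neg_iff)
  \<comment> \<open>multiplying by \<open>cis (pi - d)\<close> leaves the sum in the upper half plane\<close>
  have "Im (z * cis (pi - d)) = r * sin d"
    by (simp add: im re sin_diff cos_diff algebra_simps)
  hence pos: "Im (z * cis (pi - d)) > 0" using \<open>sin d > 0\<close> assms by simp
  have polar: "z = of_real (norm z) * cis (Arg z)" using z0 by (simp add: rcis_cmod_Arg flip: rcis_def)
  have "z * cis (pi - d) = of_real (norm z) * cis (Arg z + (pi - d))"
    by (subst polar) (simp only: mult.assoc cis_mult)
  hence "norm z * sin (Arg z + (pi - d)) > 0" using pos by simp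
  hence s: "sin (Arg z + (pi - d)) > 0" using z0 by (simp add: zero_less_mult_iff)
  have "Arg z + (pi - d) > 0"
  proof (rule ccontr)
    assume "\<not> ?thesis"
    hence "0 \<le> - (Arg z + (pi - d))" "- (Arg z + (pi - d)) \<le> pi" using arg assms by auto
    hence "sin (- (Arg z + (pi - d))) \<ge> 0" by (rule sin_ge_zero)
    thus False using s by (simp only: sin_minus)
  qed
  moreover have "of_real r - of_real b * cis d = of_real (norm z) * cis (Arg z)"
    by (rule trans[OF z_def[symmetric] polar])
  ultimately show ?thesis
    using z0 arg0 by (intro that[of "norm z" "Arg z"]) simp_all
qed

text \<open>A continuous choice of arguments \<open>\<phi>\<close> along a solution that is started at its top index \<open>N\<close> and continued
downwards. Two properties are carried along: the arguments increase with the index, and those of \<open>t g\<^sub>m\<^sub>+\<^sub>p\<close>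
are ahead of those of \<open>g\<^sub>m\<close> by less than \<open>\<pi>\<close>. By the second one the two
terms of the difference in the recurrence have different directions and cannot cancel, and the sector bound
above turns it into the same property one index lower. Above \<open>N\<close>, where \<open>g\<close> vanishes, \<open>\<phi>\<close> has no meaning as an argument but is still
required to satisfy both inequalities, which spares a case distinction at the upper end.\<close>

lemma backward_recurrence_args:
  fixes g :: "nat \<Rightarrow> complex" and \<alpha> \<beta> :: "nat \<Rightarrow> real"
  assumes t: "t = of_real \<rho> * cis \<tau>" "\<rho> > 0" "0 < \<tau>" "\<tau> < pi"
    and \<alpha>: "\<And>n. n \<ge> 1 \<Longrightarrow> \<alpha> n > 0" and \<beta>: "\<And>n. n \<ge> 1 \<Longrightarrow> \<beta> n \<ge> 0"
    and gN: "g N = 1" and g0: "\<And>n. n > N \<Longrightarrow> g n = 0"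
    and rec: "\<And>n. n \<in> {1..N} \<Longrightarrow> of_real (\<alpha> n) * g (n - 1) = g n - of_real (\<beta> n) * t * g (n + p)"
    and d: "d \<le> N"
  shows "\<exists>\<phi>. (\<forall>m\<ge>N - d. \<phi> m \<le> \<phi> (Suc m)) \<and>
     (\<forall>m\<in>{N - d..N}. \<exists>r>0. g m = of_real r * cis (\<phi> m)) \<and>
     (\<forall>m\<ge>N - d. \<phi> (m + p) + \<tau> < \<phi> m + pi)"
  using d
proof (induction d)
  case 0
  show ?case
    by (rule exI[of _ "\<lambda>_. 0"]) (use gN t in \<open>auto intro!: exI[of _ 1]\<close>)
next
  case (Suc d)
  define n where "n = N - d"
  have n: "n \<ge> 1" "n \<le> N" "N - Suc d = n - 1" using Suc.prems by (auto simp: n_def)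
  have "d \<le> N" using Suc.prems by simp
  from Suc.IH[OF this] obtain \<phi> where mono: "\<forall>m\<ge>n. \<phi> m \<le> \<phi> (Suc m)"
    and polar: "\<forall>m\<in>{n..N}. \<exists>r>0. g m = of_real r * cis (\<phi> m)"
    and window: "\<forall>m\<ge>n. \<phi> (m + p) + \<tau> < \<phi> m + pi"
    unfolding n_def by blast
  obtain r where r: "r > 0" "g n = of_real r * cis (\<phi> n)"
    using bspec[OF polar, of n] n by auto
  obtain r' where r': "r' \<ge> 0" "g (n + p) = of_real r' * cis (\<phi> (n + p))"
  proof (cases "n + p \<le> N")
    case True
    then obtain r' where "r' > 0" "g (n + p) = of_real r' * cis (\<phi> (n + p))"
      using bspec[OF polar, of "n + p"] by auto
    thus ?thesis by (intro that[of r']) simp_all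
  next
    case False
    thus ?thesis using g0[of "n + p"] that[of 0] by simp
  qed
  have mono': "\<phi> n \<le> \<phi> (n + k)" for k
  proof (induction k)
    case (Suc k)
    thus ?case using mono[rule_format, of "n + k"] by simp
  qed simp
  define \<delta> where "\<delta> = \<tau> + \<phi> (n + p) - \<phi> n"
  have \<delta>: "0 < \<delta>" "\<delta> < pi" using mono'[of p] window[rule_format, of n] t by (auto simp: \<delta>_def)
  have nonneg: "\<beta> n * \<rho> * r' \<ge> 0" using \<beta>[of n] n t r' by simp
  obtain s \<psi> where s: "s > 0" "\<delta> - pi < \<psi>" "\<psi> \<le> 0"
    "of_real r - of_real (\<beta> n * \<rho> * r') * cis \<delta> = of_real s * cis \<psi>"
    using cis_minus_scaled_cis[OF r(1) nonneg \<delta>] .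
  have "of_real (\<alpha> n) * g (n - 1) = g n - of_real (\<beta> n) * t * g (n + p)"
    using rec[of n] n by auto
  also have "\<dots> = cis (\<phi> n) * (of_real r - of_real (\<beta> n * \<rho> * r') * cis \<delta>)"
  proof -
    have *: "cis \<tau> * cis (\<phi> (n + p)) = cis (\<phi> n) * cis \<delta>"
      by (simp add: cis_mult \<delta>_def)
    have "of_real (\<beta> n) * t * g (n + p) =
        of_real (\<beta> n * \<rho> * r') * (cis \<tau> * cis (\<phi> (n + p)))"
      unfolding r'(2) t(1) by (simp only: of_real_mult ac_simps)
    thus ?thesis unfolding * r(2) by (simp only: right_diff_distrib ac_simps)
  qed
  also have "\<dots> = of_real s * cis (\<phi> n + \<psi>)" unfolding s(4) cis_mult[symmetric] by (simp only: ac_simps)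
  finally have gn: "g (n - 1) = of_real (s / \<alpha> n) * cis (\<phi> n + \<psi>)"
    using \<alpha>[of n] n by (simp add: field_simps)
  define \<phi>' where "\<phi>' = \<phi>(n - 1 := \<phi> n + \<psi>)"
  have old: "\<phi>' m = \<phi> m" if "m \<ge> n" for m using that n by (auto simp: \<phi>'_def)
  have new: "\<phi>' (n - 1) = \<phi> n + \<psi>" by (simp add: \<phi>'_def)
  have cases: "m = n - 1 \<or> m \<ge> n" if "m \<ge> n - 1" for m using that by linarith
  show ?case unfolding n(3)
  proof (intro exI[of _ \<phi>'] conjI allI ballI impI)
    fix m assume "n - 1 \<le> m"
    then consider "m = n - 1" | "m \<ge> n" using cases[of m] by auto
    thus "\<phi>' m \<le> \<phi>' (Suc m)"
    proof cases
      case 1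
      thus ?thesis unfolding 1 new using s(3) n(1) old[of n] by simp
    next
      case 2
      thus ?thesis using old[of m] old[of "Suc m"] mono by simp
    qed
  next
    fix m assume "m \<in> {n - 1..N}"
    then consider "m = n - 1" | "m \<in> {n..N}" using cases[of m] by auto
    thus "\<exists>r>0. g m = complex_of_real r * cis (\<phi>' m)"
    proof cases
      case 1
      thus ?thesis unfolding 1 new using gn s(1) \<alpha>[of n] n(1)
        by (intro exI[of _ "s / \<alpha> n"]) simp
    next
      case 2
      thus ?thesis using polar old[of m] by simp
    qed
  next
    fix m assume m: "n - 1 \<le> m"
    have shift: "\<phi>' (n - 1 + p) \<le> \<phi> (n + p)"
    proof (cases "p = 0")
      case True thus ?thesis using new s by simp
    next
      case False
      thus ?thesis using old[of "n - 1 + p"] mono[rule_format, of "n - 1 + p"] n by simp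
    qed
    from m consider "m = n - 1" | "m \<ge> n" using cases[of m] by auto
    thus "\<phi>' (m + p) + \<tau> < \<phi>' m + pi"
    proof cases
      case 1
      thus ?thesis using shift s(2) unfolding 1 new \<delta>_def
        by linarith
    next
      case 2
      thus ?thesis using window old[of m] old[of "m + p"] by simp
    qed
  qed
qed

text \<open>For \<open>a \<le> p\<close> the argument of \<open>t g\<^sub>a / g\<^sub>0\<close> lies between that of \<open>t\<close> and \<open>\<tau> + \<phi>\<^sub>p - \<phi>\<^sub>0 < \<pi>\<close>.\<close>

lemma backward_recurrence_upper_half_plane:
  fixes g :: "nat \<Rightarrow> complex" and \<alpha> \<beta> :: "nat \<Rightarrow> real"
  assumes t: "Im t > 0"
    and \<alpha>: "\<And>n. n \<ge> 1 \<Longrightarrow> \<alpha> n > 0" and \<beta>: "\<And>n. n \<ge> 1 \<Longrightarrow> \<beta> n \<ge> 0"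
    and gN: "g N = 1" and g0: "\<And>n. n > N \<Longrightarrow> g n = 0"
    and rec: "\<And>n. n \<in> {1..N} \<Longrightarrow> of_real (\<alpha> n) * g (n - 1) = g n - of_real (\<beta> n) * t * g (n + p)"
    and a: "a \<le> p" "a \<le> N"
  shows "g 0 \<noteq> 0" "Im (t * (g a / g 0)) > 0"
proof -
  have t0: "t \<noteq> 0" using t by auto
  define \<tau> where "\<tau> = Arg t"
  have \<tau>: "0 < \<tau>" "\<tau> < pi" using t Arg_lt_pi by (auto simp: \<tau>_def)
  have t': "t = of_real (norm t) * cis \<tau>"
    using t0 by (simp add: \<tau>_def rcis_cmod_Arg flip: rcis_def)
  from backward_recurrence_args[OF t' _ \<tau> \<alpha> \<beta> gN g0 rec, of N] t0
  obtain \<phi> where "\<forall>m\<ge>N - N. \<phi> m \<le> \<phi> (Suc m)"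
    "\<forall>m\<in>{N - N..N}. \<exists>r>0. g m = of_real r * cis (\<phi> m)"
    "\<forall>m\<ge>N - N. \<phi> (m + p) + \<tau> < \<phi> m + pi" by auto
  hence mono: "\<And>m. \<phi> m \<le> \<phi> (Suc m)"
    and polar: "\<And>m. m \<le> N \<Longrightarrow> \<exists>r>0. g m = of_real r * cis (\<phi> m)"
    and window: "\<And>m. \<phi> (m + p) + \<tau> < \<phi> m + pi" by simp_all
  obtain r0 where r0: "r0 > 0" "g 0 = of_real r0 * cis (\<phi> 0)" using polar[of 0] by auto
  obtain ra where ra: "ra > 0" "g a = of_real ra * cis (\<phi> a)" using polar[of a] a by auto
  show "g 0 \<noteq> 0" using r0 by simp
  have "incseq \<phi>" using mono by (rule incseq_SucI)
  hence "\<phi> 0 \<le> \<phi> a" "\<phi> a \<le> \<phi> p" using a by (auto simp: incseq_def)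
  hence \<delta>: "0 < \<tau> + \<phi> a - \<phi> 0" "\<tau> + \<phi> a - \<phi> 0 < pi" using window[of 0] \<tau> by auto
  define c where "c = norm t * ra / r0"
  have "t * (g a / g 0) = of_real c * (cis \<tau> * (cis (\<phi> a) / cis (\<phi> 0)))"
    unfolding c_def by (subst t', unfold r0(2) ra(2)) simp
  also have "cis \<tau> * (cis (\<phi> a) / cis (\<phi> 0)) = cis (\<tau> + \<phi> a - \<phi> 0)"
    by (simp add: cis_mult cis_divide algebra_simps)
  finally have "Im (t * (g a / g 0)) = c * sin (\<tau> + \<phi> a - \<phi> 0)"
    by simp
  moreover have "sin (\<tau> + \<phi> a - \<phi> 0) > 0" using \<delta> by (rule sin_gt_zero)
  moreover have "c > 0" using t0 r0 ra by (simp add: c_def)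
  ultimately show "Im (t * (g a / g 0)) > 0" by simp
qed

section \<open>Moments of functions on the slit plane\<close>

text \<open>Measures on \<open>[0, 1]\<close> are tight, so a subsequence converges weakly, and on \<open>[0, 1]\<close> the powers agree with
bounded continuous functions.\<close>

lemma moments_weak_limit:
  fixes M :: "nat \<Rightarrow> real measure"
  assumes dist: "\<And>j. real_distribution (M j)"
    and supp: "\<And>j. AE x in M j. x \<in> {0..1}"
    and lim: "\<And>n. (\<lambda>j. \<integral>x. x ^ n \<partial>M j) \<longlonglongrightarrow> m n"
  shows "\<exists>M'. real_distribution M' \<and> (AE x in M'. x \<in> {0..1}) \<and> (\<forall>n. (\<integral>x. x ^ n \<partial>M') = m n)"
proof -
  interpret M: real_distribution "M j" for j by (rule dist)
  have mass: "measure (M j) {-1<..1} = 1" for j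
  proof (subst M.prob_eq_1)
    show "AE x in M j. x \<in> {-1<..1}" using supp[of j] by eventually_elim auto
  qed auto
  have "tight M"
    unfolding tight_def
  proof (intro conjI allI impI)
    fix \<epsilon> :: real assume "\<epsilon> > 0"
    thus "\<exists>a b. a < b \<and> (\<forall>n. measure (M n) {a<..b} > 1 - \<epsilon>)"
      using mass by (intro exI[of _ "-1"] exI[of _ 1]) auto
  qed (rule dist)
  from tight_imp_convergent_subsubsequence[OF this strict_mono_id]
  obtain r M' where r: "strict_mono (r :: nat \<Rightarrow> nat)" and M': "real_distribution M'"
    and conv: "weak_conv_m (M \<circ> id \<circ> r) M'" by blast
  interpret M': real_distribution M' by (rule M')
  have conv_int: "(\<lambda>j. \<integral>x. f x \<partial>M (r j)) \<longlonglongrightarrow> (\<integral>x. f x \<partial>M')"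
    if "\<And>x. isCont f x" "\<And>x. norm (f x) \<le> B" for f :: "real \<Rightarrow> real" and B
    using weak_conv_imp_integral_bdd_continuous_conv[of "M \<circ> id \<circ> r" M' f B] that conv dist M'
    by (simp add: o_def)
  \<comment> \<open>the distance to the unit interval, truncated, has integral \<open>0\<close> in the limit\<close>
  define clamp :: "real \<Rightarrow> real" where "clamp x = min 1 (max 0 x)" for x
  define gap :: "real \<Rightarrow> real" where "gap x = min 1 \<bar>x - clamp x\<bar>" for x
  have cont: "isCont clamp x" "isCont gap x" for x
    unfolding clamp_def gap_def by (intro continuous_intros)+
  have [measurable]: "clamp \<in> borel_measurable borel" "gap \<in> borel_measurable borel"
    unfolding gap_def clamp_def by measurable
  have clamp_eq: "x \<in> {0..1} \<Longrightarrow> clamp x = x" for x by (auto simp: clamp_def)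
  have gap_eq: "gap x = 0 \<longleftrightarrow> x \<in> {0..1}" for x
    by (auto simp: gap_def clamp_def min_def max_def)
  have "(\<integral>x. gap x \<partial>M (r j)) = (\<integral>x. 0 \<partial>M (r j))" for j
    by (rule integral_cong_AE) (use supp[of "r j"] in \<open>auto elim!: eventually_mono simp: gap_eq\<close>)
  moreover have "(\<lambda>j. \<integral>x. gap x \<partial>M (r j)) \<longlonglongrightarrow> (\<integral>x. gap x \<partial>M')"
  proof (rule conv_int[of _ 1])
    show "norm (gap x) \<le> 1" for x by (simp add: gap_def)
  qed (rule cont)
  ultimately have "(\<integral>x. gap x \<partial>M') = 0"
    by (simp add: LIMSEQ_const_iff)
  moreover have "integrable M' gap"
    by (rule M'.integrable_const_bound[of _ 1]) (auto simp: gap_def)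
  ultimately have "AE x in M'. gap x = 0"
    by (subst (asm) integral_nonneg_eq_0_iff_AE) (auto simp: gap_def)
  hence supp': "AE x in M'. x \<in> {0..1}" by (simp only: gap_eq)
  have "(\<integral>x. x ^ n \<partial>M') = m n" for n
  proof -
    have "(\<integral>x. clamp x ^ n \<partial>M (r j)) = (\<integral>x. x ^ n \<partial>M (r j))" for j
      proof (rule integral_cong_AE)
      show "AE x in M (r j). clamp x ^ n = x ^ n"
        using supp[of "r j"] by eventually_elim (simp add: clamp_eq)
    qed auto
    moreover have "(\<lambda>j. \<integral>x. clamp x ^ n \<partial>M (r j)) \<longlonglongrightarrow> (\<integral>x. clamp x ^ n \<partial>M')"
      by (rule conv_int[of _ 1])
         (use cont in \<open>auto intro!: continuous_intros power_le_one simp: clamp_def\<close>)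
    moreover have "(\<lambda>j. \<integral>x. x ^ n \<partial>M (r j)) \<longlonglongrightarrow> m n"
      using LIMSEQ_subseq_LIMSEQ[OF lim r] by (simp add: o_def)
    ultimately have "(\<integral>x. clamp x ^ n \<partial>M') = m n"
      using LIMSEQ_unique by simp
    moreover have "(\<integral>x. clamp x ^ n \<partial>M') = (\<integral>x. x ^ n \<partial>M')"
    proof (rule integral_cong_AE)
      show "AE x in M'. clamp x ^ n = x ^ n"
        using supp' by eventually_elim (simp add: clamp_eq)
    qed auto
    ultimately show ?thesis by simp
  qed
  thus ?thesis using M' supp' by blast
qed

lemma sin_orthogonality:
  assumes "k \<ge> 1"
  shows "((\<lambda>\<theta>. sin (real n * \<theta>) * sin (real k * \<theta>)) has_integral (if n = k then pi / 2 else 0)) {0..pi}"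
proof -
  have cos_int: "((\<lambda>\<theta>. cos (of_int j * \<theta>)) has_integral (if j = 0 then pi else 0)) {0..pi}" for j :: int
  proof (cases "j = 0")
    case True
    thus ?thesis using has_integral_const_real[of "1::real" 0 pi] by simp
  next
    case False
    have "((\<lambda>\<theta>. cos (of_int j * \<theta>)) has_integral
        (sin (of_int j * pi) / of_int j - sin (of_int j * 0) / of_int j)) {0..pi}"
      using False
      by (intro fundamental_theorem_of_calculus)
         (auto intro!: derivative_eq_intros simp flip: has_real_derivative_iff_has_vector_derivative)
    moreover have "sin (of_int j * pi) = (0::real)"
      by (simp add: sin_zero_iff_int2)
    ultimately show ?thesis using False by simp
  qed
  have "((\<lambda>\<theta>. (cos (of_int (int n - int k) * \<theta>) - cos (of_int (int n + int k) * \<theta>)) / 2)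
     has_integral (if n = k then pi / 2 else 0)) {0..pi}"
    using has_integral_divide[OF has_integral_diff[OF cos_int[of "int n - int k"] cos_int[of "int n + int k"]], of 2]
      assms by (auto split: if_splits)
  moreover have "(cos (of_int (int n - int k) * \<theta>) - cos (of_int (int n + int k) * \<theta>)) / 2 =
      sin (real n * \<theta>) * sin (real k * \<theta>)" for \<theta>
  proof -
    have "of_int (int n - int k) * \<theta> = real n * \<theta> - real k * \<theta>"
      "of_int (int n + int k) * \<theta> = real n * \<theta> + real k * \<theta>"
      by (simp_all add: algebra_simps)
    thus ?thesis by (simp only: sin_times_sin)
  qed
  ultimately show ?thesis by simp
qed

text \<open>Uniform convergence allows integration term by term, and only the term with index \<open>k\<close> survives.\<close>

lemma sine_coefficient:
  fixes c :: "nat \<Rightarrow> real"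
  assumes "summable (\<lambda>n. \<bar>c n\<bar>)" "k \<ge> 1"
  shows "((\<lambda>\<theta>. (\<Sum>n. c n * sin (real n * \<theta>)) * sin (real k * \<theta>)) has_integral (pi / 2 * c k)) {0..pi}"
proof -
  define f where "f n \<theta> = c n * sin (real n * \<theta>) * sin (real k * \<theta>)" for n \<theta>
  have unif: "uniform_limit {0..pi} (\<lambda>N \<theta>. \<Sum>n<N. f n \<theta>) (\<lambda>\<theta>. \<Sum>n. f n \<theta>) sequentially"
  proof (rule Weierstrass_m_test[OF _ assms(1)])
    fix n \<theta>
    have "\<bar>sin (real n * \<theta>)\<bar> * \<bar>sin (real k * \<theta>)\<bar> \<le> 1 * 1"
      by (intro mult_mono) auto
    thus "norm (f n \<theta>) \<le> \<bar>c n\<bar>"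
      using mult_left_mono[of _ 1 "\<bar>c n\<bar>"] by (auto simp: f_def abs_mult mult.assoc)
  qed
  have int_f: "(f n has_integral (if n = k then pi / 2 * c k else 0)) {0..pi}" for n
    using has_integral_mult_right[OF sin_orthogonality[OF assms(2), of n], of "c n"]
    by (auto simp: f_def[abs_def] mult.assoc mult.commute[of pi] split: if_splits)
  have int_F: "((\<lambda>\<theta>. \<Sum>n<N. f n \<theta>) has_integral (\<Sum>n<N. if n = k then pi / 2 * c k else 0)) {0..pi}" for N
    by (intro has_integral_sum int_f) auto
  obtain I J where I: "\<And>N. ((\<lambda>\<theta>. \<Sum>n<N. f n \<theta>) has_integral I N) {0..pi}"
    and J: "((\<lambda>\<theta>. \<Sum>n. f n \<theta>) has_integral J) {0..pi}" and lim: "I \<longlonglongrightarrow> J"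
    by (rule uniform_limit_integral[OF unif])
       (auto intro!: continuous_intros simp: f_def)
  have "I = (\<lambda>N. \<Sum>n<N. if n = k then pi / 2 * c k else 0)"
    using has_integral_unique[OF I int_F] by blast
  moreover have "(\<lambda>n. if n = k then pi / 2 * c k else 0) sums (pi / 2 * c k)"
    using sums_single[of k "\<lambda>_. pi / 2 * c k"] by simp
  ultimately have J_eq: "J = pi / 2 * c k"
    using lim LIMSEQ_unique unfolding sums_def by blast
  have "(\<Sum>n. f n \<theta>) = (\<Sum>n. c n * sin (real n * \<theta>)) * sin (real k * \<theta>)" for \<theta>
  proof -
    have "summable (\<lambda>n. c n * sin (real n * \<theta>))"
      by (rule summable_comparison_test[OF _ assms(1)])
         (auto simp: abs_mult intro!: exI[of _ 0] mult_left_le)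
    thus ?thesis unfolding f_def by (rule suminf_mult2[symmetric])
  qed
  thus ?thesis using J J_eq by (simp only:)
qed


text \<open>With \<open>s = (1 + cos \<theta>) / 2\<close> one has \<open>4 s sin (k \<theta>) = sin ((k - 1) \<theta>) + 2 sin (k \<theta>) + sin ((k + 1) \<theta>)\<close>. If
the \<open>k\<close>-th sine coefficient of a function is \<open>c k\<close>, that of its product with \<open>s\<^sup>n\<close> is therefore obtained by
iterating the averaging operator below \<open>n\<close> times.\<close>

fun cosine_moment :: "(nat \<Rightarrow> real) \<Rightarrow> nat \<Rightarrow> nat \<Rightarrow> real" where
  "cosine_moment c 0 k = c k"
| "cosine_moment c (Suc n) k = (if k = 0 then 0 else
     (cosine_moment c n (k - 1) + 2 * cosine_moment c n k + cosine_moment c n (k + 1)) / 4)"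

lemma cosine_moment_integral:
  fixes D :: "real \<Rightarrow> real"
  assumes "\<And>k. k \<ge> 1 \<Longrightarrow> ((\<lambda>\<theta>. D \<theta> * sin (real k * \<theta>)) has_integral (pi / 2 * c k)) {0..pi}"
    and "c 0 = 0"
  shows "((\<lambda>\<theta>. ((1 + cos \<theta>) / 2) ^ n * (D \<theta> * sin (real k * \<theta>)))
    has_integral (pi / 2 * cosine_moment c n k)) {0..pi}"
proof (induction n arbitrary: k)
  case 0
  show ?case using assms by (cases "k = 0") auto
next
  case (Suc n)
  show ?case
  proof (cases "k = 0")
    case False
    have "((1 + cos \<theta>) / 2) ^ Suc n * (D \<theta> * sin (real k * \<theta>)) =
        (((1 + cos \<theta>) / 2) ^ n * (D \<theta> * sin (real (k - 1) * \<theta>)) +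
         2 * (((1 + cos \<theta>) / 2) ^ n * (D \<theta> * sin (real k * \<theta>))) +
         ((1 + cos \<theta>) / 2) ^ n * (D \<theta> * sin (real (k + 1) * \<theta>))) / 4" for \<theta>
    proof -
      have "real (k - 1) * \<theta> = real k * \<theta> - \<theta>" "real (k + 1) * \<theta> = real k * \<theta> + \<theta>"
        using False by (auto simp: algebra_simps of_nat_diff)
      hence "sin (real (k - 1) * \<theta>) + sin (real (k + 1) * \<theta>) = 2 * cos \<theta> * sin (real k * \<theta>)"
        by (simp add: sin_add sin_diff)
      hence "(1 + cos \<theta>) / 2 * sin (real k * \<theta>) =
          (sin (real (k - 1) * \<theta>) + 2 * sin (real k * \<theta>) + sin (real (k + 1) * \<theta>)) / 4"
        by (simp add: field_simps)
      hence "((1 + cos \<theta>) / 2) ^ n * D \<theta> * ((1 + cos \<theta>) / 2 * sin (real k * \<theta>)) =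
          ((1 + cos \<theta>) / 2) ^ n * D \<theta> *
          ((sin (real (k - 1) * \<theta>) + 2 * sin (real k * \<theta>) + sin (real (k + 1) * \<theta>)) / 4)"
        by simp
      thus ?thesis by (simp add: algebra_simps)
    qed
    hence "((\<lambda>\<theta>. ((1 + cos \<theta>) / 2) ^ Suc n * (D \<theta> * sin (real k * \<theta>))) has_integral
       (pi / 2 * cosine_moment c n (k - 1) + 2 * (pi / 2 * cosine_moment c n k) +
         pi / 2 * cosine_moment c n (k + 1)) / 4) {0..pi}"
      by (simp only:) (intro has_integral_divide has_integral_add has_integral_mult_right Suc.IH)
    thus ?thesis using False by (simp add: algebra_simps add_divide_distrib)
  qed simp
qed

lemma cosine_moment_tendsto:
  assumes "\<And>k. (\<lambda>j. c j k) \<longlonglongrightarrow> c' k"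
  shows "(\<lambda>j. cosine_moment (c j) n k) \<longlonglongrightarrow> cosine_moment c' n k"
  by (induction n arbitrary: k) (auto intro!: tendsto_intros assms)

text \<open>The Koebe function, rotated and scaled: it maps the unit disc onto the plane slit along \<open>[1, \<infinity>)\<close> and the
upper half disc onto the upper half plane. On the unit circle \<open>1 / koebe (cis \<theta>) = (1 + cos \<theta>) / 2\<close>, which
is how the interval \<open>[0, 1]\<close> enters.\<close>

definition koebe :: "complex \<Rightarrow> complex" where
  "koebe w = 4 * w / (1 + w) ^ 2"

lemma one_plus_nonzero_disc: "norm w < 1 \<Longrightarrow> 1 + w \<noteq> (0 :: complex)"
  by (metis add.inverse_inverse add_eq_0_iff norm_minus_cancel norm_one order_less_irrefl)

lemma koebe_slit:
  assumes "norm w < 1"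
  shows "koebe w \<notin> complex_of_real ` {1..}"
proof
  assume "koebe w \<in> complex_of_real ` {1..}"
  then obtain x where x: "x \<ge> 1" "koebe w = of_real x" by auto
  obtain a b where w: "w = Complex a b" by (cases w)
  have "4 * w = of_real x * (1 + w) ^ 2"
    using x(2) one_plus_nonzero_disc[OF assms] by (simp add: koebe_def field_simps)
  hence "Re (4 * w) = Re (of_real x * (1 + w) ^ 2)" "Im (4 * w) = Im (of_real x * (1 + w) ^ 2)"
    by simp_all
  hence re: "4 * a = x * ((1 + a) ^ 2 - b ^ 2)" and im: "4 * b = 2 * x * (1 + a) * b"
    by (simp_all add: w power2_eq_square algebra_simps)
  have lt: "a ^ 2 + b ^ 2 < 1"
    using assms by (simp add: w complex_norm real_sqrt_lt_1_iff)
  show False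
  proof (cases "b = 0")
    case True
    have "1 * (1 + a) ^ 2 \<le> x * (1 + a) ^ 2" using x by (intro mult_right_mono) auto
    hence "(1 - a) ^ 2 \<le> 0" using re True by (simp add: power2_eq_square algebra_simps)
    hence "a = 1" by simp
    thus False using lt True by simp
  next
    case False
    hence "x * (1 + a) = 2" using im by simp
    hence xa: "x * a = 2 - x" by (simp add: distrib_left)
    have "x * (1 + a) ^ 2 = (x * (1 + a)) * (1 + a)" by (simp add: power2_eq_square)
    hence "x * b ^ 2 = 2 - 2 * a"
      using re \<open>x * (1 + a) = 2\<close> by (simp add: right_diff_distrib)
    moreover have "x * a ^ 2 = (x * a) * a" by (simp add: power2_eq_square)
    hence "x * a ^ 2 = 2 * a - x * a" by (simp add: xa left_diff_distrib)
    ultimately have "x * (a ^ 2 + b ^ 2) = x * 1"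
      by (simp add: distrib_left xa)
    thus False using lt x by simp
  qed
qed

lemma koebe_upper_half_disc:
  assumes "norm w < 1" "Im w > 0"
  shows "Im (koebe w) > 0"
proof -
  obtain a b where w: "w = Complex a b" by (cases w)
  have lt: "a ^ 2 + b ^ 2 < 1"
    using assms by (simp add: w complex_norm real_sqrt_lt_1_iff)
  have nz: "1 + w \<noteq> 0" using one_plus_nonzero_disc[OF assms(1)] .
  \<comment> \<open>a real denominator makes the imaginary part visible\<close>
  have "koebe w = 4 * w * cnj (1 + w) ^ 2 / of_real (norm (1 + w) ^ 4)"
  proof -
    have "of_real (norm (1 + w) ^ 4) = (1 + w) ^ 2 * cnj (1 + w) ^ 2"
      by (simp only: power_mult_distrib[symmetric] complex_norm_square[symmetric])
         (simp flip: power_mult of_real_power)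
    moreover have "cnj (1 + w) \<noteq> 0" using nz by (metis complex_cnj_zero_iff)
    ultimately show ?thesis using nz by (simp add: koebe_def)
  qed
  hence "Im (koebe w) = Im (4 * w * cnj (1 + w) ^ 2) / norm (1 + w) ^ 4"
    by (simp only: Im_divide_of_real)
  also have "Im (4 * w * cnj (1 + w) ^ 2) = 4 * b * (1 - (a ^ 2 + b ^ 2))"
    by (simp add: w power2_eq_square algebra_simps)
  finally show ?thesis using lt assms nz by (simp add: w)
qed

text \<open>Let \<open>C n\<close> be the expansion at \<open>0\<close> of \<open>t \<Sum>\<^sub>j m (n + j) t\<^sup>j\<close> after the substitution \<open>t = koebe w\<close>. Removing the
first moment is division by \<open>t\<close>, that is, multiplication by \<open>(1 + w)\<^sup>2 / (4 w)\<close>; on coefficients this is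
the averaging operator of \<open>cosine_moment\<close>. The first coefficient of \<open>C n\<close> is \<open>4 m n\<close>, so the moments
are recovered from the coefficients \<open>c\<close> of \<open>C 0\<close> in the same way as the integrals of \<open>s\<^sup>n\<close> are
recovered from sine coefficients.\<close>

lemma koebe_composition_coefficients:
  fixes m :: "nat \<Rightarrow> real" and K :: "complex fps"
  assumes K: "K * (1 + fps_X) ^ 2 = 4 * fps_X"
  defines "C \<equiv> \<lambda>n. (fps_X * Abs_fps (\<lambda>j. complex_of_real (m (n + j)))) oo K"
  obtains c where "\<And>k. fps_nth (C 0) k = of_real (c k)" "c 0 = 0" "c 1 = 4 * m 0"
    "\<And>n. cosine_moment c n 1 = 4 * m n"
proof -
  have K0: "fps_nth K 0 = 0"
    using arg_cong[OF K, of "\<lambda>F. fps_nth F 0"] by simp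
  have step: "C n * (1 + fps_X) ^ 2 = 4 * fps_X * (fps_const (of_real (m n)) + C (Suc n))" for n
  proof -
    have "Abs_fps (\<lambda>j. complex_of_real (m (n + j))) =
        fps_const (of_real (m n)) + fps_X * Abs_fps (\<lambda>j. complex_of_real (m (Suc n + j)))"
      by (rule fps_ext) (auto simp: gr0_conv_Suc)
    hence "C n = (fps_X * (fps_const (of_real (m n)) +
        fps_X * Abs_fps (\<lambda>j. complex_of_real (m (Suc n + j))))) oo K"
      by (simp add: C_def)
    also have "\<dots> = K * (fps_const (of_real (m n)) + C (Suc n))"
      unfolding C_def using K0 by (simp add: fps_compose_mult_distrib fps_compose_add_distrib)
    finally have "C n * (1 + fps_X) ^ 2 =
        (K * (1 + fps_X) ^ 2) * (fps_const (of_real (m n)) + C (Suc n))"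
      by (simp only: mult_ac)
    thus ?thesis by (simp only: K)
  qed
  have C0: "fps_nth (C n) 0 = 0" for n unfolding C_def using K0 by (simp add: fps_compose_nth)
  have sq: "(1 + fps_X) ^ 2 = 1 + 2 * fps_X + (fps_X ^ 2 :: complex fps)"
    by (simp add: power2_eq_square algebra_simps)
  have coeff: "fps_nth (C n) (Suc k) + 2 * fps_nth (C n) k + (if k = 0 then 0 else fps_nth (C n) (k - 1)) =
      4 * ((if k = 0 then of_real (m n) else 0) + fps_nth (C (Suc n)) k)" for n k
  proof -
    have "fps_nth (C n * (1 + fps_X) ^ 2) (Suc k) =
        fps_nth (4 * fps_X * (fps_const (of_real (m n)) + C (Suc n))) (Suc k)"
      by (simp only: step)
    moreover have "fps_nth (C n * (1 + fps_X) ^ 2) (Suc k) = fps_nth (C n) (Suc k) +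
        2 * fps_nth (C n) k + (if k = 0 then 0 else fps_nth (C n) (k - 1))"
    proof -
      have "C n * (1 + fps_X) ^ 2 = C n + fps_const 2 * (fps_X * C n) + fps_X ^ 2 * C n"
        unfolding sq by (simp add: algebra_simps numeral_fps_const)
      hence "fps_nth (C n * (1 + fps_X) ^ 2) (Suc k) = fps_nth (C n) (Suc k) +
          2 * fps_nth (C n) k + fps_nth (fps_X ^ 2 * C n) (Suc k)" by simp
      moreover have "fps_nth (fps_X ^ 2 * C n) (Suc k) = (if k = 0 then 0 else fps_nth (C n) (k - 1))"
        by (subst fps_X_power_mult_nth) auto
      ultimately show ?thesis by simp
    qed
    moreover have "fps_nth (4 * fps_X * (fps_const (of_real (m n)) + C (Suc n))) (Suc k) =
        4 * ((if k = 0 then of_real (m n) else 0) + fps_nth (C (Suc n)) k)"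
    proof -
      have eq: "4 * fps_X * (fps_const (of_real (m n)) + C (Suc n)) =
          fps_const 4 * (fps_X * (fps_const (of_real (m n)) + C (Suc n)))"
        by (simp add: numeral_fps_const mult.assoc)
      show ?thesis unfolding eq by simp
    qed
    ultimately show ?thesis by simp
  qed
  have C1: "fps_nth (C n) (Suc 0) = 4 * of_real (m n)" for n
    using coeff[of n 0] by (simp add: C0)
  \<comment> \<open>the recursion, solved for the coefficient of highest index, preserves realness\<close>
  have real: "fps_nth (C n) k \<in> \<real>" for n k
  proof (induction k arbitrary: n rule: less_induct)
    case (less k)
    show ?case
    proof (cases k)
      case (Suc k')
      have "fps_nth (C n) k = 4 * ((if k' = 0 then of_real (m n) else 0) + fps_nth (C (Suc n)) k') -
          2 * fps_nth (C n) k' - (if k' = 0 then 0 else fps_nth (C n) (k' - 1))"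
        using coeff[of n k'] by (simp add: Suc algebra_simps)
      also have "\<dots> \<in> \<real>"
        by (intro Reals_diff Reals_mult Reals_add) (use less Suc in auto)
      finally show ?thesis .
    qed (simp add: C0)
  qed
  define c where "c k = Re (fps_nth (C 0) k)" for k
  have c: "fps_nth (C n) k = of_real (cosine_moment c n k)" for n k
  proof (induction n arbitrary: k)
    case 0
    show ?case using real[of 0 k] by (simp add: c_def)
  next
    case (Suc n)
    show ?case
    proof (cases "k = 0")
      case False
      have "fps_nth (C (Suc n)) k = (fps_nth (C n) (k - 1) + 2 * fps_nth (C n) k + fps_nth (C n) (k + 1)) / 4"
        using coeff[of n k] False by (simp add: algebra_simps)
      thus ?thesis using False Suc by simp
    qed (simp add: C0)
  qed
  show ?thesis
  proof (rule that)
    show "fps_nth (C 0) k = of_real (c k)" for k using c[of 0 k] by simp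
    show "c 0 = 0" by (simp add: c_def C0)
    show "c 1 = 4 * m 0" using C1[of 0] by (simp add: c_def)
    show "cosine_moment c n 1 = 4 * m n" for n
    proof -
      have "complex_of_real (cosine_moment c n 1) = complex_of_real (4 * m n)"
        using c[of n "Suc 0"] C1[of n] by simp
      thus ?thesis by (simp only: of_real_eq_iff)
    qed
  qed
qed

text \<open>The probability measure with density \<open>h / Z\<close> on the half circle, transported to \<open>[0, 1]\<close> by
\<open>\<theta> \<mapsto> (1 + cos \<theta>) / 2\<close>.\<close>

lemma density_on_half_circle:
  fixes h :: "real \<Rightarrow> real"
  assumes h: "continuous_on {0..pi} h" "\<And>\<theta>. \<theta> \<in> {0..pi} \<Longrightarrow> h \<theta> \<ge> 0"
    and Z: "(h has_integral Z) {0..pi}" "Z > 0"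
  obtains M where "real_distribution M" "AE x in M. x \<in> {0..1}"
    "\<And>n J. ((\<lambda>\<theta>. ((1 + cos \<theta>) / 2) ^ n * h \<theta>) has_integral J) {0..pi} \<Longrightarrow>
       (\<integral>x. x ^ n \<partial>M) = J / Z"
proof -
  define k where "k \<theta> = indicator {0..pi} \<theta> * (h \<theta> / Z)" for \<theta>
  define N where "N = density lborel (\<lambda>\<theta>. ennreal (k \<theta>))"
  have cont: "continuous_on {0..pi} (\<lambda>\<theta>. h \<theta> / Z)" using h Z by (intro continuous_intros) auto
  have k_nn: "k \<theta> \<ge> 0" for \<theta> using h Z by (auto simp: k_def indicator_def)
  have [measurable]: "k \<in> borel_measurable borel"
    using borel_measurable_continuous_on_indicator[OF _ cont] by (simp add: k_def[abs_def])
  have int_k: "integrable lborel (\<lambda>\<theta>. k \<theta> * f \<theta>) \<and> (\<integral>\<theta>. k \<theta> * f \<theta> \<partial>lborel) = J / Z"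
    if f: "continuous_on {0..pi} f" and J: "((\<lambda>\<theta>. f \<theta> * h \<theta>) has_integral J) {0..pi}" for f J
  proof -
    have "continuous_on {0..pi} (\<lambda>\<theta>. h \<theta> / Z * f \<theta>)" by (intro continuous_intros cont f)
    hence int: "set_integrable lborel {0..pi} (\<lambda>\<theta>. h \<theta> / Z * f \<theta>)"
      by (rule borel_integrable_atLeastAtMost')
    have "((\<lambda>\<theta>. h \<theta> / Z * f \<theta>) has_integral J / Z) {0..pi}"
      using has_integral_divide[OF J, of Z] by (simp add: mult.commute)
    hence "(LBINT \<theta>:{0..pi}. h \<theta> / Z * f \<theta>) = J / Z"
      using set_borel_integral_eq_integral(2)[OF int] integral_unique by metis
    thus ?thesis using int
      by (simp add: set_integrable_def set_lebesgue_integral_def k_def mult.assoc)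
  qed
  have "(\<integral>\<^sup>+\<theta>. ennreal (k \<theta>) \<partial>lborel) = ennreal (\<integral>\<theta>. k \<theta> \<partial>lborel)"
    using int_k[of "\<lambda>_. 1"] Z k_nn by (intro nn_integral_eq_integral) auto
  also have "(\<integral>\<theta>. k \<theta> \<partial>lborel) = 1" using int_k[of "\<lambda>_. 1" Z] Z by simp
  finally have "emeasure N (space N) = 1"
    unfolding N_def by (simp add: emeasure_density)
  then interpret N: prob_space N by (rule prob_spaceI)
  define s where "s \<theta> = (1 + cos \<theta>) / 2" for \<theta> :: real
  have s_meas: "s \<in> measurable N borel"
    unfolding N_def s_def by simp
  show ?thesis
  proof (rule that[of "distr N borel s"])
    show "real_distribution (distr N borel s)"
      using s_meas by (rule N.real_distribution_distr)
    show "AE x in distr N borel s. x \<in> {0..1}"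
      using s_meas
    proof (subst AE_distr_iff)
      have "(1 + x) / 2 \<in> {0..1}" if "-1 \<le> x" "x \<le> 1" for x :: real using that by simp
      hence "s \<theta> \<in> {0..1}" for \<theta>
        unfolding s_def by (metis cos_ge_minus_one cos_le_one)
      thus "AE \<theta> in N. s \<theta> \<in> {0..1}" by simp
    qed auto
    fix n J assume J: "((\<lambda>\<theta>. ((1 + cos \<theta>) / 2) ^ n * h \<theta>) has_integral J) {0..pi}"
    have "(\<integral>x. x ^ n \<partial>distr N borel s) = (\<integral>\<theta>. s \<theta> ^ n \<partial>N)"
      by (rule integral_distr[OF s_meas]) simp
    also have "\<dots> = (\<integral>\<theta>. k \<theta> * s \<theta> ^ n \<partial>lborel)"
      unfolding N_def by (subst integral_density) (use k_nn in \<open>auto simp: s_def\<close>)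
    also have "\<dots> = J / Z"
    proof -
      have "continuous_on {0..pi} (\<lambda>\<theta>. s \<theta> ^ n)"
        unfolding s_def by (intro continuous_intros) auto
      thus ?thesis using int_k[of "\<lambda>\<theta>. s \<theta> ^ n" J] J by (simp add: s_def)
    qed
    finally show "(\<integral>x. x ^ n \<partial>distr N borel s) = J / Z" .
  qed
qed

text \<open>Put \<open>\<Phi> w = t F t\<close> with \<open>t = koebe w\<close>. This is holomorphic in the unit disc with real coefficients \<open>c k\<close>, and
its imaginary part is nonnegative on the upper half disc. On the circle of radius \<open>r < 1\<close> that imaginary
part has the sine coefficients \<open>c k r\<^sup>k\<close>, so the nonnegative density \<open>Im \<Phi> sin \<theta>\<close> transported to \<open>[0, 1]\<close>
has moments that converge to multiples of \<open>cosine_moment c n 1 = 4 m n\<close> for \<open>r \<rightarrow> 1\<close>.\<close>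

lemma slit_plane_moments:
  fixes F :: "complex \<Rightarrow> complex" and m :: "nat \<Rightarrow> real"
  assumes hol: "F holomorphic_on - (complex_of_real ` {1..})"
    and exp: "F has_fps_expansion Abs_fps (\<lambda>n. of_real (m n))"
    and up: "\<And>t. Im t > 0 \<Longrightarrow> Im (t * F t) \<ge> 0" and m0: "m 0 > 0"
  shows "\<exists>M. real_distribution M \<and> (AE x in M. x \<in> {0..1}) \<and> (\<forall>n. (\<integral>x. x ^ n \<partial>M) = m n / m 0)"
proof -
  define K :: "complex fps" where "K = 4 * fps_X / (1 + fps_X) ^ 2"
  have nz: "fps_nth ((1 + fps_X) ^ 2 :: complex fps) 0 \<noteq> 0" by simp
  have K: "K * (1 + fps_X) ^ 2 = 4 * fps_X"
    unfolding K_def by (simp add: fps_divide_unit[OF nz] mult.assoc inverse_mult_eq_1[OF nz])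
  have K0: "fps_nth K 0 = 0" using arg_cong[OF K, of "\<lambda>F. fps_nth F 0"] by simp
  have "koebe has_fps_expansion K"
    unfolding koebe_def[abs_def] K_def by (intro fps_expansion_intros) auto
  define \<Phi> where "\<Phi> = (\<lambda>t. t * F t) \<circ> koebe"
  have \<Phi>_exp: "\<Phi> has_fps_expansion ((fps_X * Abs_fps (\<lambda>n. of_real (m n))) oo K)"
    unfolding \<Phi>_def by (intro has_fps_expansion_compose fps_expansion_intros exp K0) fact
  obtain c where c: "\<And>k. fps_nth ((fps_X * Abs_fps (\<lambda>n. of_real (m n))) oo K) k = complex_of_real (c k)"
    "c 0 = 0" "c 1 = 4 * m 0" "\<And>n. cosine_moment c n 1 = 4 * m n"
    using koebe_composition_coefficients[OF K, of m] by auto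
  have \<Phi>_hol: "\<Phi> holomorphic_on ball 0 1"
    unfolding \<Phi>_def
  proof (rule holomorphic_on_compose_gen)
    show "koebe holomorphic_on ball 0 1"
      unfolding koebe_def[abs_def] using one_plus_nonzero_disc by (intro holomorphic_intros) auto
    show "(\<lambda>t. t * F t) holomorphic_on - (complex_of_real ` {1..})"
      by (intro holomorphic_intros hol)
    show "koebe ` ball 0 1 \<subseteq> - complex_of_real ` {1..}"
    proof (rule image_subsetI)
      fix w :: complex assume "w \<in> ball 0 1"
      hence "norm w < 1" by simp
      thus "koebe w \<in> - complex_of_real ` {1..}" using koebe_slit by blast
    qed
  qed
  have sums: "(\<lambda>k. of_real (c k) * w ^ k) sums \<Phi> w" if "norm w < 1" for w
    using has_fps_expansion_imp_sums_complex[OF \<Phi>_exp, of 1 w] \<Phi>_hol that c(1)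
    by (simp add: one_ereal_def)
  have abs_sum: "summable (\<lambda>k. \<bar>c k * r ^ k\<bar>)" if r: "0 < r" "r < 1" for r
  proof -
    obtain R where R: "r < R" "R < 1" using r dense by blast
    have "summable (\<lambda>k. of_real (c k) * (of_real R :: complex) ^ k)"
      using sums[of "of_real R"] R r by (auto simp: sums_iff)
    from powser_insidea[OF this, of "of_real r"] show ?thesis
      using R r by (simp add: norm_mult norm_power abs_mult)
  qed
  \<comment> \<open>for a radius below \<open>1\<close> the moments are those of the damped coefficients; dividing by \<open>4 m\<^sub>0 r\<close> normalizes the mass\<close>
  have *: "\<exists>M. real_distribution M \<and> (AE x in M. x \<in> {0..1}) \<and>
      (\<forall>n. (\<integral>x. x ^ n \<partial>M) = cosine_moment (\<lambda>k. c k * r ^ k) n 1 / (4 * m 0 * r))"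
    if r: "0 < r" "r < 1" for r
  proof -
    define D where "D \<theta> = Im (\<Phi> (of_real r * cis \<theta>))" for \<theta>
    have in_ball: "norm (of_real r * cis \<theta>) < 1" for \<theta> using r by (simp add: norm_mult)
    have D_sums: "(\<lambda>k. c k * r ^ k * sin (real k * \<theta>)) sums D \<theta>" for \<theta>
    proof -
      have "(of_real r * cis \<theta>) ^ k = of_real (r ^ k) * cis (real k * \<theta>)" for k
        by (simp add: power_mult_distrib Complex.DeMoivre)
      hence "Im (of_real (c k) * (of_real r * cis \<theta>) ^ k) = c k * r ^ k * sin (real k * \<theta>)" for k
        by simp
      thus ?thesis using sums_Im[OF sums[OF in_ball[of \<theta>]]] by (simp only: D_def)
    qed
    have D_int: "((\<lambda>\<theta>. D \<theta> * sin (real k * \<theta>)) has_integral (pi / 2 * (c k * r ^ k))) {0..pi}"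
      if "k \<ge> 1" for k
      using sine_coefficient[OF abs_sum[OF r] that] D_sums by (simp add: sums_iff)
    have D_nonneg: "D \<theta> \<ge> 0" if \<theta>: "\<theta> \<in> {0..pi}" for \<theta>
    proof (cases "\<theta> = 0 \<or> \<theta> = pi")
      case True
      hence "(\<lambda>k. c k * r ^ k * sin (real k * \<theta>)) = (\<lambda>k. 0)" by auto
      thus ?thesis using D_sums[of \<theta>] by (simp add: sums_iff)
    next
      case False
      hence "sin \<theta> > 0" using \<theta> by (intro sin_gt_zero) auto
      hence "Im (of_real r * cis \<theta>) > 0" using r by simp
      from up[OF koebe_upper_half_disc[OF in_ball this]] show ?thesis by (simp add: D_def \<Phi>_def)
    qed
    have "continuous_on {0..pi} (\<lambda>\<theta>. \<Phi> (of_real r * cis \<theta>))"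
      by (rule continuous_on_compose2[OF holomorphic_on_imp_continuous_on[OF \<Phi>_hol]])
         (use in_ball in \<open>auto intro!: continuous_intros\<close>)
    hence D_cont: "continuous_on {0..pi} D" unfolding D_def by (intro continuous_intros)
    have int0: "((\<lambda>\<theta>. D \<theta> * sin \<theta>) has_integral (2 * pi * m 0 * r)) {0..pi}"
      using D_int[of 1] c(3) by (simp add: mult_ac)
    obtain M where M: "real_distribution M" "AE x in M. x \<in> {0..1}"
      "\<And>n J. ((\<lambda>\<theta>. ((1 + cos \<theta>) / 2) ^ n * (D \<theta> * sin \<theta>)) has_integral J) {0..pi} \<Longrightarrow>
        (\<integral>x. x ^ n \<partial>M) = J / (2 * pi * m 0 * r)"
    proof (rule density_on_half_circle[OF _ _ int0])
      show "continuous_on {0..pi} (\<lambda>\<theta>. D \<theta> * sin \<theta>)" by (intro continuous_intros D_cont)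
      show "D \<theta> * sin \<theta> \<ge> 0" if "\<theta> \<in> {0..pi}" for \<theta>
        using D_nonneg[OF that] that by (auto intro!: mult_nonneg_nonneg sin_ge_zero)
    qed (use r m0 in auto)
    have "(\<integral>x. x ^ n \<partial>M) = cosine_moment (\<lambda>k. c k * r ^ k) n 1 / (4 * m 0 * r)" for n
    proof -
      have "((\<lambda>\<theta>. ((1 + cos \<theta>) / 2) ^ n * (D \<theta> * sin \<theta>)) has_integral
          (pi / 2 * cosine_moment (\<lambda>k. c k * r ^ k) n 1)) {0..pi}"
        using cosine_moment_integral[of D "\<lambda>k. c k * r ^ k" n 1] D_int c(2) by simp
      from M(3)[OF this] show ?thesis by (simp add: field_simps)
    qed
    thus ?thesis using M by blast
  qed
  define r where "r j = 1 - 1 / real (j + 2)" for j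
  have r: "0 < r j" "r j < 1" for j by (auto simp: r_def field_simps)
  have r_lim: "r \<longlonglongrightarrow> 1"
    unfolding r_def by real_asymp
  from * r have "\<forall>j. \<exists>M. real_distribution M \<and> (AE x in M. x \<in> {0..1}) \<and>
      (\<forall>n. (\<integral>x. x ^ n \<partial>M) = cosine_moment (\<lambda>k. c k * r j ^ k) n 1 / (4 * m 0 * r j))"
    by blast
  then obtain M where M: "\<And>j. real_distribution (M j)" "\<And>j. AE x in M j. x \<in> {0..1}"
    "\<And>j n. (\<integral>x. x ^ n \<partial>M j) = cosine_moment (\<lambda>k. c k * r j ^ k) n 1 / (4 * m 0 * r j)"
    by metis
  have "(\<lambda>j. \<integral>x. x ^ n \<partial>M j) \<longlonglongrightarrow> m n / m 0" for n
  proof -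
    have "(\<lambda>j. cosine_moment (\<lambda>k. c k * r j ^ k) n 1 / (4 * m 0 * r j)) \<longlonglongrightarrow>
        cosine_moment (\<lambda>k. c k * 1 ^ k) n 1 / (4 * m 0 * 1)"
      using m0 by (intro tendsto_intros cosine_moment_tendsto r_lim) auto
    thus ?thesis unfolding M(3) using m0 c(4)[of n] by simp
  qed
  from moments_weak_limit[OF M(1,2) this] show ?thesis .
qed

section \<open>Branched recurrences generate moment sequences\<close>

text \<open>The coefficient of \<open>t\<^sup>j\<close> in \<open>S\<^sub>n\<close> when the recurrence \<open>S\<^sub>n = \<alpha>\<^sub>n S\<^sub>n\<^sub>-\<^sub>1 + \<beta>\<^sub>n t S\<^sub>n\<^sub>+\<^sub>p\<close> is cut off by
\<open>S\<^sub>n = 0\<close> for \<open>n > N\<close>.\<close>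

function trunc_coeff :: "nat \<Rightarrow> (nat \<Rightarrow> real) \<Rightarrow> (nat \<Rightarrow> real) \<Rightarrow> nat \<Rightarrow> nat \<Rightarrow> nat \<Rightarrow> real" where
  "trunc_coeff p \<alpha> \<beta> N j n =
     (if n = 0 then of_bool (j = 0) else if n > N then 0
      else \<alpha> n * trunc_coeff p \<alpha> \<beta> N j (n - 1) +
        (if j = 0 then 0 else \<beta> n * trunc_coeff p \<alpha> \<beta> N (j - 1) (n + p)))"
  by pat_completeness auto
termination
  by (relation "inv_image (less_than <*lex*> less_than) (\<lambda>(p, \<alpha>, \<beta>, N, j, n). (j, n))") auto

declare trunc_coeff.simps [simp del]

text \<open>The coefficients \<open>\<mu> j n\<close> of \<open>t\<^sup>j\<close> in the solution \<open>S\<close> of the branched recurrence with \<open>S\<^sub>0 = 1\<close>. The bound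
by \<open>1\<close> will put the singularities of \<open>S\<^sub>n\<close> on \<open>[1, \<infinity>)\<close> and hence the measures on \<open>[0, 1]\<close>.\<close>

locale branched_moments =
  fixes p :: nat and \<alpha> \<beta> :: "nat \<Rightarrow> real" and \<mu> :: "nat \<Rightarrow> nat \<Rightarrow> real"
  assumes \<alpha>: "\<And>n. n \<ge> 1 \<Longrightarrow> \<alpha> n > 0" and \<beta>: "\<And>n. n \<ge> 1 \<Longrightarrow> \<beta> n > 0"
    and source: "\<And>j. \<mu> j 0 = of_bool (j = 0)"
    and rec: "\<And>j n. n \<ge> 1 \<Longrightarrow> \<mu> j n = \<alpha> n * \<mu> j (n - 1) + (if j = 0 then 0 else \<beta> n * \<mu> (j - 1) (n + p))"
    and bound: "\<And>j n. \<mu> j n \<le> 1"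
begin

abbreviation trunc :: "nat \<Rightarrow> nat \<Rightarrow> nat \<Rightarrow> real" where
  "trunc N j n \<equiv> trunc_coeff p \<alpha> \<beta> N j n"


lemma \<mu>_nonneg: "0 \<le> \<mu> j n"
proof (induction j arbitrary: n)
  case 0
  show ?case
  proof (induction n)
    case (Suc n)
    thus ?case using rec[of "Suc n" 0] \<alpha>[of "Suc n"] by simp
  qed (simp add: source)
next
  case (Suc j)
  show ?case
  proof (induction n)
    case (Suc n)
    thus ?case using rec[of "Suc n" "Suc j"] \<alpha>[of "Suc n"] \<beta>[of "Suc n"] Suc.IH \<open>\<And>n. 0 \<le> \<mu> j n\<close> by simp
  qed (simp add: source)
qed

lemma trunc_bounds: "0 \<le> trunc N j n \<and> trunc N j n \<le> \<mu> j n"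
proof (induction j arbitrary: n)
  case 0
  show ?case
  proof (induction n)
    case (Suc n)
    thus ?case using rec[of "Suc n" 0] \<alpha>[of "Suc n"] \<mu>_nonneg[of 0 "Suc n"]
      by (simp add: trunc_coeff.simps[of _ _ _ _ _ "Suc n"] mult_left_mono)
  qed (simp add: source trunc_coeff.simps)
next
  case (Suc j)
  show ?case
  proof (induction n)
    case (Suc n)
    note IH = \<open>\<And>n. 0 \<le> trunc N j n \<and> trunc N j n \<le> \<mu> j n\<close>
    show ?case using Suc rec[of "Suc n" "Suc j"] \<alpha>[of "Suc n"] \<beta>[of "Suc n"] IH[of "Suc n + p"]
        \<mu>_nonneg[of "Suc j" "Suc n"]
      by (auto simp: trunc_coeff.simps[of _ _ _ _ _ "Suc n"] intro!: add_mono mult_left_mono)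
  qed (simp add: source trunc_coeff.simps)
qed

text \<open>The coefficient \<open>\<mu> j n\<close> depends on the recurrence only up to the index \<open>n + p j\<close>.\<close>

lemma trunc_eq: "n + p * j \<le> N \<Longrightarrow> trunc N j n = \<mu> j n"
proof (induction j arbitrary: n)
  case 0
  thus ?case
  proof (induction n)
    case (Suc n)
    thus ?case using rec[of "Suc n" 0] by (simp add: trunc_coeff.simps[of _ _ _ _ _ "Suc n"])
  qed (simp add: source trunc_coeff.simps)
next
  case (Suc j)
  note IH = Suc.IH
  show ?case using Suc.prems
  proof (induction n)
    case (Suc n)
    have "trunc N (Suc j) n = \<mu> (Suc j) n" using Suc by simp
    moreover have "trunc N j (Suc n + p) = \<mu> j (Suc n + p)" using Suc.prems by (intro IH) simp
    ultimately show ?case using rec[of "Suc n" "Suc j"] Suc.prems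
      by (simp add: trunc_coeff.simps[of _ _ _ _ _ "Suc n"])
  qed (simp add: source trunc_coeff.simps)
qed

lemma initial_pos: "\<mu> 0 n > 0"
proof (induction n)
  case (Suc n)
  thus ?case using rec[of "Suc n" 0] \<alpha>[of "Suc n"] by simp
qed (simp add: source)

text \<open>Prescribing \<open>S\<^sub>N = 1\<close> instead of \<open>S\<^sub>0 = 1\<close>, the truncated recurrence can be solved downwards from \<open>N\<close>; the
solution is polynomial in \<open>t\<close>. The recursion runs over the depth \<open>d = N - n\<close>, and \<open>backward_sol\<close> is the
same solution indexed by \<open>n\<close> and continued by \<open>0\<close> above \<open>N\<close>.\<close>

fun backward_depth :: "nat \<Rightarrow> complex \<Rightarrow> nat \<Rightarrow> complex" where
  "backward_depth N t 0 = 1"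
| "backward_depth N t (Suc d) = (backward_depth N t d - of_real (\<beta> (N - d)) * t * (if p \<le> d then backward_depth N t (d - p) else 0))
      / of_real (\<alpha> (N - d))"

definition backward_sol :: "nat \<Rightarrow> complex \<Rightarrow> nat \<Rightarrow> complex" where
  "backward_sol N t n = (if n \<le> N then backward_depth N t (N - n) else 0)"

lemma backward_sol_top: "backward_sol N t N = 1" by (simp add: backward_sol_def)
lemma backward_sol_above: "n > N \<Longrightarrow> backward_sol N t n = 0" by (simp add: backward_sol_def)

lemma backward_sol_rec:
  assumes "n \<in> {1..N}"
  shows "of_real (\<alpha> n) * backward_sol N t (n - 1) = backward_sol N t n - of_real (\<beta> n) * t * backward_sol N t (n + p)"
proof -
  define d where "d = N - n"
  have d: "N - (n - 1) = Suc d" "N - d = n" using assms by (auto simp: d_def)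
  have "backward_sol N t (n + p) = (if p \<le> d then backward_depth N t (d - p) else 0)"
    using assms by (auto simp: backward_sol_def d_def)
  moreover have "\<alpha> n > 0" using \<alpha> assms by simp
  moreover have "n - 1 \<le> N" using assms by auto
  hence "backward_sol N t (n - 1) = backward_depth N t (Suc d)" using d(1) by (simp only: backward_sol_def if_True)
  moreover have "backward_sol N t n = backward_depth N t d" using assms by (simp add: backward_sol_def d_def)
  ultimately show ?thesis using d(2) by simp
qed

lemma backward_sol_holomorphic: "(\<lambda>t. backward_sol N t n) holomorphic_on A"
proof -
  have "(\<lambda>t. backward_depth N t d) holomorphic_on A" if "d \<le> N" for d
    using that
  proof (induction d rule: less_induct)
    case (less d)
    show ?case
    proof (cases d)
      case (Suc d')
      have "\<alpha> (N - d') > 0" using less.prems Suc by (intro \<alpha>) simp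
      thus ?thesis
        using less.IH[of d'] less.IH[of "d' - p"] less.prems Suc
        by (cases "p \<le> d'") (auto intro!: holomorphic_intros)
    qed simp
  qed
  thus ?thesis by (cases "n \<le> N") (auto simp: backward_sol_def)
qed

lemma backward_sol_cnj: "backward_sol N (cnj t) n = cnj (backward_sol N t n)"
proof -
  have "backward_depth N (cnj t) d = cnj (backward_depth N t d)" for d
    by (induction d rule: less_induct, rename_tac d, case_tac d) auto
  thus ?thesis by (simp add: backward_sol_def)
qed

lemma backward_sol_nonpos:
  assumes "x \<le> 0" "n \<le> N"
  shows "backward_sol N (of_real x) n \<noteq> 0"
proof -
  have "\<exists>y>0. backward_depth N (of_real x) d = of_real y" if "d \<le> N" for d
    using that
  proof (induction d rule: less_induct)
    case (less d)
    show ?case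
    proof (cases d)
      case 0
      thus ?thesis by (auto intro: exI[of _ 1])
    next
      case (Suc d')
      have ab: "\<alpha> (N - d') > 0" "\<beta> (N - d') > 0" using less.prems Suc \<alpha> \<beta> by auto
      obtain y where y: "y > 0" "backward_depth N (of_real x) d' = of_real y"
        using less.IH[of d'] less.prems Suc by auto
      obtain z where z: "z \<ge> 0" "(if p \<le> d' then backward_depth N (of_real x) (d' - p) else 0) = of_real z"
      proof (cases "p \<le> d'")
        case True
        moreover have "d' - p < d" "d' - p \<le> N" using less.prems Suc by auto
        ultimately obtain z where "z > 0" "backward_depth N (of_real x) (d' - p) = of_real z"
          using less.IH by blast
        thus ?thesis using True by (intro that[of z]) auto
      qed (use that[of 0] in auto)
      have "\<beta> (N - d') * x * z \<le> 0"
        using ab z assms by (simp add: mult_nonneg_nonpos mult_nonpos_nonneg)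
      hence "(y - \<beta> (N - d') * x * z) / \<alpha> (N - d') > 0" using y ab by simp
      moreover have "backward_depth N (of_real x) d = of_real ((y - \<beta> (N - d') * x * z) / \<alpha> (N - d'))"
        unfolding Suc backward_depth.simps y z by simp
      ultimately show ?thesis by blast
    qed
  qed
  from this[of "N - n"] show ?thesis using assms by (auto simp: backward_sol_def)
qed

lemma trunc_summable:
  assumes "norm (t :: complex) < 1"
  shows "summable (\<lambda>j. of_real (trunc N j n) * t ^ j)"
proof (rule summable_comparison_test)
  show "\<exists>M. \<forall>j\<ge>M. norm (complex_of_real (trunc N j n) * t ^ j) \<le> norm t ^ j"
  proof (intro exI allI impI)
    fix j
    have "\<bar>trunc N j n\<bar> \<le> 1"
      using trunc_bounds[of N j n] bound[of j n] by linarith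
    thus "norm (complex_of_real (trunc N j n) * t ^ j) \<le> norm t ^ j"
      by (simp add: norm_mult norm_power mult_left_le_one_le)
  qed
  show "summable (\<lambda>j. norm t ^ j)" using assms by (simp add: summable_geometric)
qed

text \<open>Inside the unit disc the truncated series converge and solve the recurrence, so they are a multiple
\<open>S\<^sub>N\<close> of the backward solution. At index \<open>0\<close> the series is \<open>1\<close>; hence the backward solution cannot vanish
there, and the series are its quotients.\<close>

lemma trunc_series:
  assumes t: "norm (t :: complex) < 1" and n: "n \<le> N"
  shows "backward_sol N t 0 \<noteq> 0" "(\<lambda>j. of_real (trunc N j n) * t ^ j) sums (backward_sol N t n / backward_sol N t 0)"
proof -
  define S where "S n = (\<Sum>j. of_real (trunc N j n) * t ^ j)" for n
  have S: "(\<lambda>j. of_real (trunc N j n) * t ^ j) sums S n" for n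
    unfolding S_def by (rule summable_sums[OF trunc_summable[OF t]])
  have S0: "S 0 = 1"
  proof -
    have "(\<lambda>j. of_real (trunc N j 0) * t ^ j) = (\<lambda>j. if j = 0 then 1 else 0)"
      by (auto simp: trunc_coeff.simps)
    hence "(\<lambda>j. of_real (trunc N j 0) * t ^ j) sums 1"
      using sums_single[of 0 "\<lambda>_. 1 :: complex"] by simp
    thus ?thesis using S sums_unique2 by blast
  qed
  have S_above: "S n = 0" if "n > N" for n
    using that by (simp add: S_def trunc_coeff.simps[of _ _ _ _ _ n])
  have S_rec: "S n = of_real (\<alpha> n) * S (n - 1) + of_real (\<beta> n) * t * S (n + p)"
    if n: "n \<in> {1..N}" for n
  proof -
    have "(\<lambda>j. of_real (\<beta> n) * t * (of_real (trunc N j (n + p)) * t ^ j)) sums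
        (of_real (\<beta> n) * t * S (n + p))"
      by (intro sums_mult S)
    hence "(\<lambda>j. if j = 0 then 0 else of_real (\<beta> n * trunc N (j - 1) (n + p)) * t ^ j) sums
        (of_real (\<beta> n) * t * S (n + p))"
      using sums_Suc_iff[of "\<lambda>j. if j = 0 then 0 else of_real (\<beta> n * trunc N (j - 1) (n + p)) * t ^ j"
          "of_real (\<beta> n) * t * S (n + p)"] by (simp add: mult_ac)
    from sums_add[OF sums_mult[OF S[of "n - 1"], of "of_real (\<alpha> n)"] this]
    have "(\<lambda>j. of_real (trunc N j n) * t ^ j) sums
        (of_real (\<alpha> n) * S (n - 1) + of_real (\<beta> n) * t * S (n + p))"
    proof (rule back_subst[of "\<lambda>f. f sums _"])
      show "(\<lambda>j. of_real (\<alpha> n) * (of_real (trunc N j (n - 1)) * t ^ j) +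
          (if j = 0 then 0 else of_real (\<beta> n * trunc N (j - 1) (n + p)) * t ^ j)) =
          (\<lambda>j. of_real (trunc N j n) * t ^ j)"
      proof
        fix j
        show "of_real (\<alpha> n) * (of_real (trunc N j (n - 1)) * t ^ j) +
          (if j = 0 then 0 else of_real (\<beta> n * trunc N (j - 1) (n + p)) * t ^ j) =
          of_real (trunc N j n) * t ^ j"
          using n by (subst (3) trunc_coeff.simps) (auto simp: distrib_right)
      qed
    qed
    thus ?thesis using S sums_unique2 by blast
  qed
  have multiple: "S n = S N * backward_sol N t n" if "n \<le> N" for n
    using that
  proof (induction "N - n" arbitrary: n rule: less_induct)
    case less
    show ?case
    proof (cases "n = N")
      case False
      hence n: "Suc n \<in> {1..N}" using less.prems by auto
      have "S (Suc n) = S N * backward_sol N t (Suc n)" using less.hyps[of "Suc n"] n by auto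
      moreover have "S (Suc n + p) = S N * backward_sol N t (Suc n + p)"
      proof (cases "Suc n + p \<le> N")
        case True
        thus ?thesis using less.hyps[of "Suc n + p"] by auto
      qed (use S_above backward_sol_above in auto)
      moreover have "of_real (\<alpha> (Suc n)) * S n =
          S (Suc n) - of_real (\<beta> (Suc n)) * t * S (Suc n + p)"
        using S_rec[OF n] by simp
      ultimately have "of_real (\<alpha> (Suc n)) * S n =
          S N * (backward_sol N t (Suc n) - of_real (\<beta> (Suc n)) * t * backward_sol N t (Suc n + p))"
        by (simp only: right_diff_distrib mult_ac)
      also have "\<dots> = of_real (\<alpha> (Suc n)) * (S N * backward_sol N t n)"
        unfolding backward_sol_rec[OF n, symmetric] by simp
      finally show ?thesis using \<alpha>[of "Suc n"] by simp
    qed (simp add: backward_sol_top)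
  qed
  have "S N * backward_sol N t 0 = 1" using multiple[of 0] S0 by simp
  thus "backward_sol N t 0 \<noteq> 0" by auto
  hence "S N = 1 / backward_sol N t 0" using \<open>S N * backward_sol N t 0 = 1\<close> by (simp add: field_simps)
  thus "(\<lambda>j. of_real (trunc N j n) * t ^ j) sums (backward_sol N t n / backward_sol N t 0)"
    using S[of n] multiple[OF n] by simp
qed

text \<open>The quotient of backward solutions is holomorphic off \<open>[1, \<infinity>)\<close>: its denominator does not vanish in the
upper half plane by the argument estimate, in the lower one by symmetry, on \<open>(0, 1)\<close> by convergence of the
series, and on the nonpositive axis because all backward solutions are positive there.\<close>

lemma trunc_moments:
  assumes a: "a \<in> {1..p}" "a \<le> N"
  shows "\<exists>M. real_distribution M \<and> (AE x in M. x \<in> {0..1}) \<and>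
    (\<forall>n. (\<integral>x. x ^ n \<partial>M) = trunc N n a / trunc N 0 a)"
proof (rule slit_plane_moments[of "\<lambda>t. backward_sol N t a / backward_sol N t 0"])
  have up: "backward_sol N t 0 \<noteq> 0" "Im (t * (backward_sol N t a / backward_sol N t 0)) > 0" if "Im t > 0" for t
    using backward_recurrence_upper_half_plane[of t \<alpha> \<beta> "backward_sol N t" N p a, OF that \<alpha> less_imp_le[OF \<beta>]
        backward_sol_top backward_sol_above backward_sol_rec] a by auto
  show "Im (t * (backward_sol N t a / backward_sol N t 0)) \<ge> 0" if "Im t > 0" for t using up(2)[OF that] by simp
  have "backward_sol N t 0 \<noteq> 0" if "t \<in> - complex_of_real ` {1..}" for t
  proof -
    consider "Im t > 0" | "Im t < 0" | "Im t = 0" "Re t \<le> 0" | "Im t = 0" "0 < Re t" "Re t < 1" | "Im t = 0" "Re t \<ge> 1"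
      by linarith
    thus ?thesis
    proof cases
      case 1
      thus ?thesis by (rule up)
    next
      case 2
      hence "backward_sol N (cnj t) 0 \<noteq> 0" by (intro up) simp
      thus ?thesis by (simp add: backward_sol_cnj)
    next
      case 3
      then obtain x where "t = of_real x" "x \<le> 0" by (metis complex_is_Real_iff Re_complex_of_real Reals_cases)
      thus ?thesis using backward_sol_nonpos[of x 0 N] by simp
    next
      case 4
      hence "norm t < 1" by (simp add: cmod_def)
      thus ?thesis by (rule trunc_series[of _ 0]) simp
    next
      case 5
      then obtain x where "t = of_real x" "x \<ge> 1" by (metis complex_is_Real_iff Re_complex_of_real Reals_cases)
      thus ?thesis using that by simp
    qed
  qed
  thus "(\<lambda>t. backward_sol N t a / backward_sol N t 0) holomorphic_on - complex_of_real ` {1..}"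
    by (intro holomorphic_intros backward_sol_holomorphic)
  show "(\<lambda>t. backward_sol N t a / backward_sol N t 0) has_fps_expansion Abs_fps (\<lambda>n. of_real (trunc N n a))"
  proof (rule has_fps_expansionI)
    show "\<forall>\<^sub>F u in nhds 0. (\<lambda>n. fps_nth (Abs_fps (\<lambda>n. complex_of_real (trunc N n a))) n * u ^ n)
        sums (backward_sol N u a / backward_sol N u 0)"
      unfolding eventually_nhds
      by (rule exI[of _ "ball 0 1"]) (use trunc_series(2) a in auto)
  qed
  show "trunc N 0 a > 0"
  proof -
    have "trunc N 0 a = \<mu> 0 a" using a by (intro trunc_eq) simp
    thus ?thesis using initial_pos by simp
  qed
qed

text \<open>Each moment of the truncated problem is eventually constant in \<open>N\<close>, so the measures for finite \<open>N\<close> have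
a limit with the moments of the full recurrence.\<close>

theorem measure_with_moments:
  assumes a: "a \<in> {1..p}"
  shows "\<exists>M. real_distribution M \<and> (AE x in M. x \<in> {0..1}) \<and>
    (\<forall>n. (\<integral>x. x ^ n \<partial>M) = \<mu> n a / \<mu> 0 a)"
proof -
  have "\<forall>K. \<exists>M. real_distribution M \<and> (AE x in M. x \<in> {0..1}) \<and>
    (\<forall>n. (\<integral>x. x ^ n \<partial>M) = trunc (a + K) n a / trunc (a + K) 0 a)"
    using trunc_moments a by simp
  then obtain M where M: "\<And>K. real_distribution (M K)" "\<And>K. AE x in M K. x \<in> {0..1}"
    "\<And>K n. (\<integral>x. x ^ n \<partial>M K) = trunc (a + K) n a / trunc (a + K) 0 a" by metis
  have "(\<lambda>K. \<integral>x. x ^ n \<partial>M K) \<longlonglongrightarrow> \<mu> n a / \<mu> 0 a" for n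
  proof (rule tendsto_eventually, rule eventually_sequentiallyI[of "p * n"])
    fix K assume "p * n \<le> K"
    thus "(\<integral>x. x ^ n \<partial>M K) = \<mu> n a / \<mu> 0 a"
      unfolding M(3) by (simp add: trunc_eq)
  qed
  from moments_weak_limit[OF M(1,2) this] show ?thesis .
qed

end

section \<open>Stieltjes measures on the unit interval\<close>

text \<open>The factor \<open>c\<close> is needed because the spectral measures are not probability measures in general: their
masses are fixed by the unit diagonal of the initial condition matrix.\<close>

lemma scaled_distribution_stieltjes:
  fixes M :: "real measure" and c :: real
  assumes "real_distribution M" "AE x in M. x \<in> {0..1}" "c > 0"
  obtains \<psi> where "stieltjes_01 \<psi>" "interval_measure \<psi> = density M (\<lambda>_. ennreal c)"
proof -
  interpret M: real_distribution M by fact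
  define \<psi> where "\<psi> x = c * cdf M x" for x
  have mono: "\<psi> x \<le> \<psi> y" if "x \<le> y" for x y
    using that M.cdf_nondecreasing assms by (simp add: \<psi>_def mult_left_mono)
  have cont: "continuous (at_right x) \<psi>" for x
    unfolding \<psi>_def by (intro continuous_intros M.cdf_is_right_cont)
  have neg: "\<psi> x = 0" if "x < 0" for x
  proof -
    have "AE y in M. y \<notin> {..x}" using assms(2) by eventually_elim (use that in auto)
    hence "measure M {..x} = 0" by (subst M.prob_eq_0) auto
    thus ?thesis by (simp add: \<psi>_def cdf_def)
  qed
  have above: "\<psi> x = \<psi> 1" if "x \<ge> 1" for x
  proof -
    have "measure M {..y} = 1" if "y \<ge> 1" for y
    proof (subst M.prob_eq_1)
      show "AE z in M. z \<in> {..y}" using assms(2) by eventually_elim (use that in auto)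
    qed auto
    thus ?thesis using that by (simp add: \<psi>_def cdf_def)
  qed
  have "stieltjes_01 \<psi>"
    unfolding stieltjes_01_def mono_def using mono cont neg above by blast
  moreover have "interval_measure \<psi> = density M (\<lambda>_. ennreal c)"
  proof (rule cdf_unique')
    have bot: "(\<psi> \<longlongrightarrow> 0) at_bot"
      unfolding \<psi>_def using tendsto_mult_left[OF M.cdf_lim_at_bot, of c] by simp
    have top: "(\<psi> \<longlongrightarrow> c) at_top"
      unfolding \<psi>_def using tendsto_mult_left[OF M.cdf_lim_at_top_prob, of c] by simp
    show "finite_borel_measure (interval_measure \<psi>)"
      by (rule finite_borel_measure_interval_measure[OF mono cont bot top]) (use assms in auto)
    have em: "emeasure (density M (\<lambda>_. ennreal c)) A = ennreal c * emeasure M A" if "A \<in> sets M" for A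
      using that by (simp add: emeasure_density_const)
    show fin: "finite_borel_measure (density M (\<lambda>_. ennreal c))"
    proof (intro finite_borel_measure.intro finite_measureI finite_borel_measure_axioms.intro)
      show "emeasure (density M (\<lambda>_. ennreal c)) (space (density M (\<lambda>_. ennreal c))) \<noteq> \<infinity>"
        using em[of UNIV] by (simp add: M.emeasure_eq_measure ennreal_mult_eq_top_iff)
    qed simp
    show "cdf (interval_measure \<psi>) = cdf (density M (\<lambda>_. ennreal c))"
    proof -
      have "cdf (density M (\<lambda>_. ennreal c)) x = \<psi> x" for x
      proof -
        have "emeasure (density M (\<lambda>_. ennreal c)) {..x} = ennreal (\<psi> x)"
          using em[of "{..x}"] assms(3)
          by (simp add: M.emeasure_eq_measure \<psi>_def cdf_def ennreal_mult)
        moreover have "\<psi> x \<ge> 0"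
          using assms(3) M.cdf_nonneg by (simp add: \<psi>_def)
        ultimately show ?thesis by (simp add: cdf_def measure_def)
      qed
      thus ?thesis by (intro ext) (simp only: cdf_interval_measure[OF mono cont bot])
    qed
  qed
  ultimately show ?thesis by (rule that)
qed

lemma stieltjes_finite_measure:
  assumes "stieltjes_01 \<psi>"
  shows "finite_measure (interval_measure \<psi>)"
proof -
  have mono: "\<psi> x \<le> \<psi> y" if "x \<le> y" for x y
    using assms that unfolding stieltjes_01_def by (blast dest: monoD)
  have zero: "\<psi> x = 0" if "x < 0" for x using assms that unfolding stieltjes_01_def by blast
  have one: "\<psi> x = \<psi> 1" if "x \<ge> 1" for x using assms that unfolding stieltjes_01_def by blast
  have cont: "continuous (at_right x) \<psi>" for x
    using assms unfolding stieltjes_01_def by blast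
  have bot: "(\<psi> \<longlongrightarrow> 0) at_bot"
    by (rule tendsto_eventually) (use zero in \<open>auto intro: eventually_mono[OF eventually_gt_at_bot[of 0]]\<close>)
  have top: "(\<psi> \<longlongrightarrow> \<psi> 1) at_top"
    by (rule tendsto_eventually, rule eventually_mono[OF eventually_ge_at_top[of 1]]) (rule one)
  have nonneg: "\<psi> 1 \<ge> 0" using mono[of "-1" 1] zero[of "-1"] by simp
  interpret finite_borel_measure "interval_measure \<psi>"
    by (rule finite_borel_measure_interval_measure[OF mono cont bot top nonneg])
  show ?thesis by unfold_locales
qed

lemma stieltjes_integrable:
  fixes f :: "real \<Rightarrow> 'a :: {banach, second_countable_topology}"
  assumes "stieltjes_01 \<psi>" "continuous_on {0..1} f"
  shows "set_integrable (interval_measure \<psi>) {0..1} f"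
proof -
  interpret finite_measure "interval_measure \<psi>" by (rule stieltjes_finite_measure) fact
  have "compact (f ` {0..1})" by (rule compact_continuous_image) (use assms in auto)
  then obtain C where C: "\<And>x. x \<in> {0..1} \<Longrightarrow> norm (f x) \<le> C"
    by (meson bounded_iff compact_imp_bounded imageI)
  show ?thesis
    unfolding set_integrable_def
  proof (rule integrable_const_bound[of _ "\<bar>C\<bar>"])
    have "norm (indicat_real {0..1} x *\<^sub>R f x) \<le> \<bar>C\<bar>" for x
      using C[of x] by (cases "x \<in> {0..1}") auto
    thus "AE x in interval_measure \<psi>. norm (indicat_real {0..1} x *\<^sub>R f x) \<le> \<bar>C\<bar>" by simp
    show "(\<lambda>x. indicat_real {0..1} x *\<^sub>R f x) \<in> borel_measurable (interval_measure \<psi>)"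
      using borel_measurable_continuous_on_indicator[OF _ assms(2)]
      by (simp add: measurable_cong_sets[OF sets_interval_measure refl])
  qed
qed

text \<open>Expansion of the resolvent kernel in a geometric series, integrated term by term.\<close>

lemma stieltjes_resolvent_sums:
  fixes f :: "real \<Rightarrow> real" and s :: complex
  assumes \<psi>: "stieltjes_01 \<psi>" and f: "continuous_on {0..1} f" and s: "norm s < 1"
  shows "(\<lambda>n. of_real (LINT x:{0..1}|interval_measure \<psi>. x ^ n * f x) * s ^ n) sums
    (LINT x:{0..1}|interval_measure \<psi>. of_real (f x) / (1 - s * of_real x))"
proof -
  let ?M = "interval_measure \<psi>"
  define g where "g n x = indicat_real {0..1} x *\<^sub>R (of_real (x ^ n * f x) * s ^ n)" for n x
  have int: "integrable ?M (\<lambda>x. indicat_real {0..1} x *\<^sub>R (x ^ n * f x))" for n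
    using stieltjes_integrable[OF \<psi>, of "\<lambda>x. x ^ n * f x"] f
    by (simp add: set_integrable_def continuous_intros)
  have g_eq: "g n x = of_real (indicat_real {0..1} x *\<^sub>R (x ^ n * f x)) * s ^ n" for n x
    by (simp add: g_def scaleR_conv_of_real)
  have g_int: "integrable ?M (g n)" for n
    unfolding g_eq[abs_def] by (intro integrable_mult_left integrable_of_real int)
  have norm_g: "norm (g n x) \<le> norm s ^ n * norm (indicat_real {0..1} x *\<^sub>R f x)" for n x
  proof (cases "x \<in> {0..1}")
    case True
    hence "\<bar>x\<bar> ^ n \<le> 1" by (intro power_le_one) auto
    hence "\<bar>x\<bar> ^ n * (\<bar>f x\<bar> * norm s ^ n) \<le> 1 * (\<bar>f x\<bar> * norm s ^ n)"
      by (intro mult_right_mono) auto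
    thus ?thesis using True by (simp add: g_def norm_mult norm_power abs_mult power_abs mult_ac)
  qed (simp add: g_def)
  have geo: "summable (\<lambda>n. norm s ^ n * c)" for c :: real
    using s by (intro summable_mult2 summable_geometric) auto
  have f_int: "integrable ?M (\<lambda>x. indicat_real {0..1} x *\<^sub>R f x)" using int[of 0] by simp
  have "(\<lambda>n. integral\<^sup>L ?M (g n)) sums (\<integral>x. (\<Sum>n. g n x) \<partial>?M)"
  proof (rule sums_integral[OF g_int])
    show "AE x in ?M. summable (\<lambda>n. norm (g n x))"
    proof (rule AE_I2)
      fix x
      show "summable (\<lambda>n. norm (g n x))"
      proof (rule summable_comparison_test[OF _ geo], intro exI allI impI)
        show "norm (norm (g n x)) \<le> norm s ^ n * norm (indicat_real {0..1} x *\<^sub>R f x)" for n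
          using norm_g[of n x] by simp
      qed
    qed
    show "summable (\<lambda>n. \<integral>x. norm (g n x) \<partial>?M)"
    proof (rule summable_comparison_test[OF _ geo], intro exI allI impI)
      fix n
      have "(\<integral>x. norm (g n x) \<partial>?M) \<le>
          (\<integral>x. norm s ^ n * norm (indicat_real {0..1} x *\<^sub>R f x) \<partial>?M)"
        by (intro integral_mono norm_g integrable_norm g_int integrable_mult_right f_int)
      thus "norm (\<integral>x. norm (g n x) \<partial>?M) \<le>
          norm s ^ n * (\<integral>x. norm (indicat_real {0..1} x *\<^sub>R f x) \<partial>?M)"
        by (simp only: integral_mult_right_zero) (simp add: Bochner_Integration.integral_nonneg)
    qed
  qed
  moreover have "integral\<^sup>L ?M (g n) = of_real (LINT x:{0..1}|?M. x ^ n * f x) * s ^ n" for n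
    unfolding g_eq[abs_def] set_lebesgue_integral_def
    by (simp only: integral_mult_left_zero integral_complex_of_real)
  moreover have "(\<Sum>n. g n x) = indicat_real {0..1} x *\<^sub>R (of_real (f x) / (1 - s * of_real x))" for x
  proof (cases "x \<in> {0..1}")
    case True
    hence "norm s * \<bar>x\<bar> \<le> norm s * 1" by (intro mult_left_mono) auto
    hence "norm (s * of_real x) < 1" using s by (simp add: norm_mult)
    hence "(\<lambda>n. of_real (f x) * (s * of_real x) ^ n) sums (of_real (f x) * (1 / (1 - s * of_real x)))"
      by (intro sums_mult geometric_sums)
    thus ?thesis using True by (simp add: g_def sums_iff power_mult_distrib mult_ac)
  qed (simp add: g_def)
  ultimately show ?thesis by (simp add: set_lebesgue_integral_def)
qed

text \<open>By monotone convergence the integral of \<open>1 / (1 - x) = \<Sum>\<^sub>n x\<^sup>n\<close> is the sum of the moments; both sides of this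
geometric series are infinite at \<open>x = 1\<close>, so an atom there is counted correctly.\<close>

lemma stieltjes_diverges_iff:
  assumes \<psi>: "stieltjes_01 \<psi>"
  shows "integral_diverges \<psi> \<longleftrightarrow> \<not> summable (\<lambda>n. LINT x:{0..1}|interval_measure \<psi>. x ^ n)"
proof -
  let ?M = "interval_measure \<psi>"
  have int: "integrable ?M (\<lambda>x. indicat_real {0..1} x *\<^sub>R x ^ n)" for n
    using stieltjes_integrable[OF \<psi>, of "\<lambda>x. x ^ n"] by (simp add: set_integrable_def continuous_intros)
  have nn: "indicat_real {0..1} x *\<^sub>R x ^ n \<ge> 0" for x :: real and n
    by (auto simp: indicator_def)
  have geom: "(1 / ennreal (1 - x)) * indicator {0..1} x =
      (\<Sum>n. ennreal (indicat_real {0..1} x *\<^sub>R x ^ n))" for x :: real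
  proof (cases "x \<in> {0..1}")
    case True
    show ?thesis
    proof (cases "x = 1")
      case True
      have "(\<Sum>n::nat. (1::ennreal)) = top"
        using summable_suminf_not_top[of "\<lambda>_. 1"] by (auto simp: summable_const_iff)
      thus ?thesis using True by simp
    next
      case False
      hence "(\<lambda>n. x ^ n) sums (1 / (1 - x))" using \<open>x \<in> {0..1}\<close> by (intro geometric_sums) auto
      hence "(\<Sum>n. ennreal (x ^ n)) = ennreal (1 / (1 - x))"
        using \<open>x \<in> {0..1}\<close> by (subst suminf_ennreal2) (auto simp: sums_iff)
      thus ?thesis using \<open>x \<in> {0..1}\<close> False by (simp add: divide_ennreal[symmetric])
    qed
  qed simp
  have "(\<integral>\<^sup>+x\<in>{0..1}. (1 / ennreal (1 - x)) \<partial>?M) =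
      (\<Sum>n. \<integral>\<^sup>+x. ennreal (indicat_real {0..1} x *\<^sub>R x ^ n) \<partial>?M)"
    unfolding geom by (rule nn_integral_suminf) measurable
  also have "\<dots> = (\<Sum>n. ennreal (LINT x:{0..1}|?M. x ^ n))"
    unfolding set_lebesgue_integral_def using nn int
    by (intro suminf_cong nn_integral_eq_integral) auto
  finally have "integral_diverges \<psi> \<longleftrightarrow> (\<Sum>n. ennreal (LINT x:{0..1}|?M. x ^ n)) = top"
    by (simp add: integral_diverges_def)
  moreover have nonneg: "(LINT x:{0..1}|?M. x ^ n) \<ge> 0" for n
    unfolding set_lebesgue_integral_def by (intro Bochner_Integration.integral_nonneg nn)
  have "(\<Sum>n. ennreal (LINT x:{0..1}|?M. x ^ n)) \<noteq> top" if "summable (\<lambda>n. LINT x:{0..1}|?M. x ^ n)"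
    by (simp only: suminf_ennreal2[OF nonneg that] ennreal_neq_top not_False_eq_True)
  moreover have "summable (\<lambda>n. LINT x:{0..1}|?M. x ^ n)" if "(\<Sum>n. ennreal (LINT x:{0..1}|?M. x ^ n)) \<noteq> top"
    by (rule summable_suminf_not_top[OF nonneg that])
  ultimately show ?thesis by blast
qed

section \<open>Row-finite and bidiagonal matrices\<close>

text \<open>For row-finite left factors the series defining the product are finite sums, and the product is
associative.\<close>

definition row_finite :: "smat \<Rightarrow> bool" where
  "row_finite A \<longleftrightarrow> (\<forall>i. finite {k. A i k \<noteq> 0})"

lemma smat_mult_finite_sum:
  assumes "finite S" "\<And>k. k \<notin> S \<Longrightarrow> A i k * B k j = 0"
  shows "smat_mult A B i j = (\<Sum>k\<in>S. A i k * B k j)"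
  unfolding smat_mult_def by (rule suminf_finite) (use assms in auto)

lemma smat_mult_row_sum:
  assumes "row_finite A"
  shows "smat_mult A B i j = (\<Sum>k | A i k \<noteq> 0. A i k * B k j)"
  by (rule smat_mult_finite_sum) (use assms in \<open>auto simp: row_finite_def\<close>)

lemma smat_mult_sums:
  assumes "row_finite A"
  shows "(\<lambda>k. A i k * B k j) sums smat_mult A B i j"
  unfolding smat_mult_row_sum[OF assms]
  by (rule sums_finite) (use assms in \<open>auto simp: row_finite_def\<close>)

lemma row_finite_one [simp]: "row_finite smat_one"
  by (auto simp: row_finite_def smat_one_def)

lemma row_finite_mult [simp]:
  assumes "row_finite A" "row_finite B"
  shows "row_finite (smat_mult A B)"
  unfolding row_finite_def
proof
  fix i
  have "{j. smat_mult A B i j \<noteq> 0} \<subseteq> (\<Union>k\<in>{k. A i k \<noteq> 0}. {j. B k j \<noteq> 0})"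
  proof
    fix j assume "j \<in> {j. smat_mult A B i j \<noteq> 0}"
    hence "(\<Sum>k | A i k \<noteq> 0. A i k * B k j) \<noteq> 0" by (simp add: smat_mult_row_sum[OF assms(1)])
    then obtain k where "A i k \<noteq> 0" "A i k * B k j \<noteq> 0" by (metis (mono_tags, lifting) mem_Collect_eq sum.neutral)
    thus "j \<in> (\<Union>k\<in>{k. A i k \<noteq> 0}. {j. B k j \<noteq> 0})" by auto
  qed
  moreover have "finite (\<Union>k\<in>{k. A i k \<noteq> 0}. {j. B k j \<noteq> 0})"
    using assms by (intro finite_UN_I) (auto simp: row_finite_def)
  ultimately show "finite {j. smat_mult A B i j \<noteq> 0}" by (rule finite_subset)
qed

lemma smat_mult_assoc:
  assumes A: "row_finite A" and B: "row_finite B"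
  shows "smat_mult (smat_mult A B) C = smat_mult A (smat_mult B C)"
proof (intro ext)
  fix i j
  let ?S = "{k. A i k \<noteq> 0}"
  let ?T = "\<Union>k\<in>?S. {l. B k l \<noteq> 0}"
  have fin: "finite ?S" "finite ?T" using A B by (auto simp: row_finite_def)
  have "smat_mult (smat_mult A B) C i j = (\<Sum>l\<in>?T. smat_mult A B i l * C l j)"
  proof (rule smat_mult_finite_sum[OF fin(2)])
    fix l assume "l \<notin> ?T"
    hence "smat_mult A B i l = 0" unfolding smat_mult_row_sum[OF A] by (intro sum.neutral) auto
    thus "smat_mult A B i l * C l j = 0" by simp
  qed
  also have "\<dots> = (\<Sum>l\<in>?T. \<Sum>k\<in>?S. A i k * B k l * C l j)"
    by (simp add: smat_mult_row_sum[OF A] sum_distrib_right)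
  also have "\<dots> = (\<Sum>k\<in>?S. A i k * (\<Sum>l\<in>?T. B k l * C l j))"
    by (subst sum.swap) (simp add: sum_distrib_left mult.assoc)
  also have "\<dots> = (\<Sum>k\<in>?S. A i k * smat_mult B C k j)"
  proof (intro sum.cong refl arg_cong2[of _ _ _ _ "(*)"])
    fix k assume "k \<in> ?S"
    show "(\<Sum>l\<in>?T. B k l * C l j) = smat_mult B C k j"
      by (rule smat_mult_finite_sum[OF fin(2), symmetric]) (use \<open>k \<in> ?S\<close> in auto)
  qed
  also have "\<dots> = smat_mult A (smat_mult B C) i j" by (simp add: smat_mult_row_sum[OF A])
  finally show "smat_mult (smat_mult A B) C i j = smat_mult A (smat_mult B C) i j" .
qed

lemma smat_mult_one_left [simp]: "smat_mult smat_one A = A"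
proof (intro ext)
  fix i j
  have "smat_mult smat_one A i j = (\<Sum>k\<in>{i}. smat_one i k * A k j)"
    by (rule smat_mult_finite_sum) (auto simp: smat_one_def)
  thus "smat_mult smat_one A i j = A i j" by (simp add: smat_one_def)
qed

lemma smat_mult_one_right [simp]: "smat_mult A smat_one = A"
proof (intro ext)
  fix i j
  have "smat_mult A smat_one i j = (\<Sum>k\<in>{j}. A i k * smat_one k j)"
    by (rule smat_mult_finite_sum) (auto simp: smat_one_def)
  thus "smat_mult A smat_one i j = A i j" by (simp add: smat_one_def)
qed

lemma row_finite_pow [simp]: "row_finite A \<Longrightarrow> row_finite (smat_pow A n)"
  by (induction n) auto

lemma smat_pow_Suc_right:
  "row_finite A \<Longrightarrow> smat_pow A (Suc n) = smat_mult (smat_pow A n) A"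
proof (induction n)
  case (Suc n)
  have "smat_pow A (Suc (Suc n)) = smat_mult A (smat_mult (smat_pow A n) A)"
    using Suc by simp
  also have "\<dots> = smat_mult (smat_pow A (Suc n)) A"
    using Suc.prems by (simp add: smat_mult_assoc)
  finally show ?case .
qed simp

lemma smat_pow_add:
  "row_finite A \<Longrightarrow> smat_pow A (m + n) = smat_mult (smat_pow A m) (smat_pow A n)"
  by (induction m) (auto simp: smat_mult_assoc)

lemma row_finite_prod: "(\<And>A. A \<in> set As \<Longrightarrow> row_finite A) \<Longrightarrow> row_finite (smat_prod As)"
  by (induction As) (auto simp: smat_prod_def)

lemma smat_prod_append:
  "(\<And>A. A \<in> set As \<Longrightarrow> row_finite A) \<Longrightarrow>
    smat_prod (As @ Bs) = smat_mult (smat_prod As) (smat_prod Bs)"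
proof (induction As)
  case (Cons A As)
  have "row_finite (smat_prod As)" by (rule row_finite_prod) (use Cons.prems in auto)
  thus ?case using Cons by (simp add: smat_prod_def smat_mult_assoc)
qed (simp add: smat_prod_def)

lemma smat_prod_singleton [simp]: "smat_prod [A] = A"
  by (simp add: smat_prod_def)

lemma smat_transpose_mult:
  "smat_transpose (smat_mult A B) = smat_mult (smat_transpose B) (smat_transpose A)"
  by (simp add: fun_eq_iff smat_transpose_def smat_mult_def mult.commute)

lemma smat_transpose_one [simp]: "smat_transpose smat_one = smat_one"
  by (auto simp: fun_eq_iff smat_transpose_def smat_one_def)

lemma smat_transpose_pow:
  "row_finite A \<Longrightarrow> smat_transpose (smat_pow A n) = smat_pow (smat_transpose A) n"
proof (induction n)
  case (Suc n)
  have "smat_transpose (smat_pow A (Suc n)) = smat_transpose (smat_mult (smat_pow A n) A)"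
    by (simp only: smat_pow_Suc_right[OF Suc.prems])
  thus ?case using Suc by (simp add: smat_transpose_mult)
qed simp

lemma smat_transpose_prod:
  "(\<And>A. A \<in> set As \<Longrightarrow> row_finite (smat_transpose A)) \<Longrightarrow>
    smat_transpose (smat_prod As) = smat_prod (rev (map smat_transpose As))"
proof (induction As)
  case (Cons A As)
  have "smat_transpose (smat_prod (A # As)) = smat_mult (smat_transpose (smat_prod As)) (smat_transpose A)"
    by (simp add: smat_prod_def smat_transpose_mult)
  also have "\<dots> = smat_mult (smat_prod (rev (map smat_transpose As))) (smat_prod [smat_transpose A])"
    using Cons by simp
  also have "\<dots> = smat_prod (rev (map smat_transpose As) @ [smat_transpose A])"
    by (rule smat_prod_append[symmetric]) (use Cons.prems in auto)
  finally show ?case by simp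
qed (simp add: smat_prod_def)

lemma stochastic_nonneg: "stochastic A \<Longrightarrow> A i j \<ge> 0"
  by (simp add: stochastic_def)

lemma stochastic_le_one:
  assumes "stochastic A" shows "A i j \<le> 1"
proof -
  have "sum (A i) {j} \<le> suminf (A i)"
    using assms by (intro sum_le_suminf) (auto simp: stochastic_def sums_iff)
  thus ?thesis using assms by (simp add: stochastic_def sums_iff)
qed

lemma stochastic_one: "stochastic smat_one"
  unfolding stochastic_def
proof (intro conjI allI)
  fix i
  have "smat_one i = (\<lambda>j. if j = i then 1 else 0)" by (auto simp: smat_one_def)
  thus "smat_one i sums 1" using sums_single[of i "\<lambda>_. 1 :: real"] by simp
qed (simp add: smat_one_def)

lemma stochastic_mult:
  assumes A: "stochastic A" "row_finite A" and B: "stochastic B"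
  shows "stochastic (smat_mult A B)"
  unfolding stochastic_def
proof (intro conjI allI)
  fix i j
  show "0 \<le> smat_mult A B i j"
    unfolding smat_mult_row_sum[OF A(2)]
    by (intro sum_nonneg mult_nonneg_nonneg stochastic_nonneg A B)
next
  fix i
  have "(\<lambda>j. \<Sum>k | A i k \<noteq> 0. A i k * B k j) sums (\<Sum>k | A i k \<noteq> 0. A i k * 1)"
    by (intro sums_sum sums_mult) (use B in \<open>auto simp: stochastic_def\<close>)
  moreover have "(\<Sum>k | A i k \<noteq> 0. A i k) = suminf (A i)"
    by (rule suminf_finite[symmetric]) (use A in \<open>auto simp: row_finite_def\<close>)
  moreover have "suminf (A i) = 1" using A(1) by (simp add: stochastic_def sums_iff)
  moreover have "(\<lambda>j. \<Sum>k | A i k \<noteq> 0. A i k * B k j) = smat_mult A B i"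
    by (rule ext) (rule smat_mult_row_sum[OF A(2), symmetric])
  ultimately show "smat_mult A B i sums 1" by simp
qed

lemma stochastic_pow: "stochastic A \<Longrightarrow> row_finite A \<Longrightarrow> stochastic (smat_pow A n)"
  by (induction n) (auto intro: stochastic_one stochastic_mult)

lemma stochastic_prod:
  "(\<And>A. A \<in> set As \<Longrightarrow> stochastic A \<and> row_finite A) \<Longrightarrow> stochastic (smat_prod As)"
  by (induction As) (auto simp: smat_prod_def intro: stochastic_one stochastic_mult)

text \<open>The transpose of a stochastic bidiagonal matrix is in general not stochastic; only the sign pattern
survives transposition. It is what the two types of chains have in common.\<close>

definition positive_lower_bidiagonal :: "smat \<Rightarrow> bool" where
  "positive_lower_bidiagonal L \<longleftrightarrow>
     (\<forall>i j. j \<noteq> i \<and> i \<noteq> Suc j \<longrightarrow> L i j = 0) \<and> (\<forall>k. L k k > 0 \<and> L (Suc k) k > 0)"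

definition positive_upper_bidiagonal :: "smat \<Rightarrow> bool" where
  "positive_upper_bidiagonal U \<longleftrightarrow>
     (\<forall>i j. j \<noteq> i \<and> j \<noteq> Suc i \<longrightarrow> U i j = 0) \<and> (\<forall>k. U k k > 0 \<and> U k (Suc k) > 0)"

lemma lower_bidiagonal_stochasticD:
  assumes "lower_bidiagonal_stochastic L"
  shows "positive_lower_bidiagonal L" "stochastic L"
proof -
  have zero: "\<And>i j. j \<noteq> i \<Longrightarrow> i \<noteq> Suc j \<Longrightarrow> L i j = 0" and L0: "L 0 0 = 1"
    and L: "\<And>k. L (Suc k) k + L (Suc k) (Suc k) = 1 \<and> L (Suc k) k > 0 \<and> L (Suc k) (Suc k) > 0"
    using assms unfolding lower_bidiagonal_stochastic_def by (auto dest!: spec[of _ "Suc _"])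
  have diag: "L k k > 0" for k using L0 L by (cases k) auto
  show "positive_lower_bidiagonal L"
    unfolding positive_lower_bidiagonal_def
  proof (intro conjI allI impI)
    show "L i j = 0" if "j \<noteq> i \<and> i \<noteq> Suc j" for i j using zero that by blast
    show "L k k > 0" "L (Suc k) k > 0" for k using diag L by blast+
  qed
  show "stochastic L"
    unfolding stochastic_def
  proof (intro conjI allI)
    fix i j
    consider "j = i" | "i = Suc j" | "j \<noteq> i" "i \<noteq> Suc j" by blast
    thus "L i j \<ge> 0"
    proof cases
      case 1 thus ?thesis using diag[of i] by simp
    next
      case 2 thus ?thesis using conjunct1[OF conjunct2[OF L[of j]]] by simp
    next
      case 3 thus ?thesis using zero[of j i] by simp
    qed
  next
    fix i
    show "L i sums 1"
    proof (cases i)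
      case 0
      have "L 0 sums (\<Sum>j\<in>{0}. L 0 j)"
      proof (rule sums_finite)
        show "L 0 j = 0" if "j \<notin> {0}" for j using zero[of j 0] that by simp
      qed simp
      thus ?thesis using L0 0 by simp
    next
      case (Suc k)
      have "L (Suc k) sums (\<Sum>j\<in>{k, Suc k}. L (Suc k) j)"
      proof (rule sums_finite)
        show "L (Suc k) j = 0" if "j \<notin> {k, Suc k}" for j using zero[of j "Suc k"] that by simp
      qed simp
      thus ?thesis using conjunct1[OF L[of k]] Suc by simp
    qed
  qed
qed

lemma upper_bidiagonal_stochasticD:
  assumes "upper_bidiagonal_stochastic U"
  shows "positive_upper_bidiagonal U" "stochastic U"
proof -
  have zero: "\<And>i j. j \<noteq> i \<Longrightarrow> j \<noteq> Suc i \<Longrightarrow> U i j = 0"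
    and U: "\<And>k. U k k + U k (Suc k) = 1 \<and> U k k > 0 \<and> U k (Suc k) > 0"
    using assms unfolding upper_bidiagonal_stochastic_def by auto
  show "positive_upper_bidiagonal U"
    unfolding positive_upper_bidiagonal_def
  proof (intro conjI allI impI)
    show "U i j = 0" if "j \<noteq> i \<and> j \<noteq> Suc i" for i j using zero that by blast
    show "U k k > 0" "U k (Suc k) > 0" for k using U by blast+
  qed
  show "stochastic U"
    unfolding stochastic_def
  proof (intro conjI allI)
    fix i j
    consider "j = i" | "j = Suc i" | "j \<noteq> i" "j \<noteq> Suc i" by blast
    thus "U i j \<ge> 0"
    proof cases
      case 1 thus ?thesis using conjunct1[OF conjunct2[OF U[of i]]] by simp
    next
      case 2 thus ?thesis using conjunct2[OF conjunct2[OF U[of i]]] by simp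
    next
      case 3 thus ?thesis using zero[of j i] by simp
    qed
  next
    fix i
    have "U i sums (\<Sum>j\<in>{i, Suc i}. U i j)"
    proof (rule sums_finite)
      show "U i j = 0" if "j \<notin> {i, Suc i}" for j using zero[of j i] that by simp
    qed simp
    thus "U i sums 1" using conjunct1[OF U[of i]] by simp
  qed
qed

lemma bidiagonal_transpose:
  "positive_upper_bidiagonal (smat_transpose A) \<longleftrightarrow> positive_lower_bidiagonal A"
  "positive_lower_bidiagonal (smat_transpose A) \<longleftrightarrow> positive_upper_bidiagonal A"
  unfolding positive_upper_bidiagonal_def positive_lower_bidiagonal_def smat_transpose_def by metis+

lemma bidiagonal_row_finite:
  assumes "positive_lower_bidiagonal A \<or> positive_upper_bidiagonal A"
  shows "row_finite A"
  unfolding row_finite_def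
proof
  fix i
  have "{k. A i k \<noteq> 0} \<subseteq> {..Suc i}"
  proof
    fix k assume "k \<in> {k. A i k \<noteq> 0}"
    hence "k = i \<or> i = Suc k \<or> k = Suc i"
      using assms unfolding positive_lower_bidiagonal_def positive_upper_bidiagonal_def by blast
    thus "k \<in> {..Suc i}" by auto
  qed
  thus "finite {k. A i k \<noteq> 0}" by (rule finite_subset) simp
qed

lemma smat_mult_lower_bidiagonal:
  assumes "positive_lower_bidiagonal L"
  shows "smat_mult A L i k = A i k * L k k + A i (Suc k) * L (Suc k) k"
proof -
  have "smat_mult A L i k = (\<Sum>j\<in>{k, Suc k}. A i j * L j k)"
    by (rule smat_mult_finite_sum) (use assms in \<open>auto simp: positive_lower_bidiagonal_def\<close>)
  thus ?thesis by simp
qed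

lemma smat_mult_upper_bidiagonal:
  assumes "positive_upper_bidiagonal U"
  shows "smat_mult A U i k = (if k = 0 then 0 else A i (k - 1) * U (k - 1) k) + A i k * U k k"
proof (cases k)
  case 0
  have "smat_mult A U i 0 = (\<Sum>j\<in>{0}. A i j * U j 0)"
    by (rule smat_mult_finite_sum) (use assms in \<open>auto simp: positive_upper_bidiagonal_def\<close>)
  thus ?thesis using 0 by simp
next
  case (Suc k')
  have "smat_mult A U i (Suc k') = (\<Sum>j\<in>{k', Suc k'}. A i j * U j (Suc k'))"
    by (rule smat_mult_finite_sum) (use assms in \<open>auto simp: positive_upper_bidiagonal_def\<close>)
  thus ?thesis using Suc by simp
qed

section \<open>Spectral measures of a bidiagonal factorization\<close>

text \<open>The common situation: \<open>Q\<close> is the transition matrix of a type II chain or the transpose of that of a type I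
chain. Stochasticity enters the spectral theory only through the bound on the first rows.\<close>

locale bidiagonal_factorization =
  fixes p :: nat and L :: "nat \<Rightarrow> smat" and U Q :: smat
  assumes p: "p \<ge> 1"
    and L: "\<And>a. a \<in> {1..p} \<Longrightarrow> positive_lower_bidiagonal (L a)"
    and U: "positive_upper_bidiagonal U"
    and Q: "Q = smat_prod (map L [1..<p + 1] @ [U])"
    and bound: "\<And>m i k. i \<le> p \<Longrightarrow>
      smat_mult (smat_pow Q m) (smat_prod (map L [1..<i + 1])) 0 k \<le> 1"
begin

definition W :: "nat \<Rightarrow> smat" where
  "W i = smat_prod (map L [1..<i + 1])"

lemma L_row_finite: "a \<in> {1..p} \<Longrightarrow> row_finite (L a)"
  using L bidiagonal_row_finite by blast

lemma W_row_finite: "i \<le> p \<Longrightarrow> row_finite (W i)"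
  unfolding W_def by (rule row_finite_prod) (auto intro: L_row_finite)

lemma W_0: "W 0 = smat_one" by (simp add: W_def smat_prod_def)

lemma W_Suc:
  assumes "Suc i \<le> p"
  shows "W (Suc i) = smat_mult (W i) (L (Suc i))"
proof -
  have "smat_prod (map L [1..<i + 1] @ [L (Suc i)]) = smat_mult (smat_prod (map L [1..<i + 1])) (smat_prod [L (Suc i)])"
    by (rule smat_prod_append) (use assms in \<open>auto intro: L_row_finite\<close>)
  thus ?thesis by (simp add: W_def)
qed

lemma Q_eq: "Q = smat_mult (W p) U"
proof -
  have "smat_prod (map L [1..<p + 1] @ [U]) = smat_mult (smat_prod (map L [1..<p + 1])) (smat_prod [U])"
    by (rule smat_prod_append) (auto intro: L_row_finite)
  thus ?thesis by (simp add: W_def Q)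
qed

lemma Q_row_finite: "row_finite Q"
  unfolding Q_eq using W_row_finite U bidiagonal_row_finite by simp

lemma L_diag: "a \<in> {1..p} \<Longrightarrow> L a k k > 0"
  and L_subdiag: "a \<in> {1..p} \<Longrightarrow> L a (Suc k) k > 0"
  and U_diag: "U k k > 0"
  and U_superdiag: "U k (Suc k) > 0"
  using L U unfolding positive_lower_bidiagonal_def positive_upper_bidiagonal_def by blast+

lemma W_step: "Suc i \<le> p \<Longrightarrow> W (Suc i) n k = W i n k * L (Suc i) k k + W i n (Suc k) * L (Suc i) (Suc k) k"
  using smat_mult_lower_bidiagonal[OF L[of "Suc i"], of "W i" n k] W_Suc by simp

lemma W_nonneg: "i \<le> p \<Longrightarrow> W i n k \<ge> 0"
proof (induction i arbitrary: k)
  case (Suc i)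
  have "L (Suc i) k k \<ge> 0" "L (Suc i) (Suc k) k \<ge> 0"
    using L_diag[of "Suc i" k] L_subdiag[of "Suc i" k] Suc.prems by simp_all
  moreover have "W i n k \<ge> 0" "W i n (Suc k) \<ge> 0" using Suc by simp_all
  ultimately show ?case using Suc.prems by (simp add: W_step)
qed (simp add: W_0 smat_one_def)

lemma W_zero: "i \<le> p \<Longrightarrow> n < k \<or> k + i < n \<Longrightarrow> W i n k = 0"
proof (induction i arbitrary: k)
  case (Suc i)
  have "W i n k = 0" "W i n (Suc k) = 0" using Suc by (auto intro!: Suc.IH)
  thus ?case using Suc.prems by (simp add: W_step)
qed (auto simp: W_0 smat_one_def)

lemma W_diag: "i \<le> p \<Longrightarrow> W i k k > 0"
proof (induction i)
  case (Suc i)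
  thus ?case using L_diag[of "Suc i" k] by (simp add: W_step W_zero)
qed (simp add: W_0 smat_one_def)

text \<open>The lowest nonzero diagonal of the product is the product of the subdiagonals of its factors.\<close>

lemma W_bottom: "i \<le> p \<Longrightarrow> W i (k + i) k > 0"
proof (induction i arbitrary: k)
  case (Suc i)
  have "W i (Suc k + i) (Suc k) > 0" using Suc.IH[of "Suc k"] Suc.prems by simp
  moreover have "W i (k + Suc i) k = 0" using Suc.prems by (intro W_zero) auto
  ultimately show ?case using L_subdiag[of "Suc i" k] Suc.prems by (simp add: W_step)
qed (simp add: W_0 smat_one_def)

lemma W_subdiag: "i \<ge> 1 \<Longrightarrow> i \<le> p \<Longrightarrow> W i (Suc k) k > 0"
proof (cases i)
  case (Suc i')
  assume i: "i \<le> p"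
  have "W i' (Suc k) k * L i k k \<ge> 0"
    using i Suc W_nonneg[of i' "Suc k" k] L_diag[of i k] by simp
  moreover have "W i' (Suc k) (Suc k) * L i (Suc k) k > 0"
    using i Suc W_diag[of i' "Suc k"] L_subdiag[of i k] by simp
  ultimately show ?thesis using i unfolding Suc by (simp add: W_step)
qed simp

lemma Q_step: "Q n k = (if k = 0 then 0 else W p n (k - 1) * U (k - 1) k) + W p n k * U k k"
  unfolding Q_eq by (rule smat_mult_upper_bidiagonal[OF U])

lemma Q_zero: "k > n + 1 \<or> n > k + p \<Longrightarrow> Q n k = 0"
proof -
  assume "k > n + 1 \<or> n > k + p"
  hence "W p n k = 0" "k \<noteq> 0 \<Longrightarrow> W p n (k - 1) = 0" by (auto intro!: W_zero)
  thus ?thesis by (simp add: Q_step)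
qed

lemma Q_superdiag: "Q n (Suc n) > 0"
  using W_diag[of p n] U_superdiag[of n] W_zero[of p n "Suc n"] by (simp add: Q_step)

lemma Q_bottom: "Q (n + p) n > 0"
  using W_bottom[of p n] U_diag[of n] W_zero[of p "n + p" "n - 1"] by (auto simp: Q_step)

lemma Q_subdiag: "Q (Suc n) n > 0"
proof -
  have "W p (Suc n) n * U n n > 0" using W_subdiag[of p n] p U_diag[of n] by simp
  moreover have "n \<noteq> 0 \<Longrightarrow> W p (Suc n) (n - 1) * U (n - 1) n \<ge> 0"
    using W_nonneg[of p "Suc n" "n - 1"] U_superdiag[of "n - 1"] by simp
  ultimately show ?thesis by (auto simp: Q_step)
qed

text \<open>The first row of \<open>Q\<^sup>m L\<^sub>1 \<cdots> L\<^sub>i\<close>. Appending one factor changes it by a two-term rule: \<open>L\<^sub>i\<^sub>+\<^sub>1\<close> mixes the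
entries \<open>k\<close> and \<open>k + 1\<close>, and \<open>U\<close>, which completes a power of \<open>Q\<close>, mixes the entries \<open>k - 1\<close> and \<open>k\<close>.\<close>

definition first_row :: "nat \<Rightarrow> nat \<Rightarrow> nat \<Rightarrow> real" where
  "first_row m i k = smat_mult (smat_pow Q m) (W i) 0 k"

lemma first_row_0_0: "first_row 0 0 k = of_bool (k = 0)"
  by (auto simp: first_row_def W_0 smat_one_def)

lemma first_row_Suc_i: "Suc i \<le> p \<Longrightarrow> first_row m (Suc i) k = L (Suc i) k k * first_row m i k + L (Suc i) (Suc k) k * first_row m i (Suc k)"
  using smat_mult_lower_bidiagonal[OF L[of "Suc i"], of "smat_mult (smat_pow Q m) (W i)" 0 k]
    smat_mult_assoc[of "smat_pow Q m" "W i" "L (Suc i)"] Q_row_finite W_row_finite[of i]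
  by (simp add: first_row_def W_Suc)

lemma first_row_Suc_m: "first_row (Suc m) 0 k = (if k = 0 then 0 else U (k - 1) k * first_row m p (k - 1)) + U k k * first_row m p k"
proof -
  have "smat_pow Q (Suc m) = smat_mult (smat_mult (smat_pow Q m) (W p)) U"
    using smat_pow_Suc_right[OF Q_row_finite, of m] smat_mult_assoc[of "smat_pow Q m" "W p" U]
      Q_row_finite W_row_finite[of p] by (simp add: Q_eq del: smat_pow.simps)
  hence "first_row (Suc m) 0 k = smat_mult (smat_mult (smat_pow Q m) (W p)) U 0 k"
    by (simp only: first_row_def W_0 smat_mult_one_right)
  thus ?thesis unfolding smat_mult_upper_bidiagonal[OF U] by (auto simp: first_row_def mult.commute)
qed

lemma first_row_zero: "i \<le> p \<Longrightarrow> k > m \<Longrightarrow> first_row m i k = 0"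
proof (induction m arbitrary: i k)
  case 0
  thus ?case by (induction i arbitrary: k) (auto simp: first_row_0_0 first_row_Suc_i)
next
  case (Suc m)
  from Suc.prems show ?case
  proof (induction i arbitrary: k)
    case 0
    have "first_row m p k = 0" "first_row m p (k - 1) = 0" using 0 by (auto intro!: Suc.IH)
    thus ?case by (simp add: first_row_Suc_m)
  qed (auto simp: first_row_Suc_i)
qed

text \<open>The two-term rules become a single branched recurrence when the entry \<open>k\<close> after \<open>i\<close> factors is given the
index \<open>n = (p + 1) k + i + 1\<close>: one more factor is a step by \<open>1\<close>, and the neighbour that enters the mixing
sits at \<open>n + p\<close>. The power of \<open>t\<close> counts the powers of \<open>Q\<close> beyond the minimal number \<open>k\<close> needed to reach the
entry \<open>k\<close>. Index \<open>0\<close> is the source of the recurrence, whence the shift by \<open>1\<close>.\<close>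

definition site_state :: "nat \<Rightarrow> nat" where "site_state n = (n - 1) div (p + 1)"
definition site_factor :: "nat \<Rightarrow> nat" where "site_factor n = (n - 1) mod (p + 1)"

definition branch_\<alpha> :: "nat \<Rightarrow> real" where
  "branch_\<alpha> n = (let k = site_state n; i = site_factor n in
     if i > 0 then L i k k else if k > 0 then U (k - 1) k else 1)"

definition branch_\<beta> :: "nat \<Rightarrow> real" where
  "branch_\<beta> n = (let k = site_state n; i = site_factor n in
     if i > 0 then L i (Suc k) k else U k k)"

definition branch_moment :: "nat \<Rightarrow> nat \<Rightarrow> real" where
  "branch_moment j n = (if n = 0 then of_bool (j = 0)
     else first_row (j + site_state n) (site_factor n) (site_state n))"

lemma site:
  assumes "i \<le> p"
  shows "site_state (Suc ((p + 1) * k + i)) = k" "site_factor (Suc ((p + 1) * k + i)) = i"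
proof -
  have "((p + 1) * k + i) div (p + 1) = k" using assms by (subst div_mult_self4) auto
  moreover have "((p + 1) * k + i) mod (p + 1) = i" using assms by (subst mod_mult_self4) auto
  ultimately show "site_state (Suc ((p + 1) * k + i)) = k" "site_factor (Suc ((p + 1) * k + i)) = i"
    unfolding site_state_def site_factor_def by simp_all
qed

lemma branch_moment_site:
  "i \<le> p \<Longrightarrow> branch_moment j (Suc ((p + 1) * k + i)) = first_row (j + k) i k"
  unfolding branch_moment_def using site by simp

lemma site_exhaust:
  assumes "n \<ge> 1"
  obtains k i where "i \<le> p" "n = Suc ((p + 1) * k + i)"
proof (rule that)
  show "(n - 1) mod (p + 1) \<le> p" using mod_less_divisor[of "p + 1" "n - 1"] by linarith
  have "n - 1 = (p + 1) * ((n - 1) div (p + 1)) + (n - 1) mod (p + 1)"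
    by (rule mult_div_mod_eq[symmetric])
  thus "n = Suc ((p + 1) * ((n - 1) div (p + 1)) + (n - 1) mod (p + 1))" using assms by linarith
qed

sublocale branched_moments p branch_\<alpha> branch_\<beta> branch_moment
proof
  fix n :: nat assume n: "n \<ge> 1"
  then obtain k i where ik: "i \<le> p" "n = Suc ((p + 1) * k + i)" by (rule site_exhaust)
  note st = site[OF ik(1), of k]
  show "branch_\<alpha> n > 0" "branch_\<beta> n > 0"
    unfolding branch_\<alpha>_def branch_\<beta>_def ik(2) st Let_def
    using L_diag[of i k] L_subdiag[of i k] U_diag[of k] U_superdiag[of "k - 1"] ik(1) by auto
  fix j :: nat
  \<comment> \<open>for \<open>j = 0\<close> the second neighbour is an entry beyond the reach of the available powers of \<open>Q\<close>, hence zero\<close>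
  show "branch_moment j n = branch_\<alpha> n * branch_moment j (n - 1) +
      (if j = 0 then 0 else branch_\<beta> n * branch_moment (j - 1) (n + p))"
  proof (cases i)
    case (Suc i')
    have i': "i' \<le> p" "Suc i' \<le> p" using ik Suc by auto
    have n': "n - 1 = Suc ((p + 1) * k + i')" "n + p = Suc ((p + 1) * Suc k + i')"
      using ik(2) Suc by auto
    have "branch_\<alpha> n = L i k k" "branch_\<beta> n = L i (Suc k) k"
      unfolding branch_\<alpha>_def branch_\<beta>_def ik(2) st Let_def using Suc by simp_all
    moreover have "branch_moment j n = first_row (j + k) i k"
      unfolding ik(2) by (rule branch_moment_site[OF ik(1)])
    moreover have "branch_moment j (n - 1) = first_row (j + k) i' k"
      "branch_moment (j - 1) (n + p) = first_row (j - 1 + Suc k) i' (Suc k)"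
      unfolding n' by (rule branch_moment_site[OF i'(1)])+
    moreover have "first_row (j + k) i k = L i k k * first_row (j + k) i' k + L i (Suc k) k * first_row (j + k) i' (Suc k)"
      unfolding Suc by (rule first_row_Suc_i[OF i'(2)])
    moreover have "j = 0 \<Longrightarrow> first_row (j + k) i' (Suc k) = 0" using i' by (intro first_row_zero) auto
    moreover have "j \<noteq> 0 \<Longrightarrow> j - 1 + Suc k = j + k" by simp
    ultimately show ?thesis by (cases "j = 0") (simp_all only: if_True if_False mult_zero_right simp_thms)
  next
    case 0
    have mom: "branch_moment j n = first_row (j + k) 0 k"
      unfolding ik(2) 0 by (rule branch_moment_site) simp
    have n': "n + p = Suc ((p + 1) * k + p)" using ik(2) 0 by simp
    have next_p: "branch_moment (j - 1) (n + p) = first_row (j - 1 + k) p k"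
      unfolding n' by (rule branch_moment_site) simp
    have b: "branch_\<beta> n = U k k" unfolding branch_\<beta>_def ik(2) st Let_def using 0 by simp
    show ?thesis
    proof (cases k)
      case k0: 0
      have "branch_\<alpha> n = 1" unfolding branch_\<alpha>_def ik(2) st Let_def using 0 k0 by simp
      moreover have "branch_moment j (n - 1) = of_bool (j = 0)"
        using ik(2) 0 k0 by (simp add: branch_moment_def)
      moreover have "first_row j 0 0 = (if j = 0 then 1 else U 0 0 * first_row (j - 1) p 0)"
        by (cases j) (simp_all add: first_row_0_0 first_row_Suc_m)
      ultimately show ?thesis using mom next_p b k0 by (cases "j = 0") simp_all
    next
      case k: (Suc k')
      have "branch_\<alpha> n = U k' k" unfolding branch_\<alpha>_def ik(2) st Let_def using 0 k by simp
      moreover have n1: "n - 1 = Suc ((p + 1) * k' + p)" using ik(2) 0 k by simp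
      have "branch_moment j (n - 1) = first_row (j + k') p k'"
        unfolding n1 by (rule branch_moment_site) simp
      moreover have "first_row (j + k) 0 k = U k' k * first_row (j + k') p k' + U k k * first_row (j + k') p k"
        using first_row_Suc_m[of "j + k'" k] k by simp
      moreover have "j = 0 \<Longrightarrow> first_row (j + k') p k = 0" using k by (intro first_row_zero) auto
      moreover have "j \<noteq> 0 \<Longrightarrow> j - 1 + k = j + k'" using k by simp
      ultimately show ?thesis using mom next_p b
        by (cases "j = 0") (simp_all only: if_True if_False mult_zero_right simp_thms)
    qed
  qed
next
  fix j show "branch_moment j 0 = of_bool (j = 0)" by (simp add: branch_moment_def)
next
  fix j n
  show "branch_moment j n \<le> 1"
  proof (cases "n = 0")
    case False
    hence "n \<ge> 1" by simp
    then obtain k i where "i \<le> p" "n = Suc ((p + 1) * k + i)" by (rule site_exhaust)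
    thus ?thesis using branch_moment_site[of i j k] bound[of i "j + k" k] by (simp add: first_row_def W_def)
  qed (simp add: branch_moment_def)
qed

definition spectral_moment :: "nat \<Rightarrow> nat \<Rightarrow> real" where
  "spectral_moment a n = smat_mult (smat_pow Q n) (W (a - 1)) 0 0"

lemma spectral_moment_eq: "a \<in> {1..p} \<Longrightarrow> spectral_moment a n = branch_moment n a"
  using branch_moment_site[of "a - 1" n 0]
  by (cases a) (simp_all add: spectral_moment_def first_row_def)

text \<open>For \<open>1 \<le> a \<le> p\<close> the index \<open>a\<close> belongs to the entry \<open>0\<close> after \<open>a - 1\<close> factors, so \<open>S\<^sub>a\<close> generates exactly
the numbers \<open>(Q\<^sup>n L\<^sub>1 \<cdots> L\<^sub>a\<^sub>-\<^sub>1)\<^sub>0\<^sub>0\<close>.\<close>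

lemma spectral_measure:
  assumes "a \<in> {1..p}" "c > 0"
  shows "\<exists>\<psi>. stieltjes_01 \<psi> \<and>
    (\<forall>n. (LINT x:{0..1}|interval_measure \<psi>. x ^ n) = c * spectral_moment a n)"
proof -
  obtain M where M: "real_distribution M" "AE x in M. x \<in> {0..1}"
    "\<And>n. (\<integral>x. x ^ n \<partial>M) = branch_moment n a / branch_moment 0 a"
    using measure_with_moments[OF assms(1)] by blast
  have pos: "branch_moment 0 a > 0" by (rule initial_pos)
  interpret M: real_distribution M by fact
  obtain \<psi> where \<psi>: "stieltjes_01 \<psi>"
    "interval_measure \<psi> = density M (\<lambda>_. ennreal (c * branch_moment 0 a))"
    using scaled_distribution_stieltjes[OF M(1,2), of "c * branch_moment 0 a"] pos assms(2) by auto
  have "(LINT x:{0..1}|interval_measure \<psi>. x ^ n) = c * spectral_moment a n" for n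
  proof -
    have "(LINT x:{0..1}|interval_measure \<psi>. x ^ n) =
        (\<integral>x. (c * branch_moment 0 a) * (indicat_real {0..1} x * x ^ n) \<partial>M)"
      unfolding \<psi>(2) set_lebesgue_integral_def using pos assms(2)
      by (subst integral_density) auto
    also have "\<dots> = (c * branch_moment 0 a) * (\<integral>x. indicat_real {0..1} x * x ^ n \<partial>M)"
      by (rule integral_mult_right_zero)
    also have "(\<integral>x. indicat_real {0..1} x * x ^ n \<partial>M) = (\<integral>x. x ^ n \<partial>M)"
    proof (rule integral_cong_AE)
      show "AE x in M. indicat_real {0..1} x * x ^ n = x ^ n"
        using M(2) by eventually_elim simp
    qed auto
    finally show ?thesis using pos spectral_moment_eq[OF assms(1)] M(3) by simp
  qed
  thus ?thesis using \<psi>(1) by blast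
qed

lemma spectral_moment_expand:
  assumes "a \<in> {1..p}"
  shows "spectral_moment a n = (\<Sum>j<a. smat_pow Q n 0 j * W (a - 1) j 0)"
  unfolding spectral_moment_def
  by (rule smat_mult_finite_sum) (use W_zero[of "a - 1" _ 0] assms in auto)

end

section \<open>The spectral Favard theorem\<close>

lemma smat_pow_hessenberg_column:
  assumes T_zero: "\<forall>i j. j > i + 1 \<or> i > j + p \<longrightarrow> T i j = 0"
    and T_super: "\<And>n. T n (Suc n) = 1" and fin: "row_finite T"
  shows "smat_pow T (Suc n) k l = (if l = 0 then 0 else smat_pow T n k (l - 1)) +
    (\<Sum>i=0..p. T (l + i) l * smat_pow T n k (l + i))"
proof -
  let ?f = "\<lambda>m. smat_pow T n k m * T m l"
  have "smat_pow T (Suc n) k l = sum ?f ((if l = 0 then {} else {l - 1}) \<union> {l..l + p})"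
    unfolding smat_pow_Suc_right[OF fin]
    by (rule smat_mult_finite_sum) (auto intro!: T_zero[rule_format] split: if_splits)
  also have "\<dots> = sum ?f (if l = 0 then {} else {l - 1}) + sum ?f {l..l + p}"
    by (rule sum.union_disjoint) auto
  also have "sum ?f (if l = 0 then {} else {l - 1}) = (if l = 0 then 0 else smat_pow T n k (l - 1))"
    using T_super[of "l - 1"] by (cases l) auto
  also have "sum ?f {l..l + p} = (\<Sum>i=0..p. ?f (l + i))"
    using sum.shift_bounds_cl_nat_ivl[of ?f 0 l p] by (simp add: add.commute)
  finally show ?thesis by (simp add: mult.commute)
qed

lemma smat_pow_hessenberg_row:
  assumes T_zero: "\<forall>i j. j > i + 1 \<or> i > j + p \<longrightarrow> T i j = 0"
    and T_super: "\<And>n. T n (Suc n) = 1"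
  shows "smat_pow T (Suc n) k l = smat_pow T n (Suc k) l + T k k * smat_pow T n k l +
    (\<Sum>i\<in>{1..p}. if i \<le> k then T k (k - i) * smat_pow T n (k - i) l else 0)"
proof -
  let ?f = "\<lambda>m. T k m * smat_pow T n m l"
  let ?h = "\<lambda>i. if i \<le> k then ?f (k - i) else 0"
  have "smat_pow T (Suc n) k l = sum ?f {..<Suc (Suc k)}"
    unfolding smat_pow.simps by (rule smat_mult_finite_sum) (auto intro!: T_zero[rule_format])
  also have "\<dots> = sum ?f {..<Suc k} + smat_pow T n (Suc k) l" by (simp add: T_super)
  also have "sum ?f {..<Suc k} = (\<Sum>i<Suc k. ?f (k - i))"
    using sum.nat_diff_reindex[of ?f "Suc k"] by simp
  also have "\<dots> = (\<Sum>i\<in>{0..p}. ?h i)"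
    by (rule sum.mono_neutral_cong) (auto intro!: T_zero[rule_format])
  also have "\<dots> = ?h 0 + (\<Sum>i\<in>{1..p}. ?h i)" by (simp add: sum.atLeast_Suc_atMost)
  finally show ?thesis by simp
qed

text \<open>\<open>G l q\<close> stands for \<open>\<integral> (\<Sum>\<^sub>a A\<^sup>(\<^sup>a\<^sup>)\<^sub>l d\<psi>\<^sub>a) q\<close>. Its recurrence in \<open>l\<close> is that of the first rows of the powers of \<open>T\<close>,
and since \<open>T (n + p) n \<noteq> 0\<close> it determines all values from those for \<open>l < p\<close>. The recurrence of the type II
polynomials is then that of the rows \<open>k\<close> of the powers of \<open>T\<close>, starting from row \<open>0\<close>.\<close>

lemma biorthogonality_from_first_row:
  fixes G :: "nat \<Rightarrow> real poly \<Rightarrow> real"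
  assumes T_zero: "\<forall>i j. j > i + 1 \<or> i > j + p \<longrightarrow> T i j = 0"
    and T_super: "\<And>n. T n (Suc n) = 1" and T_bottom: "\<And>n. T (n + p) n \<noteq> 0"
    and fin: "row_finite T" and p: "p \<ge> 1"
    and G_add: "\<And>l q r. G l (q + r) = G l q + G l r" and G_smult: "\<And>l c q. G l (smult c q) = c * G l q"
    and G_rec: "\<And>l q. (if l = 0 then 0 else G (l - 1) q) + (\<Sum>i=0..p. T (l + i) l * G (l + i) q) = G l ([:0, 1:] * q)"
    and base: "\<And>j n. j < p \<Longrightarrow> G j (monom 1 n) = smat_pow T n 0 j"
  shows "G l (monom 1 n * type_II_poly p T k) = smat_pow T n k l"
proof -
  have X_monom: "[:0, 1:] * monom 1 n = (monom 1 (Suc n) :: real poly)" for n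
    by (simp add: monom_Suc)
  have first: "G l (monom 1 n) = smat_pow T n 0 l" for l n
  proof (induction l arbitrary: n rule: less_induct)
    case (less l)
    show ?case
    proof (cases "l < p")
      case False
      define m where "m = l - p"
      have l: "l = m + p" using False by (simp add: m_def)
      have IH: "G j (monom 1 n') = smat_pow T n' 0 j" if "j < m + p" for j n'
        using less that l by simp
      have split: "(\<Sum>i=0..p. f i) = (\<Sum>i<p. f i) + f p" for f :: "nat \<Rightarrow> real"
        by (simp add: atLeast0AtMost lessThan_Suc_atMost[symmetric])
      have "(if m = 0 then 0 else smat_pow T n 0 (m - 1)) + (\<Sum>i<p. T (m + i) m * smat_pow T n 0 (m + i)) +
          T (m + p) m * G (m + p) (monom 1 n) = smat_pow T (Suc n) 0 m"
        using G_rec[of m "monom 1 n"] p unfolding X_monom split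
        by (simp add: IH cong: if_cong)
      also have "\<dots> = (if m = 0 then 0 else smat_pow T n 0 (m - 1)) +
          (\<Sum>i<p. T (m + i) m * smat_pow T n 0 (m + i)) + T (m + p) m * smat_pow T n 0 (m + p)"
        using smat_pow_hessenberg_column[where T = T and p = p and n = n and k = 0 and l = m, OF T_zero T_super fin]
        by (simp only: split add.assoc)
      finally show ?thesis using T_bottom[of m] l by simp
    qed (rule base)
  qed
  have G_0: "G l 0 = 0" for l using G_smult[of l 0 0] by simp
  have G_diff: "G l (q - r) = G l q - G l r" for l q r
    using G_add[of l q "smult (-1) r"] G_smult[of l "-1" r] by simp
  have G_sum: "G l (sum f S) = (\<Sum>i\<in>S. G l (f i))" if "finite S" for l f and S :: "nat set"
    using that by (induction rule: finite_induct) (auto simp: G_0 G_add)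
  show ?thesis
  proof (induction k arbitrary: n rule: less_induct)
    case (less k)
    show ?case
    proof (cases k)
      case 0
      thus ?thesis by (simp add: first)
    next
      case (Suc k')
      let ?B = "type_II_poly p T"
      have IH: "G l (monom 1 n' * ?B j) = smat_pow T n' j l" if "j \<le> k'" for j n'
        using less that Suc by simp
      have "monom 1 n * ?B k = monom 1 (Suc n) * ?B k' - smult (T k' k') (monom 1 n * ?B k') -
          (\<Sum>i\<in>{1..p}. if i \<le> k' then smult (T k' (k' - i)) (monom 1 n * ?B (k' - i)) else 0)"
      proof -
        have "[:- T k' k', 1:] = [:0, 1:] - [:T k' k':]" by simp
        hence "monom 1 n * ([:- T k' k', 1:] * ?B k') =
            monom 1 (Suc n) * ?B k' - smult (T k' k') (monom 1 n * ?B k')"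
          by (simp add: X_monom[symmetric] algebra_simps)
        moreover have "monom 1 n * (\<Sum>i\<in>{1..p}. if i \<le> k' then smult (T k' (k' - i)) (?B (k' - i)) else 0) =
            (\<Sum>i\<in>{1..p}. if i \<le> k' then smult (T k' (k' - i)) (monom 1 n * ?B (k' - i)) else 0)"
          unfolding sum_distrib_left by (intro sum.cong) auto
        ultimately show ?thesis by (simp add: Suc right_diff_distrib)
      qed
      from arg_cong[OF this, of "G l"]
      have "G l (monom 1 n * ?B k) = smat_pow T (Suc n) k' l - T k' k' * smat_pow T n k' l -
          (\<Sum>i\<in>{1..p}. if i \<le> k' then T k' (k' - i) * smat_pow T n (k' - i) l else 0)"
        by (simp only:) (simp add: G_diff G_sum G_smult IH if_distrib[of "G l"] G_0 del: type_II_poly.simps smat_pow.simps cong: if_cong)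
      also have "\<dots> = smat_pow T n (Suc k') l"
        unfolding smat_pow_hessenberg_row[where T = T and p = p and n = n and k = k' and l = l, OF T_zero T_super]
        by simp
      finally show ?thesis by (simp only: Suc)
    qed
  qed
qed

text \<open>The type I recurrence solved for its term of highest index. The argument \<open>v\<close> is a column of the initial
condition matrix.\<close>

function type_I_poly :: "nat \<Rightarrow> smat \<Rightarrow> (nat \<Rightarrow> real) \<Rightarrow> nat \<Rightarrow> real poly" where
  "type_I_poly p T v j = (if j < p \<or> p = 0 then [:v j:] else
     smult (1 / T j (j - p)) ([:0, 1:] * type_I_poly p T v (j - p)
       - (if j = p then 0 else type_I_poly p T v (j - p - 1))
       - (\<Sum>k<p. smult (T (j - p + k) (j - p)) (type_I_poly p T v (j - p + k)))))"
  by pat_completeness auto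
termination
  by (relation "Wellfounded.measure (\<lambda>(p, T, v, j). j)") auto

declare type_I_poly.simps [simp del]

lemma type_I_polys_type_I_poly:
  assumes p: "p \<ge> 1" and T_bottom: "\<And>n. T (n + p) n \<noteq> 0"
  shows "type_I_polys p T \<nu> (\<lambda>a. type_I_poly p T (\<lambda>j. \<nu> (j + 1) a))"
  unfolding type_I_polys_def
proof (intro ballI conjI allI impI)
  fix a j assume "j < p"
  thus "type_I_poly p T (\<lambda>j. \<nu> (j + 1) a) j = [:\<nu> (j + 1) a:]"
    by (simp add: type_I_poly.simps[of _ _ _ j])
next
  fix a n
  let ?A = "type_I_poly p T (\<lambda>j. \<nu> (j + 1) a)"
  have "smult (T (n + p) n) (?A (n + p)) = [:0, 1:] * ?A n - (if n = 0 then 0 else ?A (n - 1)) -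
      (\<Sum>k<p. smult (T (n + k) n) (?A (n + k)))"
    using T_bottom[of n] p by (subst type_I_poly.simps) auto
  moreover have "(\<Sum>k=0..p. smult (T (n + k) n) (?A (n + k))) =
      (\<Sum>k<p. smult (T (n + k) n) (?A (n + k))) + smult (T (n + p) n) (?A (n + p))"
    by (simp add: atLeast0AtMost lessThan_Suc_atMost[symmetric])
  ultimately show "(if n = 0 then 0 else ?A (n - 1)) + (\<Sum>k=0..p. smult (T (n + k) n) (?A (n + k))) =
      [:0, 1:] * ?A n" by simp
qed

text \<open>The coefficients \<open>c a j\<close>, \<open>j < a\<close>, form a lower unitriangular matrix after the shift of the column index by
\<open>1\<close>; forward substitution inverts it within the lower unitriangular matrices.\<close>

lemma unitriangular_inverse:
  fixes c :: "nat \<Rightarrow> nat \<Rightarrow> real" and u v :: "nat \<Rightarrow> nat \<Rightarrow> real"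
  assumes u: "\<And>a n. a \<in> {1..p} \<Longrightarrow> u a n = (\<Sum>j<a. c a j * v j n)"
    and c: "\<And>a. a \<in> {1..p} \<Longrightarrow> c a (a - 1) = 1"
  shows "\<exists>\<nu>. initial_condition_matrix p \<nu> \<and>
    (\<forall>j<p. \<forall>n. v j n = (\<Sum>a=1..p. \<nu> (j + 1) a * u a n))"
proof -
  have "\<exists>r. r (Suc j) = 1 \<and> (\<forall>a>Suc j. r a = 0) \<and> (\<forall>n. v j n = (\<Sum>a=1..p. r a * u a n))" if "j < p" for j
    using that
  proof (induction j rule: less_induct)
    case (less j)
    have "\<forall>i. \<exists>r. i < j \<longrightarrow> r (Suc i) = 1 \<and> (\<forall>a>Suc i. r a = 0) \<and> (\<forall>n. v i n = (\<Sum>a=1..p. r a * u a n))"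
    proof
      fix i show "\<exists>r. i < j \<longrightarrow> r (Suc i) = 1 \<and> (\<forall>a>Suc i. r a = 0) \<and> (\<forall>n. v i n = (\<Sum>a=1..p. r a * u a n))"
        using less.IH[of i] less.prems by (cases "i < j") auto
    qed
    from choice[OF this] obtain R where R: "\<And>i a. i < j \<Longrightarrow> a > Suc i \<Longrightarrow> R i a = 0"
      "\<And>i n. i < j \<Longrightarrow> v i n = (\<Sum>a=1..p. R i a * u a n)" by blast
    define r where "r a = of_bool (a = Suc j) - (\<Sum>i<j. c (Suc j) i * R i a)" for a
    have "(\<Sum>i<j. c (Suc j) i * R i a) = 0" if "a \<ge> Suc j" for a
      using that by (intro sum.neutral) (auto intro!: R(1))
    hence "r (Suc j) = 1" "\<forall>a>Suc j. r a = 0" by (auto simp: r_def)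
    moreover have "v j n = (\<Sum>a=1..p. r a * u a n)" for n
    proof -
      have "u (Suc j) n = (\<Sum>i<j. c (Suc j) i * v i n) + v j n"
        using u[of "Suc j" n] c[of "Suc j"] less.prems by simp
      moreover have "(\<Sum>i<j. c (Suc j) i * v i n) = (\<Sum>i<j. \<Sum>a=1..p. c (Suc j) i * R i a * u a n)"
        by (intro sum.cong) (auto simp: R(2) sum_distrib_left mult.assoc)
      also have "\<dots> = (\<Sum>a=1..p. (\<Sum>i<j. c (Suc j) i * R i a) * u a n)"
        by (subst sum.swap) (simp add: sum_distrib_right)
      moreover have "(\<Sum>a=1..p. of_bool (a = Suc j) * u a n) = u (Suc j) n"
      proof -
        have "(\<Sum>a=1..p. of_bool (a = Suc j) * u a n) = (\<Sum>a=1..p. if a = Suc j then u a n else 0)"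
          by (intro sum.cong) auto
        thus ?thesis using less.prems by (simp add: sum.delta)
      qed
      ultimately show ?thesis
        by (simp add: r_def left_diff_distrib sum_subtractf)
    qed
    ultimately show ?case by blast
  qed
  hence "\<forall>j. \<exists>r. j < p \<longrightarrow> r (Suc j) = 1 \<and> (\<forall>a>Suc j. r a = 0) \<and> (\<forall>n. v j n = (\<Sum>a=1..p. r a * u a n))"
    by blast
  from choice[OF this] obtain R where R: "\<And>j. j < p \<Longrightarrow> R j (Suc j) = 1"
    "\<And>j a. j < p \<Longrightarrow> a > Suc j \<Longrightarrow> R j a = 0"
    "\<And>j n. j < p \<Longrightarrow> v j n = (\<Sum>a=1..p. R j a * u a n)" by blast
  show ?thesis
  proof (intro exI[of _ "\<lambda>i. R (i - 1)"] conjI)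
    show "initial_condition_matrix p (\<lambda>i. R (i - 1))"
      unfolding initial_condition_matrix_def
    proof (intro ballI conjI impI)
      fix i assume "i \<in> {1..p}"
      thus "R (i - 1) i = 1" using R(1)[of "i - 1"] by (cases i) auto
      fix j assume "i < j"
      thus "R (i - 1) j = 0" using R(2)[of "i - 1" j] \<open>i \<in> {1..p}\<close> by (cases i) auto
    qed
  qed (use R(3) in simp)
qed

lemma form_integral_poly:
  "form_integral p A \<psi> l (poly q) = (\<Sum>a=1..p. LINT x:{0..1}|interval_measure (\<psi> a). poly (A a l * q) x)"
  by (simp add: form_integral_def)

lemma stieltjes_poly_linear:
  assumes "stieltjes_01 \<psi>"
  shows "(LINT x:{0..1}|interval_measure \<psi>. poly (q + r) x) =
      (LINT x:{0..1}|interval_measure \<psi>. poly q x) + (LINT x:{0..1}|interval_measure \<psi>. poly r x)"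
    and "(LINT x:{0..1}|interval_measure \<psi>. poly (smult c q) x) = c * (LINT x:{0..1}|interval_measure \<psi>. poly q x)"
proof -
  have int: "set_integrable (interval_measure \<psi>) {0..1} (poly q)" for q :: "real poly"
    by (intro stieltjes_integrable assms continuous_intros)
  show "(LINT x:{0..1}|interval_measure \<psi>. poly (q + r) x) =
      (LINT x:{0..1}|interval_measure \<psi>. poly q x) + (LINT x:{0..1}|interval_measure \<psi>. poly r x)"
    using set_integral_add(2)[OF int int, of q r] by simp
qed simp

lemma resolvent_integral_sums:
  assumes \<psi>: "\<And>a. a \<in> {1..p} \<Longrightarrow> stieltjes_01 (\<psi> a)" and s: "norm s < 1"
  shows "(\<lambda>n. of_real (form_integral p A \<psi> l (\<lambda>x. x ^ n * poly (B k) x)) * s ^ n) sums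
    resolvent_integral p A B \<psi> l k s"
proof -
  have "(\<lambda>n. \<Sum>a=1..p. of_real (LINT x:{0..1}|interval_measure (\<psi> a). x ^ n * poly (A a l * B k) x) * s ^ n) sums
    (\<Sum>a=1..p. LINT x:{0..1}|interval_measure (\<psi> a). of_real (poly (A a l * B k) x) / (1 - s * of_real x))"
    by (intro sums_sum stieltjes_resolvent_sums \<psi> s continuous_intros)
  moreover have "(\<Sum>a=1..p. LINT x:{0..1}|interval_measure (\<psi> a). of_real (poly (A a l * B k) x) / (1 - s * of_real x)) =
      resolvent_integral p A B \<psi> l k s"
    by (simp add: resolvent_integral_def form_integral_def scaleR_conv_of_real)
  moreover have "(\<Sum>a=1..p. of_real (LINT x:{0..1}|interval_measure (\<psi> a). x ^ n * poly (A a l * B k) x) * s ^ n) =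
      of_real (form_integral p A \<psi> l (\<lambda>x. x ^ n * poly (B k) x)) * s ^ n" for n
    by (simp add: form_integral_def sum_distrib_left sum_distrib_right mult_ac)
  ultimately show ?thesis by (simp only:)
qed

context bidiagonal_factorization
begin

lemma scaled_pow:
  fixes T :: smat and d :: "nat \<Rightarrow> real"
  assumes T: "\<And>i j. T i j = Q i j * d j / d i" and d: "\<And>n. d n > 0"
  shows "row_finite T" "smat_pow T n i j = smat_pow Q n i j * d j / d i"
proof -
  have dn: "d n \<noteq> 0" for n using d[of n] by simp
  have nz: "T i j \<noteq> 0 \<longleftrightarrow> Q i j \<noteq> 0" for i j by (simp add: T dn)
  show fin: "row_finite T" using Q_row_finite by (simp add: row_finite_def nz)
  show "smat_pow T n i j = smat_pow Q n i j * d j / d i"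
  proof (induction n arbitrary: i j)
    case 0
    show ?case by (simp add: smat_one_def dn)
  next
    case (Suc n)
    have "smat_pow T (Suc n) i j = (\<Sum>k | Q i k \<noteq> 0. T i k * smat_pow T n k j)"
      using smat_mult_row_sum[OF fin] by (simp add: nz)
    also have "\<dots> = (\<Sum>k | Q i k \<noteq> 0. Q i k * smat_pow Q n k j * (d j / d i))"
      by (intro sum.cong refl) (simp add: T Suc dn)
    also have "\<dots> = smat_pow Q (Suc n) i j * (d j / d i)"
      by (simp add: smat_mult_row_sum[OF Q_row_finite] sum_distrib_right sum_divide_distrib)
    finally show ?case by simp
  qed
qed

text \<open>The \<open>a\<close>-th moment sequence is divided by \<open>w a\<close>, the last coefficient of its expansion in \<open>(T\<^sup>n)\<^sub>0\<^sub>j\<close>, \<open>j < a\<close>.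
This is the normalization under which the matrix of these expansions is unitriangular, so that its inverse is
an initial condition matrix.\<close>

theorem spectral_favard:
  fixes T :: smat and d :: "nat \<Rightarrow> real"
  assumes T: "\<And>i j. T i j = Q i j * d j / d i" and d: "\<And>n. d n > 0"
    and d_Suc: "\<And>n. d (Suc n) = d n / Q n (Suc n)" and d0: "d 0 = 1"
  shows "\<exists>\<nu> A \<psi>. initial_condition_matrix p \<nu> \<and> type_I_polys p T \<nu> A \<and>
    (\<forall>a\<in>{1..p}. stieltjes_01 (\<psi> a)) \<and>
    (\<forall>n k l. form_integral p A \<psi> l (\<lambda>x. x ^ n * poly (type_II_poly p T k) x) = smat_pow T n k l) \<and>
    (integral_diverges (\<psi> 1) \<longleftrightarrow> \<not> summable (\<lambda>n. smat_pow Q n 0 0))"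
proof -
  have dn: "d n \<noteq> 0" for n using d[of n] by simp
  define w where "w a = W (a - 1) (a - 1) 0 / d (a - 1)" for a
  have w: "w a > 0" if "a \<in> {1..p}" for a
    unfolding w_def using W_bottom[of "a - 1" 0] d[of "a - 1"] that by auto
  define c where "c a j = W (a - 1) j 0 / d j / w a" for a j
  define u where "u a n = 1 / w a * spectral_moment a n" for a n
  have u_eq: "u a n = (\<Sum>j<a. c a j * smat_pow T n 0 j)" if "a \<in> {1..p}" for a n
    unfolding u_def spectral_moment_expand[OF that] c_def sum_distrib_left scaled_pow(2)[OF T d]
    by (intro sum.cong refl) (simp add: dn d0)
  have c_one: "c a (a - 1) = 1" if "a \<in> {1..p}" for a
  proof -
    have "c a (a - 1) = w a / w a" by (simp only: c_def w_def)
    thus ?thesis using w[OF that] by simp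
  qed
  obtain \<nu> where \<nu>: "initial_condition_matrix p \<nu>"
    "\<forall>j<p. \<forall>n. smat_pow T n 0 j = (\<Sum>a=1..p. \<nu> (j + 1) a * u a n)"
    using unitriangular_inverse[where u = u and c = c and v = "\<lambda>j n. smat_pow T n 0 j", OF u_eq c_one]
    by blast
  have "\<forall>a. \<exists>\<psi>. a \<in> {1..p} \<longrightarrow> stieltjes_01 \<psi> \<and>
      (\<forall>n. (LINT x:{0..1}|interval_measure \<psi>. x ^ n) = u a n)"
  proof
    fix a
    show "\<exists>\<psi>. a \<in> {1..p} \<longrightarrow> stieltjes_01 \<psi> \<and> (\<forall>n. (LINT x:{0..1}|interval_measure \<psi>. x ^ n) = u a n)"
      using spectral_measure[of a "1 / w a"] w[of a] by (cases "a \<in> {1..p}") (auto simp: u_def)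
  qed
  from choice[OF this] obtain \<psi> where \<psi>: "\<And>a. a \<in> {1..p} \<Longrightarrow> stieltjes_01 (\<psi> a)"
    "\<And>a n. a \<in> {1..p} \<Longrightarrow> (LINT x:{0..1}|interval_measure (\<psi> a). x ^ n) = u a n" by blast
  define A where "A a = type_I_poly p T (\<lambda>j. \<nu> (j + 1) a)" for a
  have T_zero: "\<forall>i j. j > i + 1 \<or> i > j + p \<longrightarrow> T i j = 0"
    using Q_zero by (simp add: T)
  have T_super: "T n (Suc n) = 1" for n
    using Q_superdiag[of n] dn[of n] by (simp add: T d_Suc)
  have T_bottom: "T (n + p) n \<noteq> 0" for n using Q_bottom[of n] dn by (simp add: T)
  have A: "type_I_polys p T \<nu> A"
    unfolding A_def by (rule type_I_polys_type_I_poly[OF p]) (rule T_bottom)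
  define G where "G l q = form_integral p A \<psi> l (poly q)" for l q
  have G_eq: "G l q = (\<Sum>a=1..p. LINT x:{0..1}|interval_measure (\<psi> a). poly (A a l * q) x)" for l q
    unfolding G_def form_integral_poly ..
  have G_add: "G l (q + r) = G l q + G l r" for l q r
    unfolding G_eq sum.distrib[symmetric] distrib_left
    by (intro sum.cong refl stieltjes_poly_linear \<psi>)
  have G_smult: "G l (smult c q) = c * G l q" for l c q
    unfolding G_eq sum_distrib_left mult_smult_right
    by (intro sum.cong refl stieltjes_poly_linear \<psi>)
  have G_rec: "(if l = 0 then 0 else G (l - 1) q) + (\<Sum>i=0..p. T (l + i) l * G (l + i) q) = G l ([:0, 1:] * q)"
    for l q
  proof -
    let ?\<Lambda> = "\<lambda>a q. LINT x:{0..1}|interval_measure (\<psi> a). poly q x"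
    have sum_lin: "?\<Lambda> a (sum f S) = (\<Sum>i\<in>S. ?\<Lambda> a (f i))" if "a \<in> {1..p}" "finite S" for a f and S :: "nat set"
      using that(2)
    proof (induction rule: finite_induct)
      case empty
      thus ?case by (simp add: set_lebesgue_integral_def)
    next
      case (insert i S)
      thus ?case using stieltjes_poly_linear(1)[OF \<psi>(1)[OF that(1)], of "f i" "sum f S"] by simp
    qed
    have per_measure: "(if l = 0 then 0 else ?\<Lambda> a (A a (l - 1) * q)) + (\<Sum>i=0..p. T (l + i) l * ?\<Lambda> a (A a (l + i) * q)) =
        ?\<Lambda> a (A a l * ([:0, 1:] * q))" if a: "a \<in> {1..p}" for a
    proof -
      have "(if l = 0 then 0 else A a (l - 1)) + (\<Sum>i=0..p. smult (T (l + i) l) (A a (l + i))) = [:0, 1:] * A a l"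
        using A a by (simp add: type_I_polys_def)
      hence "A a l * ([:0, 1:] * q) =
          ((if l = 0 then 0 else A a (l - 1)) + (\<Sum>i=0..p. smult (T (l + i) l) (A a (l + i)))) * q"
        by (simp only: mult_ac)
      also have "\<dots> = (if l = 0 then 0 else A a (l - 1) * q) + (\<Sum>i=0..p. smult (T (l + i) l) (A a (l + i) * q))"
        by (simp add: distrib_right sum_distrib_right)
      finally have "?\<Lambda> a (A a l * ([:0, 1:] * q)) = ?\<Lambda> a (if l = 0 then 0 else A a (l - 1) * q) +
          (\<Sum>i=0..p. ?\<Lambda> a (smult (T (l + i) l) (A a (l + i) * q)))"
        using stieltjes_poly_linear(1)[OF \<psi>(1)[OF a]] sum_lin[OF a] by simp
      moreover have "?\<Lambda> a (if l = 0 then 0 else A a (l - 1) * q) = (if l = 0 then 0 else ?\<Lambda> a (A a (l - 1) * q))"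
        by (simp add: set_lebesgue_integral_def)
      ultimately show ?thesis using stieltjes_poly_linear(2)[OF \<psi>(1)[OF a]] by simp
    qed
    have "(\<Sum>a=1..p. (if l = 0 then 0 else ?\<Lambda> a (A a (l - 1) * q)) + (\<Sum>i=0..p. T (l + i) l * ?\<Lambda> a (A a (l + i) * q))) =
        G l ([:0, 1:] * q)"
      unfolding G_eq by (intro sum.cong refl) (rule per_measure)
    moreover have "(\<Sum>a=1..p. (if l = 0 then 0 else ?\<Lambda> a (A a (l - 1) * q)) + (\<Sum>i=0..p. T (l + i) l * ?\<Lambda> a (A a (l + i) * q))) =
        (if l = 0 then 0 else G (l - 1) q) + (\<Sum>i=0..p. T (l + i) l * G (l + i) q)"
      unfolding sum.distrib G_eq sum_distrib_left by (subst sum.swap) simp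
    ultimately show ?thesis by simp
  qed
  have base: "G j (monom 1 n) = smat_pow T n 0 j" if "j < p" for j n
  proof -
    have "G j (monom 1 n) = (\<Sum>a=1..p. \<nu> (j + 1) a * u a n)"
      unfolding G_eq
    proof (intro sum.cong refl)
      fix a assume a: "a \<in> {1..p}"
      have "A a j = [:\<nu> (j + 1) a:]" using A a that by (simp add: type_I_polys_def)
      hence "(LINT x:{0..1}|interval_measure (\<psi> a). poly (A a j * monom 1 n) x) =
          \<nu> (j + 1) a * (LINT x:{0..1}|interval_measure (\<psi> a). x ^ n)"
        by (simp add: poly_monom)
      thus "(LINT x:{0..1}|interval_measure (\<psi> a). poly (A a j * monom 1 n) x) = \<nu> (j + 1) a * u a n"
        using \<psi>(2)[OF a] by simp
    qed
    thus ?thesis using \<nu>(2) that by simp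
  qed
  have bi: "G l (monom 1 n * type_II_poly p T k) = smat_pow T n k l" for n k l
    by (rule biorthogonality_from_first_row[where T = T and p = p, OF T_zero T_super T_bottom scaled_pow(1)[OF T d] p
        G_add G_smult G_rec base])
  have one: "1 \<in> {1..p}" using p by simp
  have "spectral_moment 1 n = smat_pow Q n 0 0" for n
    by (simp add: spectral_moment_def W_0)
  moreover have "w 1 = 1" by (simp add: w_def W_0 smat_one_def d0)
  ultimately have "u 1 n = smat_pow Q n 0 0" for n by (simp add: u_def)
  hence div: "integral_diverges (\<psi> 1) \<longleftrightarrow> \<not> summable (\<lambda>n. smat_pow Q n 0 0)"
    using stieltjes_diverges_iff[OF \<psi>(1)[OF one]] \<psi>(2)[OF one] by simp
  have "form_integral p A \<psi> l (\<lambda>x. x ^ n * poly (type_II_poly p T k) x) = smat_pow T n k l" for n k l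
  proof -
    have "(\<lambda>x. x ^ n * poly (type_II_poly p T k) x) = poly (monom 1 n * type_II_poly p T k)"
      by (simp add: fun_eq_iff poly_monom)
    thus ?thesis using bi[of l n k] by (simp only: G_def)
  qed
  thus ?thesis using \<nu>(1) A \<psi>(1) div by blast
qed

end

section \<open>First passage times\<close>

locale stochastic_chain =
  fixes P :: smat and M :: "nat \<Rightarrow> 'w measure" and X :: "nat \<Rightarrow> 'w \<Rightarrow> nat"
  assumes chain: "markov_chain P M X" and stoch: "stochastic P" and fin: "row_finite P"
begin

lemma prob_space_M: "prob_space (M k)"
  using chain by (simp add: markov_chain_def)

lemma X_measurable [measurable]: "X n \<in> measurable (M k) (count_space UNIV)"
  using chain by (simp add: markov_chain_def)

lemma X_0: "AE \<omega> in M k. X 0 \<omega> = k"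
  using chain by (simp add: markov_chain_def)

text \<open>Events that depend on the past only are predicates of this list. There are countably many lists, so the
Markov property for single paths extends to all such events by countable additivity.\<close>

definition hist :: "nat \<Rightarrow> 'w \<Rightarrow> nat list" where
  "hist n \<omega> = map (\<lambda>m. X m \<omega>) [0..<Suc n]"

lemma take_hist: "take (Suc j) (hist (j + m) \<omega>) = hist j \<omega>"
  by (simp add: hist_def take_map take_upt del: upt_Suc)

lemma hist_nth: "m \<le> n \<Longrightarrow> hist n \<omega> ! m = X m \<omega>"
  by (simp add: hist_def del: upt_Suc)

lemma hist_eq_iff:
  assumes "length xs = Suc n"
  shows "hist n \<omega> = xs \<longleftrightarrow> (\<forall>m\<le>n. X m \<omega> = xs ! m)"
  using assms by (auto simp: hist_def list_eq_iff_nth_eq less_Suc_eq_le simp del: upt_Suc)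

lemma hist_sets: "{\<omega> \<in> space (M k). hist n \<omega> = xs} \<in> sets (M k)"
proof (cases "length xs = Suc n")
  case True
  have "{\<omega> \<in> space (M k). \<forall>m\<in>{..n}. X m \<omega> = xs ! m} \<in> sets (M k)" by measurable
  thus ?thesis using hist_eq_iff[OF True] by simp
next
  case False
  hence "{\<omega> \<in> space (M k). hist n \<omega> = xs} = {}" by (auto simp: hist_def)
  thus ?thesis by (metis sets.empty_sets)
qed

lemma hist_measurable [measurable]: "hist n \<in> measurable (M k) (count_space UNIV)"
proof (subst measurable_count_space_eq_countable)
  show "countable (UNIV :: nat list set)" by simp
  show "hist n \<in> space (M k) \<rightarrow> UNIV \<and> (\<forall>a\<in>UNIV. hist n -` {a} \<inter> space (M k) \<in> sets (M k))"
  proof (intro conjI ballI)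
    fix xs :: "nat list"
    have "hist n -` {xs} \<inter> space (M k) = {\<omega> \<in> space (M k). hist n \<omega> = xs}" by auto
    thus "hist n -` {xs} \<inter> space (M k) \<in> sets (M k)" using hist_sets by simp
  qed simp
qed

lemma path_step:
  assumes "length xs = Suc n"
  shows "\<P>(\<omega> in M k. hist n \<omega> = xs \<and> X (Suc n) \<omega> = j) = \<P>(\<omega> in M k. hist n \<omega> = xs) * P (last xs) j"
proof -
  interpret prob_space "M k" by (rule prob_space_M)
  let ?Q = "\<lambda>\<omega>. \<forall>m\<le>n. X m \<omega> = xs ! m"
  have last: "last xs = xs ! n" using assms by (subst last_conv_nth) auto
  have Q: "hist n \<omega> = xs \<longleftrightarrow> ?Q \<omega>" for \<omega> by (rule hist_eq_iff[OF assms])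
  show ?thesis
  proof (cases "\<P>(\<omega> in M k. ?Q \<omega>) > 0")
    case True
    hence "\<P>(\<omega> in M k. X (Suc n) \<omega> = j \<bar> ?Q \<omega>) = P (xs ! n) j"
      using chain unfolding markov_chain_def by blast
    hence "\<P>(\<omega> in M k. X (Suc n) \<omega> = j \<and> ?Q \<omega>) = P (xs ! n) j * \<P>(\<omega> in M k. ?Q \<omega>)"
      using True by (simp add: cond_prob_def field_simps)
    thus ?thesis by (simp add: Q last conj_commute mult.commute)
  next
    case False
    hence zero: "\<P>(\<omega> in M k. hist n \<omega> = xs) = 0"
      using measure_nonneg[of "M k"] by (simp add: Q not_less antisym)
    have "\<P>(\<omega> in M k. hist n \<omega> = xs \<and> X (Suc n) \<omega> = j) \<le> \<P>(\<omega> in M k. hist n \<omega> = xs)"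
      by (intro finite_measure_mono hist_sets) auto
    thus ?thesis using zero measure_nonneg[of "M k"] by (simp add: antisym)
  qed
qed

lemma one_step:
  "\<P>(\<omega> in M k. (R (hist n \<omega>) \<and> X n \<omega> = i) \<and> X (Suc n) \<omega> = j) =
     \<P>(\<omega> in M k. R (hist n \<omega>) \<and> X n \<omega> = i) * P i j"
proof -
  interpret prob_space "M k" by (rule prob_space_M)
  define I where "I = {xs. R xs \<and> last xs = i \<and> length xs = Suc n}"
  have last: "last (hist n \<omega>) = X n \<omega>" for \<omega> by (simp add: hist_def)
  have len: "length (hist n \<omega>) = Suc n" for \<omega> by (simp add: hist_def)
  define E where "E xs = {\<omega> \<in> space (M k). hist n \<omega> = xs}" for xs
  define E' where "E' xs = {\<omega> \<in> space (M k). hist n \<omega> = xs \<and> X (Suc n) \<omega> = j}" for xs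
  have [measurable]: "E xs \<in> sets (M k)" "E' xs \<in> sets (M k)" for xs
    unfolding E_def E'_def by measurable
  have disj: "disjoint_family_on E I" "disjoint_family_on E' I"
    by (auto simp: disjoint_family_on_def E_def E'_def)
  have P_nn: "P i j \<ge> 0" using stoch by (rule stochastic_nonneg)
  have step: "emeasure (M k) (E' xs) = emeasure (M k) (E xs) * ennreal (P i j)" if "xs \<in> I" for xs
    using path_step[of xs n k j] that P_nn
    by (simp add: E_def E'_def I_def emeasure_eq_measure ennreal_mult'')
  have "{\<omega> \<in> space (M k). (R (hist n \<omega>) \<and> X n \<omega> = i) \<and> X (Suc n) \<omega> = j} = (\<Union>xs\<in>I. E' xs)"
    by (auto simp: I_def E'_def last len)
  hence "emeasure (M k) {\<omega> \<in> space (M k). (R (hist n \<omega>) \<and> X n \<omega> = i) \<and> X (Suc n) \<omega> = j} =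
      (\<integral>\<^sup>+xs. emeasure (M k) (E' xs) \<partial>count_space I)"
    using disj by (simp only:) (intro emeasure_UN_countable, auto)
  also have "\<dots> = (\<integral>\<^sup>+xs. emeasure (M k) (E xs) * ennreal (P i j) \<partial>count_space I)"
    by (rule nn_integral_cong) (simp add: step)
  also have "\<dots> = (\<integral>\<^sup>+xs. emeasure (M k) (E xs) \<partial>count_space I) * ennreal (P i j)"
    by (rule nn_integral_multc) simp
  also have "(\<integral>\<^sup>+xs. emeasure (M k) (E xs) \<partial>count_space I) = emeasure (M k) (\<Union>xs\<in>I. E xs)"
    using disj by (intro emeasure_UN_countable[symmetric]) auto
  also have "(\<Union>xs\<in>I. E xs) = {\<omega> \<in> space (M k). R (hist n \<omega>) \<and> X n \<omega> = i}"
    by (auto simp: I_def E_def last len)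
  finally show ?thesis using P_nn
    by (simp add: emeasure_eq_measure ennreal_mult''[symmetric])
qed

lemma step_sums:
  "(\<lambda>i. \<P>(\<omega> in M k. R (hist n \<omega>) \<and> X n \<omega> = i) * P i j) sums
     \<P>(\<omega> in M k. R (hist n \<omega>) \<and> X (Suc n) \<omega> = j)"
proof -
  interpret prob_space "M k" by (rule prob_space_M)
  let ?A = "\<lambda>i. {\<omega> \<in> space (M k). (R (hist n \<omega>) \<and> X n \<omega> = i) \<and> X (Suc n) \<omega> = j}"
  have "(\<lambda>i. measure (M k) (?A i)) sums measure (M k) (\<Union>i. ?A i)"
  proof (rule finite_measure_UNION)
    show "range ?A \<subseteq> sets (M k)" by auto
    show "disjoint_family ?A" by (auto simp: disjoint_family_on_def)
  qed
  moreover have "(\<Union>i. ?A i) = {\<omega> \<in> space (M k). R (hist n \<omega>) \<and> X (Suc n) \<omega> = j}" by auto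
  ultimately show ?thesis unfolding one_step by simp
qed

text \<open>The event must fix the present state \<open>l\<close>; it may say anything about the past. Events at a first visit to \<open>l\<close>
are of this kind.\<close>

lemma markov_property:
  assumes "\<And>\<omega>. R (hist n \<omega>) \<Longrightarrow> X n \<omega> = l"
  shows "\<P>(\<omega> in M k. R (hist n \<omega>) \<and> X (n + m) \<omega> = j) = \<P>(\<omega> in M k. R (hist n \<omega>)) * smat_pow P m l j"
proof (induction m arbitrary: j)
  case 0
  show ?case
  proof (cases "j = l")
    case True
    hence "(R (hist n \<omega>) \<and> X n \<omega> = j) = R (hist n \<omega>)" for \<omega> using assms by auto
    thus ?thesis using True by (simp add: smat_one_def)
  next
    case False
    hence "{\<omega> \<in> space (M k). R (hist n \<omega>) \<and> X n \<omega> = j} = {}" using assms by auto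
    hence "\<P>(\<omega> in M k. R (hist n \<omega>) \<and> X n \<omega> = j) = 0" by (metis measure_empty)
    thus ?thesis using False by (simp add: smat_one_def)
  qed
next
  case (Suc m)
  let ?c = "\<P>(\<omega> in M k. R (hist n \<omega>))"
  have "(\<lambda>i. \<P>(\<omega> in M k. R (hist n \<omega>) \<and> X (n + m) \<omega> = i) * P i j) sums
     \<P>(\<omega> in M k. R (hist n \<omega>) \<and> X (Suc (n + m)) \<omega> = j)"
    using step_sums[of k "\<lambda>xs. R (take (Suc n) xs)" "n + m" j] by (simp only: take_hist)
  moreover have "(\<lambda>i. ?c * (smat_pow P m l i * P i j)) sums (?c * smat_pow P (Suc m) l j)"
    unfolding smat_pow_Suc_right[OF fin] by (intro sums_mult smat_mult_sums row_finite_pow fin)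
  ultimately show ?case
    unfolding Suc.IH mult.assoc by (auto dest: sums_unique2)
qed

lemma transition_prob: "\<P>(\<omega> in M k. X n \<omega> = l) = smat_pow P n k l"
proof -
  interpret prob_space "M k" by (rule prob_space_M)
  let ?R = "\<lambda>xs. hd xs = k"
  have hd: "hd (hist 0 \<omega>) = X 0 \<omega>" for \<omega> by (simp add: hist_def)
  have "\<P>(\<omega> in M k. ?R (hist 0 \<omega>) \<and> X (0 + n) \<omega> = l) = \<P>(\<omega> in M k. ?R (hist 0 \<omega>)) * smat_pow P n k l"
    by (rule markov_property) (simp add: hd)
  moreover have "\<P>(\<omega> in M k. ?R (hist 0 \<omega>)) = 1"
    using X_0[of k] by (subst prob_eq_1) (auto simp: hd elim!: eventually_mono)
  moreover have "\<P>(\<omega> in M k. ?R (hist 0 \<omega>) \<and> X (0 + n) \<omega> = l) = \<P>(\<omega> in M k. X n \<omega> = l)"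
    by (rule finite_measure_eq_AE) (use X_0[of k] in \<open>auto simp: hd elim!: eventually_mono\<close>)
  ultimately show ?thesis by simp
qed

definition first_at :: "nat \<Rightarrow> nat \<Rightarrow> nat list \<Rightarrow> bool" where
  "first_at l n xs \<longleftrightarrow> xs ! n = l \<and> (\<forall>m. 1 \<le> m \<and> m < n \<longrightarrow> xs ! m \<noteq> l)"

lemma first_at_hist:
  "first_at l n (hist n \<omega>) \<longleftrightarrow> X n \<omega> = l \<and> (\<forall>m. 1 \<le> m \<and> m < n \<longrightarrow> X m \<omega> \<noteq> l)"
  by (auto simp: first_at_def hist_nth)

lemma first_passage_hist: "first_passage M X n k l = \<P>(\<omega> in M k. first_at l n (hist n \<omega>))"
  by (simp add: first_passage_def first_at_hist)

lemma first_at_unique: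
  assumes "first_at l (Suc i) (hist (Suc i) \<omega>)" "first_at l (Suc j) (hist (Suc j) \<omega>)"
  shows "i = j"
proof (rule linorder_cases[of i j])
  assume "i < j"
  hence "X (Suc i) \<omega> \<noteq> l" using assms(2) unfolding first_at_hist by auto
  thus ?thesis using assms(1) unfolding first_at_hist by simp
next
  assume "j < i"
  hence "X (Suc j) \<omega> \<noteq> l" using assms(1) unfolding first_at_hist by auto
  thus ?thesis using assms(2) unfolding first_at_hist by simp
qed

lemma first_at_exists:
  assumes "X (Suc n) \<omega> = l"
  obtains i where "i \<le> n" "first_at l (Suc i) (hist (Suc i) \<omega>)"
proof -
  define i where "i = (LEAST i. X (Suc i) \<omega> = l)"
  have "X (Suc i) \<omega> = l" unfolding i_def using assms by (rule LeastI)
  moreover have "i \<le> n" unfolding i_def using assms by (rule Least_le)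
  moreover have "X m \<omega> \<noteq> l" if "1 \<le> m" "m < Suc i" for m
    using not_less_Least[of "m - 1" "\<lambda>i. X (Suc i) \<omega> = l"] that by (cases m) (auto simp: i_def)
  ultimately show ?thesis using that[of i] by (auto simp: first_at_hist)
qed

text \<open>A path that is at \<open>l\<close> at time \<open>n + 1\<close> has a unique first visit to \<open>l\<close> at some time \<open>i + 1 \<le> n + 1\<close>.\<close>

lemma renewal_equation:
  "smat_pow P (Suc n) k l = (\<Sum>i\<le>n. first_passage M X (Suc i) k l * smat_pow P (n - i) l l)"
proof -
  interpret prob_space "M k" by (rule prob_space_M)
  let ?A = "\<lambda>i. {\<omega> \<in> space (M k). first_at l (Suc i) (hist (Suc i) \<omega>) \<and> X (Suc i + (n - i)) \<omega> = l}"
  have "measure (M k) (\<Union>i\<in>{..n}. ?A i) = (\<Sum>i\<in>{..n}. measure (M k) (?A i))"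
    by (rule finite_measure_finite_Union)
       (auto simp: disjoint_family_on_def dest: first_at_unique)
  moreover have "(\<Union>i\<in>{..n}. ?A i) = {\<omega> \<in> space (M k). X (Suc n) \<omega> = l}"
  proof (intro set_eqI iffI)
    fix \<omega> assume "\<omega> \<in> {\<omega> \<in> space (M k). X (Suc n) \<omega> = l}"
    hence \<omega>: "\<omega> \<in> space (M k)" "X (Suc n) \<omega> = l" by auto
    obtain i where "i \<le> n" "first_at l (Suc i) (hist (Suc i) \<omega>)"
      using \<omega>(2) by (rule first_at_exists)
    thus "\<omega> \<in> (\<Union>i\<in>{..n}. ?A i)" using \<omega> by (intro UN_I[of i]) auto
  qed auto
  moreover have "measure (M k) (?A i) = first_passage M X (Suc i) k l * smat_pow P (n - i) l l" for i
    unfolding first_passage_hist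
    by (rule markov_property) (simp add: first_at_hist)
  ultimately have "\<P>(\<omega> in M k. X (Suc n) \<omega> = l) =
      (\<Sum>i\<in>{..n}. first_passage M X (Suc i) k l * smat_pow P (n - i) l l)" by (simp only:)
  thus ?thesis by (simp only: transition_prob)
qed

lemma return_prob_sums: "(\<lambda>i. first_passage M X (Suc i) l l) sums return_prob M X l"
proof -
  interpret prob_space "M l" by (rule prob_space_M)
  let ?A = "\<lambda>i. {\<omega> \<in> space (M l). first_at l (Suc i) (hist (Suc i) \<omega>)}"
  have "(\<lambda>i. measure (M l) (?A i)) sums measure (M l) (\<Union>i. ?A i)"
    by (rule finite_measure_UNION)
       (auto simp: disjoint_family_on_def dest: first_at_unique)
  moreover have "(\<Union>i. ?A i) = {\<omega> \<in> space (M l). \<exists>n\<ge>1. X n \<omega> = l}"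
  proof (intro set_eqI iffI)
    fix \<omega> assume "\<omega> \<in> {\<omega> \<in> space (M l). \<exists>n\<ge>1. X n \<omega> = l}"
    then obtain n where \<omega>: "\<omega> \<in> space (M l)" "X (Suc n) \<omega> = l" by (auto simp: Suc_le_eq gr0_conv_Suc)
    obtain i where "first_at l (Suc i) (hist (Suc i) \<omega>)"
      using \<omega>(2) by (rule first_at_exists)
    thus "\<omega> \<in> (\<Union>i. ?A i)" using \<omega> by auto
  qed (auto simp: first_at_hist intro: exI[of _ "Suc _"])
  ultimately show ?thesis by (simp add: return_prob_def first_passage_hist)
qed

lemma first_passage_bounds: "0 \<le> first_passage M X n k l" "first_passage M X n k l \<le> 1"
proof -
  interpret prob_space "M k" by (rule prob_space_M)
  show "0 \<le> first_passage M X n k l" "first_passage M X n k l \<le> 1"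
    by (auto simp: first_passage_def)
qed

lemma pow_bounds: "0 \<le> smat_pow P n k l" "smat_pow P n k l \<le> 1"
  using stochastic_pow[OF stoch fin] stochastic_nonneg stochastic_le_one by blast+

lemma return_prob_le_1: "return_prob M X l \<le> 1"
proof -
  interpret prob_space "M l" by (rule prob_space_M)
  show ?thesis by (simp add: return_prob_def)
qed

lemma bounded_gf_summable:
  fixes s :: complex
  assumes "\<And>n. 0 \<le> f n \<and> f n \<le> 1" "norm s < 1"
  shows "summable (\<lambda>n. norm (of_real (f n) * s ^ n))"
proof (rule summable_comparison_test)
  show "\<exists>N. \<forall>n\<ge>N. norm (norm (of_real (f n) * s ^ n)) \<le> norm s ^ n"
    using assms by (auto simp: norm_mult norm_power intro!: mult_left_le_one_le)
  show "summable (\<lambda>n. norm s ^ n)" using assms by (simp add: summable_geometric)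
qed

text \<open>The renewal equation is a Cauchy product.\<close>

lemma generating_function_identity:
  assumes s: "norm s < 1"
  shows "transition_gf P s k l = of_bool (k = l) + first_passage_gf M X s k l * transition_gf P s l l"
proof -
  define a where "a i = of_real (first_passage M X (Suc i) k l) * s ^ Suc i" for i
  define b where "b n = of_real (smat_pow P n l l) * s ^ n" for n
  have a: "summable (\<lambda>i. norm (a i))"
    using summable_mult2[OF bounded_gf_summable[of "\<lambda>i. first_passage M X (Suc i) k l", OF _ s], of "norm s"]
      first_passage_bounds by (simp add: a_def norm_mult norm_power mult_ac)
  have b: "summable (\<lambda>n. norm (b n))"
    unfolding b_def by (rule bounded_gf_summable[OF _ s]) (simp add: pow_bounds)
  have convolution: "(\<Sum>i\<le>n. a i * b (n - i)) = of_real (smat_pow P (Suc n) k l) * s ^ Suc n" for n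
  proof -
    have "(\<Sum>i\<le>n. a i * b (n - i)) =
        (\<Sum>i\<le>n. of_real (first_passage M X (Suc i) k l * smat_pow P (n - i) l l) * s ^ Suc n)"
    proof (intro sum.cong refl)
      fix i assume "i \<in> {..n}"
      hence "s ^ Suc n = s ^ Suc i * s ^ (n - i)" by (simp flip: power_add)
      thus "a i * b (n - i) =
          of_real (first_passage M X (Suc i) k l * smat_pow P (n - i) l l) * s ^ Suc n"
        by (simp only: a_def b_def of_real_mult mult_ac)
    qed
    also have "\<dots> = of_real (smat_pow P (Suc n) k l) * s ^ Suc n"
      unfolding renewal_equation by (simp only: of_real_sum sum_distrib_right)
    finally show ?thesis .
  qed
  have "(\<lambda>n. \<Sum>i\<le>n. a i * b (n - i)) sums ((\<Sum>i. a i) * (\<Sum>n. b n))"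
    by (rule Cauchy_product_sums[OF a b])
  moreover have "(\<Sum>i. a i) = first_passage_gf M X s k l" "(\<Sum>n. b n) = transition_gf P s l l"
    by (simp_all only: a_def b_def first_passage_gf_def transition_gf_def)
  ultimately have "(\<lambda>n. of_real (smat_pow P (Suc n) k l) * s ^ Suc n) sums
      (first_passage_gf M X s k l * transition_gf P s l l)"
    by (simp only: convolution)
  hence "(\<lambda>n. of_real (smat_pow P n k l) * s ^ n) sums
      (first_passage_gf M X s k l * transition_gf P s l l + of_real (smat_pow P 0 k l) * s ^ 0)"
    by (rule sums_Suc)
  thus ?thesis by (simp add: transition_gf_def sums_iff smat_one_def)
qed

lemma first_passage_gf_eq:
  assumes s: "norm s < 1"
  shows "transition_gf P s l l \<noteq> 0"
    "k \<noteq> l \<Longrightarrow> first_passage_gf M X s k l = transition_gf P s k l / transition_gf P s l l"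
    "first_passage_gf M X s l l = 1 - 1 / transition_gf P s l l"
proof -
  have "transition_gf P s l l = 1 + first_passage_gf M X s l l * transition_gf P s l l"
    using generating_function_identity[OF s, of l l] by simp
  thus nz: "transition_gf P s l l \<noteq> 0" by auto
  show "first_passage_gf M X s l l = 1 - 1 / transition_gf P s l l"
    using \<open>transition_gf P s l l = _\<close> nz by (simp add: field_simps)
  show "first_passage_gf M X s k l = transition_gf P s k l / transition_gf P s l l" if "k \<noteq> l"
    using generating_function_identity[OF s, of k l] that nz by (simp add: field_simps)
qed

text \<open>Let \<open>u\<close> be the diagonal entries, \<open>f\<close> the first return probabilities and \<open>R\<close> their sum. If \<open>u\<close> is summable with
sum \<open>V\<close>, the renewal equation gives \<open>V = 1 + R V\<close>, hence \<open>R < 1\<close>. If \<open>R < 1\<close>, it bounds the partial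
sums \<open>V\<^sub>N\<close> by \<open>V\<^sub>N \<le> 1 + R V\<^sub>N\<close>.\<close>

lemma return_prob_less_1_iff:
  "return_prob M X l < 1 \<longleftrightarrow> summable (\<lambda>n. smat_pow P n l l)"
proof -
  let ?f = "\<lambda>i. first_passage M X (Suc i) l l" and ?u = "\<lambda>n. smat_pow P n l l"
  let ?R = "return_prob M X l"
  have f_sum: "summable ?f" "(\<Sum>i. ?f i) = ?R" using return_prob_sums[of l] by (auto simp: sums_iff)
  have u0: "?u 0 = 1" by (simp add: smat_one_def)
  have "?R < 1" if u: "summable ?u"
  proof -
    have "(\<lambda>n. \<Sum>i\<le>n. ?f i * ?u (n - i)) sums ((\<Sum>i. ?f i) * (\<Sum>n. ?u n))"
      using f_sum(1) u by (intro Cauchy_product_sums) (simp_all add: first_passage_bounds pow_bounds)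
    hence "(\<lambda>n. ?u (Suc n)) sums (?R * (\<Sum>n. ?u n))"
      by (simp only: renewal_equation[symmetric] f_sum(2))
    hence "(\<Sum>n. ?u n) = ?R * (\<Sum>n. ?u n) + 1"
      using sums_Suc[of ?u] u0 by (auto simp: sums_iff)
    moreover have "(\<Sum>n. ?u n) \<ge> 0" using u by (intro suminf_nonneg) (auto simp: pow_bounds)
    moreover have "1 * (\<Sum>n. ?u n) \<le> ?R * (\<Sum>n. ?u n)" if "\<not> ?R < 1"
      using that \<open>(\<Sum>n. ?u n) \<ge> 0\<close> by (intro mult_right_mono) auto
    ultimately show "?R < 1" by linarith
  qed
  moreover have "summable ?u" if R: "?R < 1"
  proof -
    have bound: "(\<Sum>n<N. ?u n) \<le> 1 / (1 - ?R)" for N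
    proof (cases N)
      case (Suc N')
      let ?S = "\<lambda>N. \<Sum>n<N. ?u n"
      have S_nn: "?S N \<ge> 0" for N by (intro sum_nonneg) (simp add: pow_bounds)
      have S_eq: "?S N = 1 + (\<Sum>n<N'. \<Sum>i\<le>n. ?f i * ?u (n - i))"
        unfolding Suc sum.lessThan_Suc_shift u0 renewal_equation by simp
      have "(\<Sum>n<N'. \<Sum>i\<le>n. ?f i * ?u (n - i)) = (\<Sum>(i,j)\<in>{(i,j). i + j < N'}. ?f i * ?u j)"
        by (rule sum.triangle_reindex[symmetric])
      also have "\<dots> \<le> (\<Sum>(i,j)\<in>{..<N'} \<times> {..<N'}. ?f i * ?u j)"
      proof (rule sum_mono2)
        fix ij :: "nat \<times> nat"
        show "0 \<le> (case ij of (i, j) \<Rightarrow> ?f i * ?u j)"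
          by (cases ij) (simp only: prod.case first_passage_bounds(1) pow_bounds(1) mult_nonneg_nonneg)
      next
        show "finite ({..<N'} \<times> {..<N'})" by simp
        show "{(i, j). i + j < N'} \<subseteq> {..<N'} \<times> {..<N'}" by auto
      qed
      also have "\<dots> = (\<Sum>i<N'. ?f i) * ?S N'" 
        by (subst sum.cartesian_product[of "\<lambda>i j. ?f i * ?u j", symmetric], subst sum_product) (rule refl)
      also have "\<dots> \<le> ?R * ?S N'"
        using sum_le_suminf[OF f_sum(1), of "{..<N'}"] f_sum(2) S_nn
        by (intro mult_right_mono) (auto simp: first_passage_bounds)
      also have "\<dots> \<le> ?R * ?S N"
      proof (rule mult_left_mono)
        show "?S N' \<le> ?S N" using Suc pow_bounds[of N' l l] by simp
        show "0 \<le> ?R" using f_sum by (metis suminf_nonneg first_passage_bounds(1))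
      qed
      finally have "?S N \<le> 1 + ?R * ?S N" unfolding S_eq[symmetric] using S_eq by linarith
      hence "(1 - ?R) * ?S N \<le> 1" by (simp add: left_diff_distrib)
      thus ?thesis using R by (simp add: field_simps)
    qed (use R in simp)
    show "summable ?u"
      by (rule summableI_nonneg_bounded[OF _ bound]) (simp add: pow_bounds)
  qed
  ultimately show ?thesis by blast
qed

lemma pow_add_ge: "smat_pow P a i j * smat_pow P b j k \<le> smat_pow P (a + b) i k"
proof -
  let ?f = "\<lambda>j. smat_pow P a i j * smat_pow P b j k"
  have sums: "?f sums smat_pow P (a + b) i k"
    unfolding smat_pow_add[OF fin] by (intro smat_mult_sums row_finite_pow fin)
  hence "sum ?f {j} \<le> suminf ?f"
    by (intro sum_le_suminf) (auto simp: sums_iff pow_bounds)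
  thus ?thesis using sums by (simp add: sums_iff)
qed

text \<open>A loop from \<open>j\<close> to \<open>i\<close>, around \<open>i\<close>, and back to \<open>j\<close> is one particular loop at \<open>j\<close>.\<close>

lemma summable_diagonal_transfer:
  assumes "smat_pow P a j i > 0" "smat_pow P b i j > 0" "summable (\<lambda>n. smat_pow P n j j)"
  shows "summable (\<lambda>n. smat_pow P n i i)"
proof -
  let ?c = "smat_pow P a j i * smat_pow P b i j"
  have c: "?c > 0" using assms by simp
  have le: "smat_pow P n i i \<le> smat_pow P (n + (a + b)) j j / ?c" for n
  proof -
    have "smat_pow P a j i * smat_pow P n i i * smat_pow P b i j \<le> smat_pow P (a + n) j i * smat_pow P b i j"
      by (intro mult_right_mono pow_add_ge pow_bounds)
    also have "\<dots> \<le> smat_pow P (a + n + b) j j" by (rule pow_add_ge)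
    finally show ?thesis using c by (simp add: field_simps add_ac)
  qed
  have "summable (\<lambda>n. smat_pow P (n + (a + b)) j j / ?c)"
    by (intro summable_divide summable_ignore_initial_segment assms(3))
  thus ?thesis
  proof (rule summable_comparison_test'[where N = 0])
    fix n
    show "norm (smat_pow P n i i) \<le> smat_pow P (n + (a + b)) j j / ?c"
      using le[of n] pow_bounds(1)[of n i i] by (simp only: real_norm_def abs_of_nonneg)
  qed
qed

lemma recurrence_dichotomy:
  assumes up: "\<And>n. P n (Suc n) > 0" and down: "\<And>n. P (Suc n) n > 0"
  shows "recurrent M X \<longleftrightarrow> \<not> summable (\<lambda>n. smat_pow P n 0 0)"
    "summable (\<lambda>n. smat_pow P n 0 0) \<Longrightarrow> transient M X"
proof -
  have "smat_pow P l 0 l > 0" for l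
  proof (induction l)
    case (Suc l)
    have "smat_pow P l 0 l * smat_pow P (Suc 0) l (Suc l) > 0" using Suc up by simp
    thus ?case using pow_add_ge[of l 0 l "Suc 0" "Suc l"] by (simp del: smat_pow.simps)
  qed (simp add: smat_one_def)
  moreover have "smat_pow P l l 0 > 0" for l
  proof (induction l)
    case (Suc l)
    have "smat_pow P (Suc 0) (Suc l) l * smat_pow P l l 0 > 0" using Suc down by simp
    thus ?case using pow_add_ge[of "Suc 0" "Suc l" l l 0] by (simp del: smat_pow.simps)
  qed (simp add: smat_one_def)
  ultimately have iff: "summable (\<lambda>n. smat_pow P n l l) \<longleftrightarrow> summable (\<lambda>n. smat_pow P n 0 0)" for l
    using summable_diagonal_transfer by metis
  show "recurrent M X \<longleftrightarrow> \<not> summable (\<lambda>n. smat_pow P n 0 0)"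
    unfolding recurrent_def using return_prob_less_1_iff iff return_prob_le_1
    by (metis less_irrefl order_less_le)
  show "transient M X" if "summable (\<lambda>n. smat_pow P n 0 0)"
    unfolding transient_def using return_prob_less_1_iff iff that by blast
qed

end

section \<open>Spectral representation of the Markov chains\<close>

lemma smat_diag_conjugate:
  "smat_mult (smat_mult (smat_diag a) T) (smat_diag b) i j = a i * T i j * b j"
proof -
  have "smat_mult (smat_diag a) T i k = a i * T i k" for k
  proof -
    have "smat_mult (smat_diag a) T i k = (\<Sum>m\<in>{i}. smat_diag a i m * T m k)"
      by (rule smat_mult_finite_sum) (auto simp: smat_diag_def)
    thus ?thesis by (simp add: smat_diag_def)
  qed
  moreover have "smat_mult (smat_mult (smat_diag a) T) (smat_diag b) i j =
      (\<Sum>m\<in>{j}. smat_mult (smat_diag a) T i m * smat_diag b m j)"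
    by (rule smat_mult_finite_sum) (auto simp: smat_diag_def)
  ultimately show ?thesis by (simp add: smat_diag_def)
qed

text \<open>The Karlin--McGregor formula determines the generating functions. In the lemma below \<open>r\<close> and \<open>c\<close> select which
of the two states indexes the type I polynomials and which the type II polynomials; this is where the two
types of chains differ.\<close>

context stochastic_chain
begin

lemma spectral_generating_functions:
  assumes \<psi>: "\<And>a. a \<in> {1..p} \<Longrightarrow> stieltjes_01 (\<psi> a)" and s: "norm s < 1"
    and pow: "\<And>n k l. smat_pow P n k l = \<theta> k l * form_integral p A \<psi> (r k l) (\<lambda>x. x ^ n * poly (B (c k l)) x)"
    and \<theta>: "\<And>l. \<theta> l l = 1"
  shows "transition_gf P s k l = \<theta> k l * resolvent_integral p A B \<psi> (r k l) (c k l) s"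
    and "k \<noteq> l \<Longrightarrow> first_passage_gf M X s k l = \<theta> k l *
      (resolvent_integral p A B \<psi> (r k l) (c k l) s / resolvent_integral p A B \<psi> (r l l) (c l l) s)"
    and "first_passage_gf M X s l l = 1 - 1 / resolvent_integral p A B \<psi> (r l l) (c l l) s"
proof -
  have gf: "transition_gf P s k l = \<theta> k l * resolvent_integral p A B \<psi> (r k l) (c k l) s" for k l
  proof -
    have "(\<lambda>n. of_real (\<theta> k l) * (of_real (form_integral p A \<psi> (r k l) (\<lambda>x. x ^ n * poly (B (c k l)) x)) * s ^ n)) sums
        (of_real (\<theta> k l) * resolvent_integral p A B \<psi> (r k l) (c k l) s)"
      by (intro sums_mult resolvent_integral_sums \<psi> s)
    thus ?thesis by (simp add: transition_gf_def pow sums_iff mult.assoc)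
  qed
  show "transition_gf P s k l = \<theta> k l * resolvent_integral p A B \<psi> (r k l) (c k l) s" by (rule gf)
  have diag: "transition_gf P s l l = resolvent_integral p A B \<psi> (r l l) (c l l) s"
    using gf[of l l] by (simp add: \<theta>)
  show "first_passage_gf M X s l l = 1 - 1 / resolvent_integral p A B \<psi> (r l l) (c l l) s"
    using first_passage_gf_eq(3)[OF s, of l] by (simp only: diag)
  show "first_passage_gf M X s k l = \<theta> k l *
      (resolvent_integral p A B \<psi> (r k l) (c k l) s / resolvent_integral p A B \<psi> (r l l) (c l l) s)"
    if "k \<noteq> l"
    using first_passage_gf_eq(2)[OF s that] by (simp only: diag gf[of k l] times_divide_eq_right)
qed

end

lemma pi_weights:
  assumes "\<And>n. Q n (Suc n) > 0"
  defines "d \<equiv> \<lambda>n. 1 / (\<Prod>i<n. Q i (i + 1))"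
  shows "d 0 = (1::real)" "d n > 0" "d (Suc n) = d n / Q n (Suc n)"
  using assms by (auto simp: d_def intro!: prod_pos)

text \<open>Partial products of the factorization are stochastic, and entries of stochastic matrices are at most \<open>1\<close>.\<close>

lemma type_II_bidiagonal_factorization:
  assumes p: "p \<ge> 1" and P: "has_PSBF_II p P"
  obtains L U where "bidiagonal_factorization p L U P"
proof -
  from P obtain L U where L: "\<forall>a\<in>{1..p}. lower_bidiagonal_stochastic (L a)"
    and U: "upper_bidiagonal_stochastic U" and eq: "P = smat_prod (map L [1..<p + 1] @ [U])"
    unfolding has_PSBF_II_def by blast
  have L': "stochastic (L a) \<and> row_finite (L a)" if "a \<in> {1..p}" for a
    using L that lower_bidiagonal_stochasticD bidiagonal_row_finite by blast
  have U': "stochastic U \<and> row_finite U"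
    using U upper_bidiagonal_stochasticD bidiagonal_row_finite by blast
  have W: "stochastic (smat_prod (map L [1..<i + 1]))" "row_finite (smat_prod (map L [1..<i + 1]))"
    if "i \<le> p" for i
    by (intro stochastic_prod row_finite_prod; use that L' in force)+
  have "stochastic P" "row_finite P"
    unfolding eq by (intro stochastic_prod row_finite_prod; use L' U' in force)+
  hence "smat_mult (smat_pow P m) (smat_prod (map L [1..<i + 1])) 0 k \<le> 1" if "i \<le> p" for m i k
    by (intro stochastic_le_one stochastic_mult stochastic_pow row_finite_pow W that)
  hence "bidiagonal_factorization p L U P"
    using p L U eq lower_bidiagonal_stochasticD(1) upper_bidiagonal_stochasticD(1)
    by unfold_locales auto
  thus ?thesis by (rule that)
qed

text \<open>Transposition reverses the order of the factors, which turns the factorization of a type I matrix into one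
of the shape required for \<open>Q\<close>. The bound now concerns the first column of the stochastic matrix
\<open>\<Upsilon>\<^sub>i \<cdots> \<Upsilon>\<^sub>1 P\<^sup>m\<close>.\<close>

lemma type_I_bidiagonal_factorization:
  assumes p: "p \<ge> 1" and P: "has_PSBF_I p P"
  obtains L U where "bidiagonal_factorization p L U (smat_transpose P)" "row_finite P"
proof -
  from P obtain L U where L: "lower_bidiagonal_stochastic L"
    and U: "\<forall>a\<in>{1..p}. upper_bidiagonal_stochastic (U a)"
    and eq: "P = smat_prod (L # map U (rev [1..<p + 1]))"
    unfolding has_PSBF_I_def by blast
  define L' where "L' a = smat_transpose (U a)" for a
  have tt: "smat_transpose (smat_transpose A) = A" for A by (simp add: smat_transpose_def fun_eq_iff)
  have U_st: "stochastic (U a) \<and> row_finite (U a)" and L'_pos: "positive_lower_bidiagonal (L' a)"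
    if "a \<in> {1..p}" for a
    using U that upper_bidiagonal_stochasticD bidiagonal_row_finite
    by (auto simp: L'_def bidiagonal_transpose)
  have L_st: "stochastic L \<and> row_finite L" and L_pos: "positive_upper_bidiagonal (smat_transpose L)"
    using L lower_bidiagonal_stochasticD bidiagonal_row_finite by (auto simp: bidiagonal_transpose)
  have P_st: "stochastic P" "row_finite P"
    unfolding eq by (intro stochastic_prod row_finite_prod; use U_st L_st in force)+
  have Q_eq: "smat_transpose P = smat_prod (map L' [1..<p + 1] @ [smat_transpose L])"
  proof -
    have "smat_transpose P = smat_prod (rev (map smat_transpose (L # map U (rev [1..<p + 1]))))"
      unfolding eq
    proof (rule smat_transpose_prod)
      fix A assume "A \<in> set (L # map U (rev [1..<p + 1]))"
      hence "A = L \<or> (\<exists>a\<in>{1..p}. A = U a)" by auto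
      thus "row_finite (smat_transpose A)"
        using L_pos L'_pos bidiagonal_row_finite by (auto simp: L'_def)
    qed
    also have "rev (map smat_transpose (L # map U (rev [1..<p + 1]))) = map L' [1..<p + 1] @ [smat_transpose L]"
      by (simp add: L'_def rev_map o_def del: upt_Suc)
    finally show ?thesis .
  qed
  have "smat_mult (smat_pow (smat_transpose P) m) (smat_prod (map L' [1..<i + 1])) 0 k \<le> 1"
    if i: "i \<le> p" for m i k
  proof -
    let ?V = "smat_prod (rev (map U [1..<i + 1]))"
    have V: "stochastic ?V" "row_finite ?V"
      by (intro stochastic_prod row_finite_prod; use i U_st in force)+
    have "smat_transpose (smat_prod (map L' [1..<i + 1])) = smat_prod (rev (map smat_transpose (map L' [1..<i + 1])))"
      by (rule smat_transpose_prod) (use i U_st in \<open>auto simp: L'_def tt\<close>)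
    also have "map smat_transpose (map L' [1..<i + 1]) = map U [1..<i + 1]" by (simp add: L'_def tt)
    finally have "smat_transpose ?V = smat_prod (map L' [1..<i + 1])" by (metis tt)
    hence "smat_mult (smat_pow (smat_transpose P) m) (smat_prod (map L' [1..<i + 1])) =
        smat_transpose (smat_mult ?V (smat_pow P m))"
      by (simp only: smat_transpose_mult smat_transpose_pow[OF P_st(2)])
    moreover have "smat_mult ?V (smat_pow P m) k 0 \<le> 1"
      by (intro stochastic_le_one stochastic_mult stochastic_pow P_st V)
    ultimately show ?thesis by (simp add: smat_transpose_def)
  qed
  hence "bidiagonal_factorization p L' (smat_transpose L) (smat_transpose P)"
    using p L'_pos L_pos Q_eq by unfold_locales auto
  thus ?thesis using P_st(2) by (rule that)
qed

lemma type_II_case: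
  fixes p :: nat and P T :: smat and M :: "nat \<Rightarrow> 'w measure"
  assumes p: "p \<ge> 1" and chain: "markov_chain P M X" and P: "type_II_stochastic p P"
    and fact: "has_PSBF_II p P" and hess: "hessenberg_II P T"
  defines "B \<equiv> type_II_poly p T"
  shows "\<exists>\<nu> A \<psi>. initial_condition_matrix p \<nu> \<and> type_I_polys p T \<nu> A \<and>
         (\<forall>a\<in>{1..p}. stieltjes_01 (\<psi> a)) \<and> multiple_orthogonal p A B \<psi> \<and>
         (\<forall>n k l. smat_pow P n k l =
            Theta_II P k l * form_integral p A \<psi> l (\<lambda>x. x ^ n * poly (B k) x)) \<and>
         (\<forall>s k l. norm s < 1 \<longrightarrow>
            transition_gf P s k l = Theta_II P k l * resolvent_integral p A B \<psi> l k s \<and>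
            (k \<noteq> l \<longrightarrow> first_passage_gf M X s k l =
               Theta_II P k l * (resolvent_integral p A B \<psi> l k s / resolvent_integral p A B \<psi> l l s)) \<and>
            first_passage_gf M X s l l = 1 - 1 / resolvent_integral p A B \<psi> l l s) \<and>
         (recurrent M X \<longleftrightarrow> integral_diverges (\<psi> 1)) \<and>
         (\<not> integral_diverges (\<psi> 1) \<longrightarrow> transient M X)"
proof -
  obtain L U where "bidiagonal_factorization p L U P"
    using type_II_bidiagonal_factorization[OF p fact] .
  then interpret bidiagonal_factorization p L U P .
  interpret stochastic_chain P M X
    by unfold_locales (use chain P Q_row_finite in \<open>auto simp: type_II_stochastic_def\<close>)
  note d = pi_weights[of P, OF Q_superdiag, folded pi_II_def]
  have dn: "pi_II P n \<noteq> 0" for n using d(2)[of n] by simp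
  have T: "T i j = P i j * pi_II P j / pi_II P i" for i j
  proof -
    have "P i j = pi_II P i * T i j * inverse (pi_II P j)"
      using hess unfolding hessenberg_II_def by (metis smat_diag_conjugate)
    thus ?thesis using dn by (simp add: field_simps)
  qed
  obtain \<nu> A \<psi> where \<nu>: "initial_condition_matrix p \<nu>" and A: "type_I_polys p T \<nu> A"
    and \<psi>: "\<forall>a\<in>{1..p}. stieltjes_01 (\<psi> a)"
    and form: "\<And>n k l. form_integral p A \<psi> l (\<lambda>x. x ^ n * poly (B k) x) = smat_pow T n k l"
    and div: "integral_diverges (\<psi> 1) \<longleftrightarrow> \<not> summable (\<lambda>n. smat_pow P n 0 0)"
    using spectral_favard[OF T d(2) d(3) d(1)] unfolding B_def by blast
  have orth: "multiple_orthogonal p A B \<psi>"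
    using form[of _ 0] by (auto simp: multiple_orthogonal_def smat_one_def)
  have KM: "smat_pow P n k l = Theta_II P k l * form_integral p A \<psi> l (\<lambda>x. x ^ n * poly (B k) x)" for n k l
    unfolding form scaled_pow(2)[OF T d(2)] Theta_II_def using dn by simp
  have \<theta>: "Theta_II P l l = 1" for l using dn by (simp add: Theta_II_def)
  note gf = spectral_generating_functions[of p \<psi> _ "Theta_II P" A "\<lambda>k l. l" B "\<lambda>k l. k", OF bspec[OF \<psi>] _ KM \<theta>]
  note rec = recurrence_dichotomy[OF Q_superdiag Q_subdiag]
  show ?thesis
  proof (intro exI[of _ \<nu>] exI[of _ A] exI[of _ \<psi>] conjI allI impI)
    fix n k l :: nat
    show "smat_pow P n k l = Theta_II P k l * form_integral p A \<psi> l (\<lambda>x. x ^ n * poly (B k) x)"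
      by (rule KM)
    fix s :: complex assume s: "norm s < 1"
    show "transition_gf P s k l = Theta_II P k l * resolvent_integral p A B \<psi> l k s"
      by (rule gf(1)[OF _ s])
    show "first_passage_gf M X s l l = 1 - 1 / resolvent_integral p A B \<psi> l l s"
      by (rule gf(3)[OF _ s])
    assume "k \<noteq> l"
    show "first_passage_gf M X s k l =
        Theta_II P k l * (resolvent_integral p A B \<psi> l k s / resolvent_integral p A B \<psi> l l s)"
      by (rule gf(2)[OF _ s \<open>k \<noteq> l\<close>])
  next
    show "recurrent M X \<longleftrightarrow> integral_diverges (\<psi> 1)" by (simp only: rec(1) div)
    show "transient M X" if "\<not> integral_diverges (\<psi> 1)" using that rec(2) div by blast
  qed (use \<nu> A \<psi> orth in simp_all)
qed

lemma type_I_case: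
  fixes p :: nat and P T :: smat and M :: "nat \<Rightarrow> 'w measure"
  assumes p: "p \<ge> 1" and chain: "markov_chain P M X" and P: "type_I_stochastic p P"
    and fact: "has_PSBF_I p P" and hess: "hessenberg_I P T"
  defines "B \<equiv> type_II_poly p T"
  shows "\<exists>\<nu> A \<psi>. initial_condition_matrix p \<nu> \<and> type_I_polys p T \<nu> A \<and>
         (\<forall>a\<in>{1..p}. stieltjes_01 (\<psi> a)) \<and> multiple_orthogonal p A B \<psi> \<and>
         (\<forall>n k l. smat_pow P n k l =
            Theta_I P l k * form_integral p A \<psi> k (\<lambda>x. x ^ n * poly (B l) x)) \<and>
         (\<forall>s k l. norm s < 1 \<longrightarrow>
            transition_gf P s k l = Theta_I P l k * resolvent_integral p A B \<psi> k l s \<and>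
            (k \<noteq> l \<longrightarrow> first_passage_gf M X s k l =
               Theta_I P l k * (resolvent_integral p A B \<psi> k l s / resolvent_integral p A B \<psi> l l s)) \<and>
            first_passage_gf M X s l l = 1 - 1 / resolvent_integral p A B \<psi> l l s) \<and>
         (recurrent M X \<longleftrightarrow> integral_diverges (\<psi> 1)) \<and>
         (\<not> integral_diverges (\<psi> 1) \<longrightarrow> transient M X)"
proof -
  let ?Q = "smat_transpose P"
  obtain L U where fac: "bidiagonal_factorization p L U ?Q" and fin: "row_finite P"
    using type_I_bidiagonal_factorization[OF p fact] .
  interpret bidiagonal_factorization p L U ?Q by (rule fac)
  interpret stochastic_chain P M X
    by unfold_locales (use chain P fin in \<open>auto simp: type_I_stochastic_def\<close>)
  have pi_I: "1 / (\<Prod>i<n. ?Q i (i + 1)) = pi_I P n" for n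
    by (simp add: pi_I_def smat_transpose_def)
  note d = pi_weights[of ?Q, OF Q_superdiag, unfolded pi_I]
  have dn: "pi_I P n \<noteq> 0" for n using d(2)[of n] by simp
  have T: "T i j = ?Q i j * pi_I P j / pi_I P i" for i j
  proof -
    have "P j i = inverse (pi_I P j) * smat_transpose T j i * pi_I P i"
      using hess unfolding hessenberg_I_def by (metis smat_diag_conjugate)
    thus ?thesis using dn by (simp add: smat_transpose_def field_simps)
  qed
  have pow: "smat_pow ?Q n i j = smat_pow P n j i" for n i j
    by (simp add: smat_transpose_pow[OF fin, symmetric] smat_transpose_def)
  obtain \<nu> A \<psi> where \<nu>: "initial_condition_matrix p \<nu>" and A: "type_I_polys p T \<nu> A"
    and \<psi>: "\<forall>a\<in>{1..p}. stieltjes_01 (\<psi> a)"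
    and form: "\<And>n k l. form_integral p A \<psi> l (\<lambda>x. x ^ n * poly (B k) x) = smat_pow T n k l"
    and div: "integral_diverges (\<psi> 1) \<longleftrightarrow> \<not> summable (\<lambda>n. smat_pow P n 0 0)"
    using spectral_favard[OF T d(2) d(3) d(1)] unfolding B_def pow by blast
  have orth: "multiple_orthogonal p A B \<psi>"
    using form[of _ 0] by (auto simp: multiple_orthogonal_def smat_one_def)
  have KM: "smat_pow P n k l = Theta_I P l k * form_integral p A \<psi> k (\<lambda>x. x ^ n * poly (B l) x)" for n k l
    unfolding form scaled_pow(2)[OF T d(2)] Theta_I_def pow using dn by simp
  have \<theta>: "Theta_I P l l = 1" for l using dn by (simp add: Theta_I_def)
  note gf = spectral_generating_functions[of p \<psi> _ "\<lambda>k l. Theta_I P l k" A "\<lambda>k l. k" B "\<lambda>k l. l", OF bspec[OF \<psi>] _ KM \<theta>]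
  have "P n (Suc n) > 0" "P (Suc n) n > 0" for n
    using Q_subdiag[of n] Q_superdiag[of n] by (simp_all add: smat_transpose_def)
  note rec = recurrence_dichotomy[OF this]
  show ?thesis
  proof (intro exI[of _ \<nu>] exI[of _ A] exI[of _ \<psi>] conjI allI impI)
    fix n k l :: nat
    show "smat_pow P n k l = Theta_I P l k * form_integral p A \<psi> k (\<lambda>x. x ^ n * poly (B l) x)"
      by (rule KM)
    fix s :: complex assume s: "norm s < 1"
    show "transition_gf P s k l = Theta_I P l k * resolvent_integral p A B \<psi> k l s"
      by (rule gf(1)[OF _ s])
    show "first_passage_gf M X s l l = 1 - 1 / resolvent_integral p A B \<psi> l l s"
      by (rule gf(3)[OF _ s])
    assume "k \<noteq> l"
    show "first_passage_gf M X s k l =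
        Theta_I P l k * (resolvent_integral p A B \<psi> k l s / resolvent_integral p A B \<psi> l l s)"
      by (rule gf(2)[OF _ s \<open>k \<noteq> l\<close>])
  next
    show "recurrent M X \<longleftrightarrow> integral_diverges (\<psi> 1)" by (simp only: rec(1) div)
    show "transient M X" if "\<not> integral_diverges (\<psi> 1)" using that rec(2) div by blast
  qed (use \<nu> A \<psi> orth in simp_all)
qed

theorem theorem11:
  fixes p :: nat and P T :: smat
    and M :: "nat \<Rightarrow> 'w measure" and X :: "nat \<Rightarrow> 'w \<Rightarrow> nat" and B :: "nat \<Rightarrow> real poly"
  assumes "p \<ge> 1"
    and "markov_chain P M X"
    and "B = type_II_poly p T"
  shows "(type_II_stochastic p P \<and> has_PSBF_II p P \<and> hessenberg_II P T \<longrightarrow>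
      (\<exists>\<nu> A \<psi>. initial_condition_matrix p \<nu> \<and> type_I_polys p T \<nu> A \<and>
         (\<forall>a\<in>{1..p}. stieltjes_01 (\<psi> a)) \<and> multiple_orthogonal p A B \<psi> \<and>
         (\<forall>n k l. smat_pow P n k l =
            Theta_II P k l * form_integral p A \<psi> l (\<lambda>x. x ^ n * poly (B k) x)) \<and>
         (\<forall>s k l. norm s < 1 \<longrightarrow>
            transition_gf P s k l = Theta_II P k l * resolvent_integral p A B \<psi> l k s \<and>
            (k \<noteq> l \<longrightarrow> first_passage_gf M X s k l =
               Theta_II P k l * (resolvent_integral p A B \<psi> l k s / resolvent_integral p A B \<psi> l l s)) \<and>
            first_passage_gf M X s l l = 1 - 1 / resolvent_integral p A B \<psi> l l s) \<and>
         (recurrent M X \<longleftrightarrow> integral_diverges (\<psi> 1)) \<and>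
         (\<not> integral_diverges (\<psi> 1) \<longrightarrow> transient M X))) \<and>
    (type_I_stochastic p P \<and> has_PSBF_I p P \<and> hessenberg_I P T \<longrightarrow>
      (\<exists>\<nu> A \<psi>. initial_condition_matrix p \<nu> \<and> type_I_polys p T \<nu> A \<and>
         (\<forall>a\<in>{1..p}. stieltjes_01 (\<psi> a)) \<and> multiple_orthogonal p A B \<psi> \<and>
         (\<forall>n k l. smat_pow P n k l =
            Theta_I P l k * form_integral p A \<psi> k (\<lambda>x. x ^ n * poly (B l) x)) \<and>
         (\<forall>s k l. norm s < 1 \<longrightarrow>
            transition_gf P s k l = Theta_I P l k * resolvent_integral p A B \<psi> k l s \<and>
            (k \<noteq> l \<longrightarrow> first_passage_gf M X s k l =
               Theta_I P l k * (resolvent_integral p A B \<psi> k l s / resolvent_integral p A B \<psi> l l s)) \<and>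
            first_passage_gf M X s l l = 1 - 1 / resolvent_integral p A B \<psi> l l s) \<and>
         (recurrent M X \<longleftrightarrow> integral_diverges (\<psi> 1)) \<and>
         (\<not> integral_diverges (\<psi> 1) \<longrightarrow> transient M X)))"
  using type_II_case[OF assms(1,2)] type_I_case[OF assms(1,2)]
  unfolding assms(3) by blast

end
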